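(* The set $\mathcal F_0([0,1]^5\setminus\mathbb Q^5)$ is $\Game\boldsymbol\Sigma^0_2$-hard.
   Context: All spaces are separable metrizable. A space is zero-dimensional if it has a basis of clopen sets; the empty space counts as zero-dimensional. $\boldsymbol\Sigma^0_2$ is the class of $F_\sigma$ sets. $\mathcal F(X)$ is the set of all closed subsets of $X$, and $\mathcal F_0(X)\subset\mathcal F(X)$ is the set of all zero-dimensional closed subsets of $X$. $\mathcal F(X)$ is endowed with an admissible topology: take a compact metrizable space $\hat X\supset X$ (with $X$ a subspace, not necessarily dense), identify $F\in\mathcal F(X)$ with its closure $\overline F$ in $\hat X$, and give $\mathcal F(X)$ the topology induced by the Vietoris (Hausdorff metric) topology on the compact subsets of $\hat X$; an admissible topology is one obtained in this way from some $\hat X$. Game classes: for $A\subset\omega^\omega$, $\mathbf G_A$ is the game in which Players I and II alternately choose $n_0$ (I), $n_1$ (II), $n_2$ (I), $\dots$ in $\omega$, and Player I wins iff $(n_0,n_1,n_2,\dots)\in A$. For a Polish space $Z$ and $B\subset Z\times\omega^\omega$ put $B(z)=\{\gamma:(z,\gamma)\in B\}$ and $\Game B=\{z\in Z:\text{Player I has a winning strategy in }\mathbf G_{B(z)}\}$. A set $A\subset Z$ is in $\Game\Gamma$ if $A=\Game B$ for some $B\subset Z\times\omega^\omega$ in $\Gamma$. For a class $\Gamma$, $\mathcal F_0(X)$ is $\Gamma$-hard if for every $A\subset 2^\omega$ in $\Gamma$ there is a continuous $\varphi:2^\omega\to\mathcal F(X)$ with $A=\varphi^{-1}(\mathcal F_0(X))$.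 *)

theory Defs
  imports "HOL-Analysis.Analysis"
begin

definition zero_dimensional :: "'a topology \<Rightarrow> bool" where
  "zero_dimensional X \<longleftrightarrow>
     (\<exists>\<B>. (\<forall>U\<in>\<B>. openin X U \<and> closedin X U) \<and> openin X = arbitrary union_of (\<lambda>U. U \<in> \<B>))"

lemma zero_dimensional_iff_dim_le_0: "zero_dimensional X \<longleftrightarrow> X dim_le 0"
proof -
  have "zero_dimensional X \<longleftrightarrow>
      (\<forall>W x. openin X W \<and> x \<in> W \<longrightarrow> (\<exists>U. (closedin X U \<and> openin X U) \<and> x \<in> U \<and> U \<subseteq> W))"
    (is "?L \<longleftrightarrow> ?R")
  proof
    show ?R if ?L
      using that unfolding zero_dimensional_def openin_topology_base_unique by blast
    show ?L if ?R
      using that unfolding zero_dimensional_def openin_topology_base_unique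
      by (intro exI[of _ "{U. closedin X U \<and> openin X U}"]) simp
  qed
  also have "\<dots> \<longleftrightarrow> neighbourhood_base_of (\<lambda>U. closedin X U \<and> openin X U) X"
    by (rule open_neighbourhood_base_of [symmetric]) simp
  also have "\<dots> \<longleftrightarrow> X dim_le 0"
    by (rule dimension_le_0_neighbourhood_base_of_clopen [symmetric])
  finally show ?thesis .
qed

definition closed_sets :: "'a topology \<Rightarrow> 'a set set" where
  "closed_sets X = {F. closedin X F}"

definition zero_dim_closed_sets :: "'a topology \<Rightarrow> 'a set set" where
  "zero_dim_closed_sets X = {F \<in> closed_sets X. zero_dimensional (subtopology X F)}"

text \<open>The empty set is a point of the Vietoris hyperspace, and it is isolated (take \<open>U = {}\<close>
  in the first family of subbasic sets).\<close>

definition vietoris :: "'a topology \<Rightarrow> 'a set topology" where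
  "vietoris K =
     subtopology
       (topology_generated_by
          ({{C. C \<subseteq> U} | U. openin K U} \<union> {{C. C \<inter> U \<noteq> {}} | U. openin K U}))
       {C. compactin K C}"

lemma topspace_vietoris: "topspace (vietoris K) = {C. compactin K C}"
proof -
  have "C \<in> topspace (topology_generated_by
          ({{C. C \<subseteq> U} | U. openin K U} \<union> {{C. C \<inter> U \<noteq> {}} | U. openin K U}))"
    if "compactin K C" for C
    unfolding topology_generated_by_topspace
  proof (rule UnionI)
    show "{C. C \<subseteq> topspace K} \<in> {{C. C \<subseteq> U} | U. openin K U} \<union> {{C. C \<inter> U \<noteq> {}} | U. openin K U}"
      by (intro UnI1 CollectI exI[of _ "topspace K"]) simp
    show "C \<in> {C. C \<subseteq> topspace K}"
      using compactin_subset_topspace[OF that] by simp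
  qed
  then show ?thesis
    unfolding vietoris_def topspace_subtopology by blast
qed

text \<open>The admissible topology on the closed subsets of \<open>X\<close> given by a compact metrizable space
  \<open>K\<close> containing \<open>X\<close>. The inclusion of \<open>X\<close> in \<open>K\<close> is an embedding \<open>e\<close>, whose image need not be
  dense.\<close>

definition admissible_topology :: "'a topology \<Rightarrow> 'k topology \<Rightarrow> ('a \<Rightarrow> 'k) \<Rightarrow> 'a set topology" where
  "admissible_topology X K e =
     pullback_topology (closed_sets X) (\<lambda>F. K closure_of (e ` F)) (vietoris K)"

lemma topspace_admissible_topology:
  assumes "compact_space K"
  shows "topspace (admissible_topology X K e) = closed_sets X"
  using assms
  by (auto simp: admissible_topology_def topspace_pullback_topology topspace_vietoris
      closedin_compact_space)

text \<open>\<open>\<gamma> n\<close> is the \<open>n\<close>-th move, and Player I makes the even-numbered ones. A strategy for Player I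
  maps each position at which he has to move (the list of all moves made so far) to his next move.\<close>

definition player_I_wins :: "(nat \<Rightarrow> nat) set \<Rightarrow> bool" where
  "player_I_wins A \<longleftrightarrow>
     (\<exists>\<sigma> :: nat list \<Rightarrow> nat.
        \<forall>\<gamma>. (\<forall>k. \<gamma> (2 * k) = \<sigma> (map \<gamma> [0..<2 * k])) \<longrightarrow> \<gamma> \<in> A)"

definition game_set :: "'z set \<Rightarrow> ('z \<times> (nat \<Rightarrow> nat)) set \<Rightarrow> 'z set" where
  "game_set Z B = {z \<in> Z. player_I_wins {\<gamma>. (z, \<gamma>) \<in> B}}"

abbreviation baire_space :: "(nat \<Rightarrow> nat) topology" where
  "baire_space \<equiv> product_topology (\<lambda>_. discrete_topology UNIV) UNIV"

abbreviation cantor_space :: "(nat \<Rightarrow> bool) topology" where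
  "cantor_space \<equiv> product_topology (\<lambda>_. discrete_topology UNIV) UNIV"

text \<open>A pointclass is represented by a predicate \<open>\<Gamma>\<close> such that \<open>\<Gamma> X A\<close> says that \<open>A\<close> is a subset of
  the space \<open>X\<close> belonging to the class; for instance \<^const>\<open>fsigma_in\<close> is the class of
  \<open>F\<^sub>\<sigma>\<close> sets.\<close>

definition game_class ::
  "(('z \<times> (nat \<Rightarrow> nat)) topology \<Rightarrow> ('z \<times> (nat \<Rightarrow> nat)) set \<Rightarrow> bool) \<Rightarrow>
   'z topology \<Rightarrow> 'z set \<Rightarrow> bool" where
  "game_class \<Gamma> Z A \<longleftrightarrow>
     (\<exists>B. B \<subseteq> topspace (prod_topology Z baire_space) \<and> \<Gamma> (prod_topology Z baire_space) B \<and>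
          A = game_set (topspace Z) B)"

definition hard_for ::
  "((nat \<Rightarrow> bool) topology \<Rightarrow> (nat \<Rightarrow> bool) set \<Rightarrow> bool) \<Rightarrow> 'b topology \<Rightarrow> 'b set \<Rightarrow> bool" where
  "hard_for \<Gamma> T S \<longleftrightarrow>
     (\<forall>A. \<Gamma> cantor_space A \<longrightarrow> (\<exists>\<phi>. continuous_map cantor_space T \<phi> \<and> A = \<phi> -` S))"

definition cube_minus_rationals :: "(real ^ 5) topology" where
  "cube_minus_rationals =
     top_of_set ({x. \<forall>i. x $ i \<in> {0..1}} - {x. \<forall>i. x $ i \<in> \<rat>})"

end

theory Submission
  imports Defs "HOL-Library.Nat_Bijection" "HOL-Library.Countable" "HOL-Computational_Algebra.Polynomial"
begin

text \<open>
  A position is coloured when, along the play, a new closed piece of the \<open>F\<^sub>\<sigma>\<close> set is left; Player I wins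
  iff he can force only finitely many coloured positions. To such a colouring we attach a self-similar
  compact subset of the space, a graph-like continuum from \<open>src\<close> to \<open>tgt\<close> with hub, spokes and countably
  many small copies of cells. A clopen partition separating \<open>src\<close> from \<open>tgt\<close> after the removal of a
  countable set of points on the spokes has to choose, at each position, a move \<open>i\<close> of Player I where
  the spokes \<open>uspoke s i\<close> and \<open>uspoke s (Suc i)\<close> are separated; answers of Player II then lead into a cut
  smaller copy precisely when a coloured position is reached, and an infinite chain of nested cut copies
  is impossible. Conversely a winning strategy describes clopen partitions. Thus the continuum minus the
  countable set is zero-dimensional iff Player I wins. It is embedded in \<open>[0,1]\<^sup>5\<close> so that exactly the
  countable set has rational coordinates. Finally isolated points are added which make the closures in
  the compactification \<open>K\<close> depend continuously on the parameter.
\<close>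

text \<open>Nested cut copies of all depths are impossible because their common point lies in cells
  of every depth. Such points are never removed, so this point belongs to the set, and a locally
  constant function cannot separate the ends of arbitrarily small cells around it. Only the copies
  along \<open>Co s\<close> remember a position; all other copies restart the game at
  \<open>[]\<close>. Hence one winning strategy cuts copies of every label. Conversely, by the same
  chain argument some separated restarted copy contains no smaller one, and the game is played
  inside it: there no side changes along the edges whose copies restart. The hub is removed so that
  different spokes may lie on different sides; the further removed points let a partition follow a
  hyperplane across the spokes. The continuum needs three coordinates. Each is perturbed to be
  rational on the removed points. This may make countably many other points rational as well, and a
  fourth coordinate is irrational at those. The fifth is constant.\<close>

section \<open>Games played in rounds and the colouring of positions\<close>

primrec round_list :: "(nat \<Rightarrow> nat) \<Rightarrow> nat \<Rightarrow> (nat \<times> nat) list" where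
  "round_list \<gamma> 0 = []"
| "round_list \<gamma> (Suc n) = (\<gamma> (2 * n), \<gamma> (Suc (2 * n))) # round_list \<gamma> n"

lemma length_round_list [simp]: "length (round_list \<gamma> n) = n"
  by (induction n) auto

lemma round_list_cong:
  "(\<And>i. i < 2 * n \<Longrightarrow> \<gamma> i = \<gamma>' i) \<Longrightarrow> round_list \<gamma> n = round_list \<gamma>' n"
  by (induction n) auto

lemma round_list_eqD:
  "round_list \<gamma> n = round_list \<gamma>' n \<Longrightarrow> i < 2 * n \<Longrightarrow> \<gamma> i = \<gamma>' i"
proof (induction n)
  case (Suc n)
  then consider "i < 2 * n" | "i = 2 * n" | "i = Suc (2 * n)" by fastforce
  then show ?case using Suc by cases auto
qed simp

primrec flatten_rounds :: "(nat \<times> nat) list \<Rightarrow> nat list" where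
  "flatten_rounds [] = []"
| "flatten_rounds (x # p) = flatten_rounds p @ [fst x, snd x]"

lemma flatten_round_list: "flatten_rounds (round_list \<gamma> n) = map \<gamma> [0..<2 * n]"
  by (induction n) auto

text \<open>Player I moves only after complete rounds, so a position at which he moves and its list
  of rounds determine each other, and strategies translate in both directions.\<close>

lemma player_I_wins_iff_rounds:
  "player_I_wins A \<longleftrightarrow>
    (\<exists>f. \<forall>\<gamma>. (\<forall>k. \<gamma> (2 * k) = f (round_list \<gamma> k)) \<longrightarrow> \<gamma> \<in> A)"
proof
  assume "player_I_wins A"
  then obtain \<sigma> where \<sigma>: "\<And>\<gamma>. (\<forall>k. \<gamma> (2 * k) = \<sigma> (map \<gamma> [0..<2 * k])) \<Longrightarrow> \<gamma> \<in> A"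
    unfolding player_I_wins_def by blast
  show "\<exists>f. \<forall>\<gamma>. (\<forall>k. \<gamma> (2 * k) = f (round_list \<gamma> k)) \<longrightarrow> \<gamma> \<in> A"
    by (rule exI[of _ "\<lambda>p. \<sigma> (flatten_rounds p)"]) (auto simp: flatten_round_list intro!: \<sigma>)
next
  assume "\<exists>f. \<forall>\<gamma>. (\<forall>k. \<gamma> (2 * k) = f (round_list \<gamma> k)) \<longrightarrow> \<gamma> \<in> A"
  then obtain f where f: "\<And>\<gamma>. (\<forall>k. \<gamma> (2 * k) = f (round_list \<gamma> k)) \<Longrightarrow> \<gamma> \<in> A"
    by blast
  have "round_list (nth (map \<gamma> [0..<2 * k])) k = round_list \<gamma> k" for \<gamma> k
    by (rule round_list_cong) simp
  then show "player_I_wins A"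
    unfolding player_I_wins_def
    by (intro exI[of _ "\<lambda>l. f (round_list (nth l) (length l div 2))"]) (auto intro!: f)
qed

text \<open>The colours of the positions turn an \<open>F\<^sub>\<sigma>\<close> payoff into a co-Buechi condition:
  Player I wins a play iff it has only finitely many coloured positions. A position is a list of
  rounds, the last round first.\<close>

definition colour_win :: "((nat \<times> nat) list \<Rightarrow> bool) \<Rightarrow> ((nat \<times> nat) list \<Rightarrow> nat) \<Rightarrow> bool" where
  "colour_win c f \<longleftrightarrow>
    (\<forall>\<gamma>. (\<forall>k. \<gamma> (2 * k) = f (round_list \<gamma> k)) \<longrightarrow>
      (\<exists>n0. \<forall>n\<ge>n0. \<not> c (round_list \<gamma> (Suc n))))"

text \<open>The parameter \<open>z\<close> is read only up to the length of the position. So the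
  colour of a position depends on finitely many entries of \<open>z\<close>, as a continuous
  reduction requires.\<close>

definition cylinder_meets ::
  "((nat \<Rightarrow> bool) \<times> (nat \<Rightarrow> nat)) set \<Rightarrow> (nat \<Rightarrow> bool) \<Rightarrow> (nat \<times> nat) list \<Rightarrow> bool" where
  "cylinder_meets C z p \<longleftrightarrow>
    (\<exists>z' \<gamma>. (z', \<gamma>) \<in> C \<and> (\<forall>n<length p. z' n = z n) \<and> round_list \<gamma> (length p) = p)"

text \<open>The index of the closed set in which the play is currently supposed to stay. It moves on
  by one as soon as the finite information about parameter and play no longer meets that
  set.\<close>

primrec stage :: "(nat \<Rightarrow> ((nat \<Rightarrow> bool) \<times> (nat \<Rightarrow> nat)) set) \<Rightarrow> (nat \<Rightarrow> bool) \<Rightarrow> (nat \<times> nat) list \<Rightarrow> nat" where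
  "stage C z [] = 0"
| "stage C z (x # p) =
    (if cylinder_meets (C (stage C z p)) z (x # p) then stage C z p else Suc (stage C z p))"

definition colour :: "(nat \<Rightarrow> ((nat \<Rightarrow> bool) \<times> (nat \<Rightarrow> nat)) set) \<Rightarrow> (nat \<Rightarrow> bool) \<Rightarrow> (nat \<times> nat) list \<Rightarrow> bool" where
  "colour C z p \<longleftrightarrow> p \<noteq> [] \<and> stage C z p \<noteq> stage C z (tl p)"

lemma cylinder_meets_cong:
  "(\<And>n. n < length p \<Longrightarrow> z n = z' n) \<Longrightarrow> cylinder_meets C z p = cylinder_meets C z' p"
  unfolding cylinder_meets_def by (simp cong: conj_cong)

lemma stage_cong: "(\<And>n. n < length p \<Longrightarrow> z n = z' n) \<Longrightarrow> stage C z p = stage C z' p"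
proof (induction p)
  case (Cons x p)
  then have "stage C z p = stage C z' p" by simp
  moreover have "cylinder_meets (C (stage C z p)) z (x # p) = cylinder_meets (C (stage C z p)) z' (x # p)"
    using Cons.prems by (intro cylinder_meets_cong)
  ultimately show ?case by simp
qed simp

lemma colour_cong: "(\<And>n. n < length p \<Longrightarrow> z n = z' n) \<Longrightarrow> colour C z p = colour C z' p"
  unfolding colour_def using stage_cong[of p z z' C] stage_cong[of "tl p" z z' C] by auto

lemma openin_discrete_product_cylinder:
  fixes U :: "(nat \<Rightarrow> 'a) set"
  assumes "openin (product_topology (\<lambda>_. discrete_topology UNIV) UNIV) U" "x \<in> U"
  obtains N where "\<And>y. (\<And>n. n < N \<Longrightarrow> y n = x n) \<Longrightarrow> y \<in> U"
proof -
  have "\<exists>X. finite {i \<in> UNIV. X i \<noteq> topspace (discrete_topology UNIV)} \<and>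
      (\<forall>i\<in>UNIV. openin (discrete_topology UNIV) (X i)) \<and> x \<in> Pi\<^sub>E UNIV X \<and> Pi\<^sub>E UNIV X \<subseteq> U"
    using assms unfolding openin_product_topology_alt by blast
  then obtain X where X: "finite {i. X i \<noteq> UNIV}" "x \<in> Pi\<^sub>E UNIV X" "Pi\<^sub>E UNIV X \<subseteq> U"
    unfolding topspace_discrete_topology by (elim exE conjE) simp
  obtain N where N: "{i. X i \<noteq> UNIV} \<subseteq> {..<N}"
    using X(1) finite_nat_iff_bounded by blast
  show thesis
  proof (rule that[of N])
    fix y assume y: "\<And>n. n < N \<Longrightarrow> y n = x n"
    have "y i \<in> X i" for i
    proof (cases "i < N")
      case True
      then show ?thesis using y PiE_mem[OF X(2), of i] by simp
    next
      case False
      then have "X i = UNIV" using N by blast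
      then show ?thesis by simp
    qed
    then have "y \<in> Pi\<^sub>E UNIV X" by (simp add: PiE_iff)
    then show "y \<in> U" using X(3) by blast
  qed
qed

lemma openin_discrete_product_if_cylinder:
  fixes U :: "(nat \<Rightarrow> 'a) set"
  assumes "\<And>x. x \<in> U \<Longrightarrow> \<exists>N. \<forall>y. (\<forall>n<N. y n = x n) \<longrightarrow> y \<in> U"
  shows "openin (product_topology (\<lambda>_. discrete_topology UNIV) UNIV) U"
  unfolding openin_product_topology_alt
proof (clarify)
  fix x assume "x \<in> U"
  then obtain N where N: "\<forall>y. (\<forall>n<N. y n = x n) \<longrightarrow> y \<in> U" using assms by blast
  show "\<exists>X. finite {i \<in> UNIV. X i \<noteq> topspace (discrete_topology UNIV)} \<and>
      (\<forall>i\<in>UNIV. openin (discrete_topology UNIV) (X i)) \<and> x \<in> Pi\<^sub>E UNIV X \<and> Pi\<^sub>E UNIV X \<subseteq> U"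
  proof (intro exI conjI)
    show "finite {i \<in> UNIV. (if i < N then {x i} else UNIV) \<noteq> topspace (discrete_topology UNIV)}"
      by (rule finite_subset[of _ "{..<N}"]) auto
    show "Pi\<^sub>E UNIV (\<lambda>i. if i < N then {x i} else UNIV) \<subseteq> U"
    proof
      fix y assume "y \<in> Pi\<^sub>E UNIV (\<lambda>i. if i < N then {x i} else UNIV)"
      then have "y i \<in> (if i < N then {x i} else UNIV)" for i by (rule PiE_mem) simp
      then have "\<forall>n<N. y n = x n" by (metis singletonD)
      then show "y \<in> U" using N by blast
    qed
  qed auto
qed

lemma closedin_if_cylinders_meet:
  assumes "closedin (prod_topology cantor_space baire_space) C"
    and "\<And>n. cylinder_meets C z (round_list \<gamma> n)"
  shows "(z, \<gamma>) \<in> C"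
proof (rule ccontr)
  let ?P = "prod_topology cantor_space baire_space"
  assume "(z, \<gamma>) \<notin> C"
  then have "openin ?P (topspace ?P - C)" "(z, \<gamma>) \<in> topspace ?P - C"
    using assms(1) by (auto simp: closedin_def)
  then obtain V W where VW: "openin cantor_space V" "openin baire_space W" "z \<in> V" "\<gamma> \<in> W"
      "V \<times> W \<subseteq> topspace ?P - C"
    unfolding openin_prod_topology_alt by metis
  obtain N where N: "\<And>y. (\<And>n. n < N \<Longrightarrow> y n = z n) \<Longrightarrow> y \<in> V"
    using openin_discrete_product_cylinder[OF VW(1,3)] by blast
  obtain M where M: "\<And>y. (\<And>n. n < M \<Longrightarrow> y n = \<gamma> n) \<Longrightarrow> y \<in> W"
    using openin_discrete_product_cylinder[OF VW(2,4)] by blast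
  obtain z' \<gamma>' where *: "(z', \<gamma>') \<in> C" "\<forall>n<N + M. z' n = z n"
      "round_list \<gamma>' (N + M) = round_list \<gamma> (N + M)"
    using assms(2)[of "N + M"] unfolding cylinder_meets_def by auto
  have "z' \<in> V" using *(2) by (intro N) auto
  moreover have "\<gamma>' \<in> W" using round_list_eqD[OF *(3)] by (intro M) auto
  ultimately show False using VW(5) *(1) by auto
qed

text \<open>If the play lies in \<open>C m\<close>, its stage can never pass \<open>m\<close>, so it
  changes only finitely often. If the stage is eventually constant, all cylinders of the play meet
  one and the same closed set, which therefore contains it.\<close>

lemma mem_fsigma_iff_finitely_many_colours:
  assumes "\<And>n. closedin (prod_topology cantor_space baire_space) (C n)"
  shows "(z, \<gamma>) \<in> (\<Union>n. C n) \<longleftrightarrow> (\<exists>n0. \<forall>n\<ge>n0. \<not> colour C z (round_list \<gamma> (Suc n)))"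
proof
  assume "(z, \<gamma>) \<in> (\<Union>n. C n)"
  then obtain m where m: "(z, \<gamma>) \<in> C m" unfolding UN_iff by (rule bexE)
  have meets: "cylinder_meets (C m) z (round_list \<gamma> n)" for n
    unfolding cylinder_meets_def using m by (intro exI[of _ z] exI[of _ \<gamma>]) simp
  define s where "s n = stage C z (round_list \<gamma> n)" for n
  have s_Suc: "s (Suc n) = (if cylinder_meets (C (s n)) z (round_list \<gamma> (Suc n)) then s n else Suc (s n))" for n
    by (simp add: s_def)
  have mono: "s n \<le> s (Suc n)" for n by (simp add: s_Suc)
  have le: "s n \<le> m" for n
  proof (induction n)
    case 0
    show ?case by (simp add: s_def)
  next
    case (Suc n)
    show ?case
    proof (cases "s n = m")
      case True
      then show ?thesis using meets[of "Suc n"] unfolding s_Suc by (simp del: round_list.simps)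
    next
      case False
      then show ?thesis using Suc unfolding s_Suc by simp
    qed
  qed
  have fin: "finite (range s)" by (rule finite_subset[of _ "{..m}"]) (use le in auto)
  then have "Max (range s) \<in> range s" by (intro Max_in) auto
  then obtain n0 where n0: "s n0 = Max (range s)" by (metis imageE)
  have const: "s n = s n0" if "n \<ge> n0" for n
  proof (rule antisym)
    show "s n \<le> s n0" unfolding n0 using fin by simp
    show "s n0 \<le> s n" using lift_Suc_mono_le[of s, OF mono that] .
  qed
  have "s (Suc n) = s n" if "n \<ge> n0" for n
    using const[OF that] const[of "Suc n"] that by simp
  then have "\<forall>n\<ge>n0. \<not> colour C z (round_list \<gamma> (Suc n))"
    unfolding colour_def s_def by (simp del: stage.simps)
  then show "\<exists>n0. \<forall>n\<ge>n0. \<not> colour C z (round_list \<gamma> (Suc n))" by blast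
next
  assume "\<exists>n0. \<forall>n\<ge>n0. \<not> colour C z (round_list \<gamma> (Suc n))"
  then obtain n0 where n0: "\<And>n. n \<ge> n0 \<Longrightarrow> \<not> colour C z (round_list \<gamma> (Suc n))"
    by blast
  define s where "s n = stage C z (round_list \<gamma> n)" for n
  have s_Suc: "s (Suc n) = (if cylinder_meets (C (s n)) z (round_list \<gamma> (Suc n)) then s n else Suc (s n))" for n
    by (simp add: s_def)
  have s_eq: "s (Suc n) = s n" if "n \<ge> n0" for n
    using n0[OF that] unfolding colour_def s_def by (simp del: stage.simps)
  have const: "s n = s n0" if "n \<ge> n0" for n
    using that by (induction n rule: dec_induct) (simp_all add: s_eq)
  have far: "cylinder_meets (C (s n0)) z (round_list \<gamma> (Suc n))" if "n \<ge> n0" for n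
  proof (rule ccontr)
    assume "\<not> ?thesis"
    then have "s (Suc n) = Suc (s n)" using s_Suc[of n] const[OF that] by simp
    then show False using s_eq[OF that] by simp
  qed
  have "cylinder_meets (C (s n0)) z (round_list \<gamma> n)" for n
  proof -
    \<comment> \<open>Cylinders grow when they are shortened, so an index beyond \<open>n0\<close>
      settles every \<open>n\<close>.\<close>
    define m where "m = max n0 n"
    have "n0 \<le> m" "n \<le> m" by (simp_all add: m_def)
    obtain z' \<gamma>' where *: "(z', \<gamma>') \<in> C (s n0)" "\<forall>i<Suc m. z' i = z i"
        "round_list \<gamma>' (Suc m) = round_list \<gamma> (Suc m)"
      using far[OF \<open>n0 \<le> m\<close>] unfolding cylinder_meets_def length_round_list by blast
    have "round_list \<gamma>' n = round_list \<gamma> n"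
    proof (rule round_list_cong)
      fix i assume "i < 2 * n"
      then show "\<gamma>' i = \<gamma> i" using \<open>n \<le> m\<close> by (intro round_list_eqD[OF *(3)]) simp
    qed
    moreover have "\<forall>i<n. z' i = z i" using *(2) \<open>n \<le> m\<close> by simp
    ultimately show ?thesis
      unfolding cylinder_meets_def length_round_list using *(1) by blast
  qed
  then have "(z, \<gamma>) \<in> C (s n0)" by (intro closedin_if_cylinders_meet assms)
  then show "(z, \<gamma>) \<in> (\<Union>n. C n)" by (intro UN_I[OF UNIV_I])
qed

theorem game_class_fsigma_colouring:
  assumes "game_class fsigma_in cantor_space A"
  obtains c :: "(nat \<Rightarrow> bool) \<Rightarrow> (nat \<times> nat) list \<Rightarrow> bool" where
    "\<And>z z' p. (\<And>n. n < length p \<Longrightarrow> z n = z' n) \<Longrightarrow> c z p = c z' p"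
    "\<And>z. z \<in> A \<longleftrightarrow> (\<exists>f. colour_win (c z) f)"
proof -
  have "\<exists>B. B \<subseteq> topspace (prod_topology cantor_space baire_space) \<and>
      fsigma_in (prod_topology cantor_space baire_space) B \<and> A = game_set (topspace cantor_space) B"
    using assms by (simp only: game_class_def)
  then obtain B where "B \<subseteq> topspace (prod_topology cantor_space baire_space) \<and>
      fsigma_in (prod_topology cantor_space baire_space) B \<and> A = game_set (topspace cantor_space) B"
    by (rule exE)
  then have B: "fsigma_in (prod_topology cantor_space baire_space) B"
      "A = game_set (topspace cantor_space) B" by simp_all
  have "\<exists>C. (\<forall>n. closedin (prod_topology cantor_space baire_space) (C n)) \<and>
      (\<forall>n. C n \<subseteq> C (Suc n)) \<and> \<Union> (range C) = B"
    by (rule fsigma_in_ascending[THEN iffD1, OF B(1)])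
  then obtain C :: "nat \<Rightarrow> _" where C: "\<And>n. closedin (prod_topology cantor_space baire_space) (C n)"
      "(\<Union>n. C n) = B" by blast
  show thesis
  proof (rule that[of "colour C"])
    show "colour C z p = colour C z' p" if "\<And>n. n < length p \<Longrightarrow> z n = z' n" for z z' p
      using that by (rule colour_cong)
    show "z \<in> A \<longleftrightarrow> (\<exists>f. colour_win (colour C z) f)" for z
      unfolding B(2) game_set_def player_I_wins_iff_rounds colour_win_def
        mem_fsigma_iff_finitely_many_colours[OF C(1), symmetric] C(2)
      by simp
  qed
qed

section \<open>The lens-shaped cell and the positions of the vertices\<close>

type_synonym pt = "real \<times> real \<times> real"
type_synonym position = "(nat \<times> nat) list"

text \<open>Every index above 1 gives the third coordinate, so quantifying over all natural numbers
  is quantifying over the three coordinates.\<close>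

definition coord :: "nat \<Rightarrow> pt \<Rightarrow> real" where
  "coord k y = (if k = 0 then fst y else if k = 1 then fst (snd y) else snd (snd y))"

lemma coord_simps [simp]: "coord 0 (x, v, w) = x" "coord (Suc 0) (x, v, w) = v" "coord 2 (x, v, w) = w"
  by (simp_all add: coord_def)

lemma coord_cases:
  "(\<forall>k. P (coord k x) (coord k y)) \<longleftrightarrow>
    P (fst x) (fst y) \<and> P (fst (snd x)) (fst (snd y)) \<and> P (snd (snd x)) (snd (snd y))"
  (is "?L \<longleftrightarrow> ?R")
proof
  assume L: ?L
  show ?R using L[rule_format, of 0] L[rule_format, of 1] L[rule_format, of 2]
    by (simp add: coord_def)
qed (simp add: coord_def)

text \<open>Closeness in the maximum norm, which fits coordinatewise estimates; it differs from
  closeness in \<open>dist\<close> by a factor of at most 3.\<close>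

definition near_by :: "real \<Rightarrow> pt \<Rightarrow> pt \<Rightarrow> bool" where
  "near_by d x y \<longleftrightarrow> (\<forall>k. \<bar>coord k x - coord k y\<bar> \<le> d)"

lemma near_by_iff: "near_by d (x, v, w) (x', v', w') \<longleftrightarrow> \<bar>x - x'\<bar> \<le> d \<and> \<bar>v - v'\<bar> \<le> d \<and> \<bar>w - w'\<bar> \<le> d"
  unfolding near_by_def coord_cases[of "\<lambda>a b. \<bar>a - b\<bar> \<le> d"] by simp

lemma near_by_mono: "near_by d x y \<Longrightarrow> d \<le> d' \<Longrightarrow> near_by d' x y"
  unfolding near_by_def using order_trans by blast

lemma coord_le_dist: "\<bar>coord k x - coord k y\<bar> \<le> dist x y"
proof -
  have "dist (fst x) (fst y) \<le> dist x y" "dist (snd x) (snd y) \<le> dist x y"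
    by (rule dist_fst_le, rule dist_snd_le)
  moreover have "dist (fst (snd x)) (fst (snd y)) \<le> dist (snd x) (snd y)"
      "dist (snd (snd x)) (snd (snd y)) \<le> dist (snd x) (snd y)"
    by (rule dist_fst_le, rule dist_snd_le)
  ultimately show ?thesis by (auto simp: coord_def dist_real_def)
qed

lemma near_by_dist: "near_by (dist x y) x y"
  unfolding near_by_def using coord_le_dist by blast

lemma dist_le_of_near_by: "near_by d x y \<Longrightarrow> dist x y \<le> 3 * d"
proof -
  obtain a b c a' b' c' where xy: "x = (a, b, c)" "y = (a', b', c')" by (metis prod_cases3)
  assume "near_by d x y"
  then have *: "\<bar>a - a'\<bar> \<le> d" "\<bar>b - b'\<bar> \<le> d" "\<bar>c - c'\<bar> \<le> d" by (simp_all add: xy near_by_iff)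
  have "dist x y = norm (a - a', b - b', c - c')" by (simp add: xy dist_norm)
  also have "\<dots> \<le> norm (a - a') + norm (b - b', c - c')" by (rule norm_Pair_le)
  also have "\<dots> \<le> norm (a - a') + (norm (b - b') + norm (c - c'))"
    by (intro add_left_mono norm_Pair_le)
  also have "\<dots> \<le> 3 * d" using * by simp
  finally show ?thesis .
qed

text \<open>A lens over the segment from \<open>src\<close> to \<open>tgt\<close>: \<open>v\<close>
  lies between a quarter of \<open>min x (1 - x)\<close> and all of it. The lower bound pinches the
  lens: \<open>v = 0\<close> occurs only at \<open>src\<close> and \<open>tgt\<close>, and this is
  why cells will touch only at these ends.\<close>

definition Delta :: "pt set" where
  "Delta = {(x, v, w). 0 \<le> x \<and> x \<le> 1 \<and> 0 \<le> w \<and> w \<le> v \<and> v \<le> x \<and> v \<le> 1 - x \<and> min x (1 - x) \<le> 4 * v}"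

definition src :: pt where "src = (0, 0, 0)"
definition tgt :: pt where "tgt = (1, 0, 0)"
definition hub :: pt where "hub = (1/2, 1/8, 0)"

lemma compact_Delta: "compact Delta"
proof -
  have eq: "Delta = ({0..1} \<times> {0..1} \<times> {0..1}) \<inter>
      {y. snd (snd y) \<le> fst (snd y)} \<inter> {y. fst (snd y) \<le> fst y} \<inter> {y. fst (snd y) \<le> 1 - fst y} \<inter>
      {y. min (fst y) (1 - fst y) \<le> 4 * fst (snd y)}"
    by (auto simp: Delta_def)
  have "compact ({0..1::real} \<times> {0..1::real} \<times> {0..1::real})"
    by (simp add: compact_Times)
  moreover have "closed {y::pt. snd (snd y) \<le> fst (snd y)}" "closed {y::pt. fst (snd y) \<le> fst y}"
      "closed {y::pt. fst (snd y) \<le> 1 - fst y}" "closed {y::pt. min (fst y) (1 - fst y) \<le> 4 * fst (snd y)}"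
    by (auto intro!: closed_Collect_le continuous_intros)
  ultimately show ?thesis unfolding eq by (intro compact_Int_closed)
qed

lemma src_in_Delta: "src \<in> Delta" and tgt_in_Delta: "tgt \<in> Delta"
  by (simp_all add: src_def tgt_def Delta_def)

lemma Delta_near_by: "x \<in> Delta \<Longrightarrow> y \<in> Delta \<Longrightarrow> near_by 1 x y"
  by (auto simp: Delta_def near_by_iff)

text \<open>The positions are numbered, and the vertices are placed on the spine
  \<open>v = 1/8\<close>, \<open>w = 0\<close>: the vertices \<open>u\<^sub>k(s)\<close> (with even numbers) to the left of the hub and the
  vertices \<open>b(s)\<close> (with odd numbers) to its right.\<close>

definition node_code :: "position \<Rightarrow> nat" where
  "node_code s = list_encode (map prod_encode s)"

lemma inj_node_code: "inj node_code"
proof (rule injI)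
  fix s t assume "node_code s = node_code t"
  then have "map prod_encode s = map prod_encode t"
    unfolding node_code_def by (metis list_encode_inverse)
  then show "s = t" using inj_prod_encode[of UNIV] by simp
qed

lemma node_code_eq [simp]: "node_code s = node_code t \<longleftrightarrow> s = t"
  using inj_node_code by (auto dest: injD)

lemma node_code_Nil [simp]: "node_code [] = 0" by (simp add: node_code_def)

definition uspoke :: "position \<Rightarrow> nat \<Rightarrow> nat" where "uspoke s k = 2 * prod_encode (node_code s, k)"
definition bspoke :: "position \<Rightarrow> nat" where "bspoke s = 2 * node_code s + 1"

lemma uspoke_eq [simp]: "uspoke s k = uspoke t l \<longleftrightarrow> s = t \<and> k = l"
  by (simp add: uspoke_def)

lemma bspoke_eq [simp]: "bspoke s = bspoke t \<longleftrightarrow> s = t"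
  by (simp add: bspoke_def)

lemma uspoke_neq_bspoke [simp]: "uspoke s k \<noteq> bspoke t" "bspoke t \<noteq> uspoke s k"
  unfolding uspoke_def bspoke_def by presburger+

lemma spoke_cases: obtains s k where "g = uspoke s k" | s where "g = bspoke s"
proof (cases "even g")
  case True
  then obtain n where n: "g = 2 * n" by blast
  obtain m k where mk: "n = prod_encode (m, k)" by (metis prod_decode_inverse surj_pair)
  have "\<exists>s. node_code s = m"
    by (rule exI[of _ "map prod_decode (list_decode m)"]) (simp add: node_code_def o_def)
  then show ?thesis using that(1) n mk by (auto simp: uspoke_def)
next
  case False
  then obtain n where n: "g = 2 * n + 1" by (metis oddE)
  have "\<exists>s. node_code s = n"
    by (rule exI[of _ "map prod_decode (list_decode n)"]) (simp add: node_code_def o_def)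
  then show ?thesis using that(2) n by (auto simp: bspoke_def)
qed

text \<open>The offsets from 1/2 shrink geometrically with the number of the vertex, so the vertices
  accumulate at the hub only.\<close>

definition spine_pos :: "nat \<Rightarrow> real" where
  "spine_pos g = 1/2 + (if even g then -1 else 1) * (1/2) ^ (g + 3)"

lemma spine_pos_dist: "\<bar>spine_pos g - 1/2\<bar> = (1/2) ^ (g + 3)"
  by (simp add: spine_pos_def)

lemma spine_pos_inj: "spine_pos g = spine_pos h \<Longrightarrow> g = h"
proof -
  assume "spine_pos g = spine_pos h"
  then have "(1/2::real) ^ (g + 3) = (1/2) ^ (h + 3)" by (metis spine_pos_dist)
  then show "g = h" by (simp add: power_inject_exp')
qed

lemma half_pow_le: "(1/2::real) ^ (n + k) \<le> (1/2) ^ k"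
  by (rule power_decreasing) auto

lemma spine_pos_bounds: "3/8 \<le> spine_pos g" "spine_pos g \<le> 9/16"
proof -
  define x :: real where "x = (1/2) ^ (g + 3)"
  have eq: "spine_pos g = 1/2 + (if even g then -1 else 1) * x" by (simp add: spine_pos_def x_def)
  have "x \<le> 1/8" using half_pow_le[of g 3] unfolding x_def by (simp add: power3_eq_cube)
  moreover have "x \<le> 1/16" if "odd g"
  proof -
    from that obtain m where m: "g = 2 * m + 1" by (metis oddE)
    have "x = (1/2) ^ (2 * m + 4)" by (simp add: m x_def add.commute)
    also have "\<dots> \<le> (1/2) ^ 4" by (rule half_pow_le)
    finally show ?thesis by (simp add: power_divide)
  qed
  moreover have "0 < x" by (simp add: x_def)
  ultimately show "3/8 \<le> spine_pos g" "spine_pos g \<le> 9/16"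
    unfolding eq by (cases "even g"; simp)+
qed

text \<open>The leftmost and the rightmost vertex have the numbers 0 and 1. Their positions are the
  constants in the maps \<open>T SA\<close> and \<open>T SB\<close>.\<close>

lemma spine_pos_extreme: "spine_pos (uspoke [] 0) = 3/8" "spine_pos (bspoke []) = 9/16"
  by (simp_all add: spine_pos_def uspoke_def bspoke_def prod_encode_def power_divide)

section \<open>Edges, their ends and the slopes of their arcs\<close>

text \<open>With \<open>s' = (i, j) # s\<close>, the edge \<open>St i j s\<close> joins \<open>u\<^sub>0(s')\<close> to \<open>u\<^sub>i(s)\<close>, the edge \<open>En i j s\<close> joins
  \<open>b(s')\<close> to \<open>u\<^sub>i\<^sub>+\<^sub>1(s)\<close>, \<open>Co s\<close> joins \<open>u\<^sub>0(s)\<close> to \<open>b(s)\<close>, and \<open>Vv s k\<close> joins \<open>u\<^sub>k(s)\<close> to a point \<open>b\<^sub>k(s)\<close>, where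
  \<open>b\<^sub>k(s)\<close> converges to \<open>b(s)\<close>. Hence \<open>u\<^sub>0(s)\<close> is connected to \<open>b(s)\<close> unless some pair \<open>u\<^sub>i(s)\<close>, \<open>u\<^sub>i\<^sub>+\<^sub>1(s)\<close> is
  separated: this is the choice of Player I. The pair is then separated within all children \<open>(i, j) # s\<close>
  of \<open>s\<close>: this is the choice of Player II.\<close>

datatype edge = St nat nat position | En nat nat position | Co position | Vv position nat

primrec edge_spoke :: "edge \<Rightarrow> nat" where
  "edge_spoke (St i j s) = uspoke s i"
| "edge_spoke (En i j s) = uspoke s (Suc i)"
| "edge_spoke (Co s) = bspoke s"
| "edge_spoke (Vv s k) = bspoke s"

primrec level :: "edge \<Rightarrow> nat" where
  "level (St i j s) = 2 * j"
| "level (En i j s) = 2 * j + 1"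
| "level (Co s) = 0"
| "level (Vv s k) = Suc k"

primrec near_spoke :: "edge \<Rightarrow> nat" where
  "near_spoke (St i j s) = uspoke ((i, j) # s) 0"
| "near_spoke (En i j s) = bspoke ((i, j) # s)"
| "near_spoke (Co s) = uspoke s 0"
| "near_spoke (Vv s k) = uspoke s k"

text \<open>The offset from 1/2 is at least 3/4 of that of \<open>b(s)\<close> and smaller than it,
  which keeps these points apart from all vertices and from those of other positions. If they
  coincided with \<open>b(s)\<close>, all \<open>u_k(s)\<close>, in particular
  \<open>u_0(s)\<close>, would be tied to \<open>b(s)\<close>; mere convergence ties only those with
  large \<open>k\<close>.\<close>

definition bk_pos :: "position \<Rightarrow> nat \<Rightarrow> real" where
  "bk_pos s k = 1/2 + (1/2) ^ (bspoke s + 3) * (1 - (1/2) ^ (k + 2))"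

definition near_end :: "edge \<Rightarrow> real" where "near_end e = spine_pos (near_spoke e)"

primrec far_end :: "edge \<Rightarrow> real" where
  "far_end (St i j s) = spine_pos (uspoke s i)"
| "far_end (En i j s) = spine_pos (uspoke s (Suc i))"
| "far_end (Co s) = spine_pos (bspoke s)"
| "far_end (Vv s k) = bk_pos s k"

lemma edge_eqI: "edge_spoke e = edge_spoke e' \<Longrightarrow> level e = level e' \<Longrightarrow> e = e'"
  by (cases e; cases e') (auto, presburger+)

lemma bk_pos_bounds: "1/2 < bk_pos s k" "bk_pos s k < spine_pos (bspoke s)"
proof -
  have "(1/2::real) ^ (k + 2) < 1" unfolding power_less_one_iff[of "1/2::real", simplified] by simp
  then show "1/2 < bk_pos s k" by (simp add: bk_pos_def)
  have "odd (bspoke s)" by (simp add: bspoke_def)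
  then show "bk_pos s k < spine_pos (bspoke s)"
    by (simp add: bk_pos_def spine_pos_def algebra_simps)
qed

lemma bk_pos_dist: "\<bar>bk_pos s k - spine_pos (bspoke s)\<bar> \<le> (1/2) ^ Suc k"
proof -
  have "odd (bspoke s)" by (simp add: bspoke_def)
  then have "\<bar>bk_pos s k - spine_pos (bspoke s)\<bar> = (1/2) ^ (bspoke s + 3) * (1/2) ^ (k + 2)"
    by (simp add: bk_pos_def spine_pos_def algebra_simps)
  also have "\<dots> = (1/2) ^ ((bspoke s + 4) + Suc k)" unfolding power_add[symmetric] by (simp add: add.commute)
  also have "\<dots> \<le> (1/2) ^ Suc k" by (rule half_pow_le)
  finally show ?thesis .
qed

lemma far_end_dist: "\<bar>far_end e - spine_pos (edge_spoke e)\<bar> \<le> (1/2) ^ level e"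
  by (cases e) (auto simp: bk_pos_dist simp del: power_Suc)

lemma uspoke_less_half: "spine_pos (uspoke s k) < 1/2" and bspoke_greater_half: "spine_pos (bspoke s) > 1/2"
  by (simp_all add: spine_pos_def uspoke_def bspoke_def)

lemma near_neq_far: "near_end e \<noteq> far_end e"
proof (cases e)
  case (St i j s)
  then show ?thesis using spine_pos_inj by (auto simp: near_end_def dest!: spine_pos_inj)
next
  case (En i j s)
  then show ?thesis using uspoke_less_half[of s "Suc i"] bspoke_greater_half[of "(i, j) # s"]
    by (simp add: near_end_def)
next
  case (Co s)
  then show ?thesis using uspoke_less_half[of s 0] bspoke_greater_half[of s]
    by (simp add: near_end_def)
next
  case (Vv s k)
  then show ?thesis using uspoke_less_half[of s k] bk_pos_bounds[of s k] by (simp add: near_end_def)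
qed

lemma spine_pos_neq: "spine_pos g \<noteq> 1/2"
  using spine_pos_dist[of g] zero_less_power[of "1/2::real" "g + 3"] by force

lemma near_end_bounds: "3/8 \<le> near_end e" "near_end e \<le> 9/16" "near_end e \<noteq> 1/2"
  using spine_pos_bounds[of "near_spoke e"] spine_pos_neq unfolding near_end_def by auto

lemma far_end_bounds: "3/8 \<le> far_end e" "far_end e \<le> 9/16" "far_end e \<noteq> 1/2"
proof -
  have "3/8 \<le> far_end e \<and> far_end e \<le> 9/16 \<and> far_end e \<noteq> 1/2"
  proof (cases "\<exists>s k. e = Vv s k")
    case True
    then obtain s k where "e = Vv s k" by blast
    then show ?thesis using bk_pos_bounds[of s k] spine_pos_bounds[of "bspoke s"] by auto
  next
    case False
    then have "far_end e = spine_pos (edge_spoke e)" by (cases e) auto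
    then show ?thesis using spine_pos_bounds[of "edge_spoke e"] spine_pos_neq by simp
  qed
  then show "3/8 \<le> far_end e" "far_end e \<le> 9/16" "far_end e \<noteq> 1/2" by auto
qed

definition extent :: "edge \<Rightarrow> real" where "extent e = \<bar>far_end e - near_end e\<bar>"

lemma extent_pos: "0 < extent e" and extent_le: "extent e \<le> 1/4"
  using near_neq_far[of e] near_end_bounds[of e] far_end_bounds[of e] unfolding extent_def by linarith+

text \<open>The number of chords of the arc. It grows with the level, so that the cells accumulating
  at a spoke become small.\<close>

definition pieces :: "edge \<Rightarrow> real" where "pieces e = real (level e + 1)"

lemma pieces_ge_1: "1 \<le> pieces e" by (simp add: pieces_def)

text \<open>Arcs are told apart by the ratio of \<open>w\<close> to the height above the spine.
  Spoke \<open>g\<close> has the ratio \<open>slope0 g\<close>; the cells of \<open>e\<close> have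
  ratios between \<open>slope e\<close> and \<open>slope e + width e\<close>. These intervals lie
  strictly between \<open>slope0 (edge_spoke e)\<close> and twice that value, are disjoint for
  different edges and shrink towards \<open>slope0 (edge_spoke e)\<close> as the level
  grows.\<close>

definition slope0 :: "nat \<Rightarrow> real" where "slope0 g = (1/2) ^ (g + 1)"
definition slope :: "edge \<Rightarrow> real" where
  "slope e = (1/2) ^ (edge_spoke e + 1) * (1 + (1/2) ^ (level e + 1))"
definition width :: "edge \<Rightarrow> real" where "width e = (1/2) ^ (edge_spoke e + level e + 3)"
definition thick :: "edge \<Rightarrow> real" where "thick e = extent e / (8 * pieces e)"

lemma slope_pos: "0 < slope e" and width_pos: "0 < width e"
  unfolding slope_def width_def by (auto intro!: mult_pos_pos add_pos_pos)

lemma thick_pos: "0 < thick e" and thick_le: "thick e \<le> 1/32" "thick e \<le> extent e / 8"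
proof -
  show "0 < thick e" using extent_pos[of e] pieces_ge_1[of e] by (simp add: thick_def)
  have "extent e / (8 * pieces e) \<le> extent e / 8"
    using extent_pos[of e] pieces_ge_1[of e] by (intro divide_left_mono) auto
  then show "thick e \<le> extent e / 8" by (simp add: thick_def)
  then show "thick e \<le> 1/32" using extent_le[of e] by simp
qed

lemma slope_width_lt:
  "slope e + width e < 2 * slope0 (edge_spoke e)"
  "slope e + width e < slope0 (edge_spoke e) * (1 + (1/2) ^ level e)"
proof -
  \<comment> \<open>In units of \<open>(1/2) ^ level e\<close> the relative excess is 1/2 from
    \<open>slope\<close> and 1/4 from \<open>width\<close>.\<close>
  have eq: "slope e + width e = slope0 (edge_spoke e) * (1 + 3/4 * (1/2) ^ level e)"
    by (simp add: slope_def width_def slope0_def power_add power_divide algebra_simps)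
  have "0 < slope0 (edge_spoke e) * (1/2) ^ level e" by (simp add: slope0_def)
  then show *: "slope e + width e < slope0 (edge_spoke e) * (1 + (1/2) ^ level e)"
    unfolding eq by (simp add: algebra_simps)
  have "(1/2::real) ^ level e \<le> 1" by (rule power_le_one) auto
  then have "slope0 (edge_spoke e) * (1 + (1/2) ^ level e) \<le> slope0 (edge_spoke e) * 2"
    by (intro mult_left_mono) (auto simp: slope0_def)
  then show "slope e + width e < 2 * slope0 (edge_spoke e)" using * by simp
qed

lemma slope_gt: "slope0 (edge_spoke e) < slope e"
proof -
  have "0 < slope0 (edge_spoke e) * (1/2) ^ (level e + 1)" by (simp add: slope0_def)
  then show ?thesis unfolding slope_def slope0_def[symmetric] by (simp add: algebra_simps)
qed

lemma slope0_less: "g < h \<Longrightarrow> 2 * slope0 h \<le> slope0 g"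
proof -
  assume "g < h"
  then have "(1/2::real) ^ h \<le> (1/2) ^ (g + 1)" by (intro power_decreasing) auto
  then show ?thesis by (simp add: slope0_def)
qed

lemma slope_width_le_1: "slope e + width e \<le> 1"
proof -
  have "(1/2::real) ^ edge_spoke e \<le> 1" by (rule power_le_one) auto
  then have "2 * slope0 (edge_spoke e) \<le> 1" by (simp add: slope0_def)
  then show ?thesis using slope_width_lt(1)[of e] by simp
qed

lemma slopes_disjoint:
  assumes "e \<noteq> e'"
  shows "slope e + width e < slope e' \<or> slope e' + width e' < slope e"
proof -
  consider "edge_spoke e < edge_spoke e'" | "edge_spoke e' < edge_spoke e"
    | "edge_spoke e = edge_spoke e'" "level e < level e'"
    | "edge_spoke e = edge_spoke e'" "level e' < level e"
    using assms edge_eqI by (metis linorder_neqE_nat)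
  moreover have lev: "slope b + width b < slope a"
    if "edge_spoke a = edge_spoke b" "level a < level b" for a b
  proof -
    have "(1/2::real) ^ level b \<le> (1/2) ^ (level a + 1)" using that by (intro power_decreasing) auto
    then have "slope0 (edge_spoke b) * (1 + (1/2) ^ level b) \<le> slope a"
      unfolding slope_def that(1) slope0_def by (intro mult_left_mono) auto
    then show ?thesis using slope_width_lt(2)[of b] by simp
  qed
  moreover have spk: "slope b + width b < slope a" if "edge_spoke a < edge_spoke b" for a b
    using slope_width_lt(1)[of b] slope0_less[OF that] slope_gt[of a] by simp
  ultimately show ?thesis by metis
qed

lemma slope_spoke_disjoint: "slope0 g < slope e \<or> slope e + width e < slope0 g"
proof (cases "edge_spoke e \<le> g")
  case True
  then have "slope0 g \<le> slope0 (edge_spoke e)"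
    unfolding slope0_def by (intro power_decreasing) auto
  then show ?thesis using slope_gt[of e] by simp
next
  case False
  then show ?thesis using slope_width_lt(1)[of e] slope0_less[of g "edge_spoke e"] by simp
qed

lemma slope_dist: "\<bar>slope e - slope0 (edge_spoke e)\<bar> \<le> (1/2) ^ level e"
proof -
  have "slope e - slope0 (edge_spoke e) = (1/2) ^ ((edge_spoke e + 2) + level e)"
    by (simp add: slope_def slope0_def power_add algebra_simps)
  moreover have "0 \<le> (1/2::real) ^ ((edge_spoke e + 2) + level e)" by simp
  ultimately show ?thesis using half_pow_le[of "edge_spoke e + 2" "level e"] by linarith
qed

lemma finite_edges_spoke_level: "finite {e. edge_spoke e \<le> G \<and> level e \<le> L}"
proof -
  have "inj_on (\<lambda>e. (edge_spoke e, level e)) {e. edge_spoke e \<le> G \<and> level e \<le> L}"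
    by (auto intro!: inj_onI edge_eqI)
  moreover have "(\<lambda>e. (edge_spoke e, level e)) ` {e. edge_spoke e \<le> G \<and> level e \<le> L} \<subseteq> {..G} \<times> {..L}"
    by auto
  ultimately show ?thesis by (meson finite_SigmaI finite_atMost inj_on_finite)
qed

primrec edge_code :: "edge \<Rightarrow> nat" where
  "edge_code (St i j s) = 4 * node_code ((i, j) # s)"
| "edge_code (En i j s) = 4 * node_code ((i, j) # s) + 1"
| "edge_code (Co s) = 4 * node_code s + 2"
| "edge_code (Vv s k) = 4 * prod_encode (node_code s, k) + 3"

text \<open>The injective numbering \<open>edge_code\<close> is bounded by a linear function of
  \<open>near_spoke\<close>.\<close>

lemma finite_edges_near_spoke: "finite {e. near_spoke e \<le> N}"
proof -
  have "inj edge_code"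
  proof (rule injI)
    fix e e' assume "edge_code e = edge_code e'"
    then show "e = e'" by (cases e; cases e') (auto, presburger+)
  qed
  moreover have "edge_code e \<le> 2 * near_spoke e + 3" for e
  proof -
    have "node_code t \<le> prod_encode (node_code t, 0)" for t by (rule le_prod_encode_1)
    then show ?thesis
      by (cases e) (auto simp: uspoke_def bspoke_def trans_le_add1 intro: le_SucI)
  qed
  then have "edge_code ` {e. near_spoke e \<le> N} \<subseteq> {..2 * N + 3}" by (force intro: order_trans)
  ultimately show ?thesis by (meson finite_atMost inj_on_finite inj_on_subset subset_UNIV)
qed

section \<open>Arcs, chords and the cell maps\<close>

definition height :: "real \<Rightarrow> real \<Rightarrow> real" where "height q t = t * (1 - t) * q"

text \<open>A parabola over the spine in the plane \<open>w = sl * (v - 1/8)\<close>. Quadratic arcs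
  serve the choice of the removed points: a coordinate takes each value finitely often on such a
  curve unless it is constant there.\<close>

definition arc :: "real \<Rightarrow> real \<Rightarrow> real \<Rightarrow> real \<Rightarrow> pt" where
  "arc p q sl t = (p + t * (q - p), 1/8 + height \<bar>q - p\<bar> t, sl * height \<bar>q - p\<bar> t)"

definition edge_arc :: "edge \<Rightarrow> real \<Rightarrow> pt" where
  "edge_arc e = arc (near_end e) (far_end e) (slope e)"

definition spoke_arc :: "nat \<Rightarrow> real \<Rightarrow> pt" where
  "spoke_arc g = arc (1/2) (spine_pos g) (slope0 g)"

definition spoke :: "nat \<Rightarrow> pt set" where "spoke g = spoke_arc g ` {0..1}"

definition spine :: "real \<Rightarrow> pt" where "spine x = (x, 1/8, 0)"

lemma edge_arc_ends: "edge_arc e 0 = spine (near_end e)" "edge_arc e 1 = spine (far_end e)"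
  by (simp_all add: edge_arc_def arc_def height_def spine_def)

lemma spoke_arc_ends: "spoke_arc g 0 = hub" "spoke_arc g 1 = spine (spine_pos g)"
  by (simp_all add: spoke_arc_def arc_def height_def spine_def hub_def)

definition knot :: "edge \<Rightarrow> nat \<Rightarrow> real" where "knot e m = real m / pieces e"

definition chord_height :: "edge \<Rightarrow> nat \<Rightarrow> real \<Rightarrow> real" where
  "chord_height e m x = height (extent e) (knot e m) +
     x * (height (extent e) (knot e (Suc m)) - height (extent e) (knot e m))"

datatype sym = SA | SB | SE edge nat

text \<open>\<open>T SA\<close> and \<open>T SB\<close> map the cell to the parts between \<open>src\<close> and the leftmost vertex and between the
  rightmost vertex and \<open>tgt\<close>. \<open>T (SE e m)\<close> maps it to a thin set along the \<open>m\<close>-th of the \<open>level e + 1\<close> chords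
  of the arc of \<open>e\<close>.\<close>

fun T :: "sym \<Rightarrow> pt \<Rightarrow> pt" where
  "T SA (x, v, w) = (3/8 * x, x/8 + v/8, w/8)"
| "T SB (x, v, w) = (9/16 + 7/16 * x, 1/8 - x/8 + v/8, w/8)"
| "T (SE e m) (x, v, w) =
    (near_end e + (knot e m + x / pieces e) * (far_end e - near_end e),
     1/8 + (chord_height e m x + thick e * v),
     slope e * (chord_height e m x + thick e * v) + thick e * (width e * w))"

fun valid :: "sym \<Rightarrow> bool" where
  "valid SA = True" | "valid SB = True" | "valid (SE e m) = (m \<le> level e)"

lemma height_nonneg: "0 \<le> q \<Longrightarrow> 0 \<le> t \<Longrightarrow> t \<le> 1 \<Longrightarrow> 0 \<le> height q t"
  by (simp add: height_def)

lemma height_le: "0 \<le> q \<Longrightarrow> 0 \<le> t \<Longrightarrow> t \<le> 1 \<Longrightarrow> height q t \<le> q"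
proof -
  assume *: "0 \<le> q" "0 \<le> t" "t \<le> 1"
  have "t * (1 - t) \<le> 1 * 1" using * by (intro mult_mono) auto
  then show ?thesis unfolding height_def using * mult_right_mono[of "t * (1 - t)" 1 q] by simp
qed

lemma height_quarter: "0 \<le> q \<Longrightarrow> height q t \<le> q / 4"
proof -
  have "t * (1 - t) \<le> 1/4" using zero_le_power2[of "t - 1/2"] by (simp add: power2_eq_square algebra_simps)
  then show "0 \<le> q \<Longrightarrow> height q t \<le> q / 4" unfolding height_def using mult_right_mono by fastforce
qed

lemma knot_nonneg: "0 \<le> knot e m"
  by (simp add: knot_def pieces_def)

lemma knot_le_1: "m \<le> Suc (level e) \<Longrightarrow> knot e m \<le> 1"
  by (simp add: knot_def pieces_def)

lemma knot_Suc: "knot e (Suc m) = knot e m + 1 / pieces e"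
  by (simp add: knot_def add_divide_distrib)

lemma knot_ends: "knot e 0 = 0" "knot e (Suc (level e)) = 1"
  by (simp_all add: knot_def pieces_def)

lemma extent_nonneg: "0 \<le> extent e" by (simp add: extent_def)

lemma chord_height_nonneg:
  "m \<le> level e \<Longrightarrow> 0 \<le> x \<Longrightarrow> x \<le> 1 \<Longrightarrow> 0 \<le> chord_height e m x"
proof -
  assume *: "m \<le> level e" "0 \<le> x" "x \<le> 1"
  have eq: "chord_height e m x = (1 - x) * height (extent e) (knot e m) + x * height (extent e) (knot e (Suc m))"
    by (simp add: chord_height_def algebra_simps)
  show ?thesis unfolding eq
    using * by (intro add_nonneg_nonneg mult_nonneg_nonneg height_nonneg extent_nonneg knot_nonneg knot_le_1) auto
qed

lemma chord_height_le:
  "m \<le> level e \<Longrightarrow> 0 \<le> x \<Longrightarrow> x \<le> 1 \<Longrightarrow> chord_height e m x \<le> extent e / 4"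
proof -
  assume *: "m \<le> level e" "0 \<le> x" "x \<le> 1"
  have "chord_height e m x = (1 - x) * height (extent e) (knot e m) + x * height (extent e) (knot e (Suc m))"
    by (simp add: chord_height_def algebra_simps)
  also have "\<dots> \<le> (1 - x) * (extent e / 4) + x * (extent e / 4)"
    using * by (intro add_mono mult_left_mono height_quarter extent_nonneg) auto
  also have "\<dots> = extent e / 4" by (simp add: algebra_simps add_divide_distrib[symmetric])
  finally show ?thesis .
qed

lemma T_src_tgt:
  "T SA src = src" "T SA tgt = spine (spine_pos (uspoke [] 0))"
  "T SB src = spine (spine_pos (bspoke []))" "T SB tgt = tgt"
  "T (SE e m) src = edge_arc e (knot e m)" "T (SE e m) tgt = edge_arc e (knot e (Suc m))"
  by (simp_all add: src_def tgt_def spine_def spine_pos_extreme edge_arc_def arc_def chord_height_def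
      extent_def knot_Suc)

lemma knot_height_diff:
  assumes "m \<le> level e"
  shows "\<bar>height (extent e) (knot e (Suc m)) - height (extent e) (knot e m)\<bar> \<le> extent e / pieces e"
proof -
  have "height (extent e) (knot e (Suc m)) - height (extent e) (knot e m) =
      (extent e / pieces e) * (1 - knot e m - knot e (Suc m))"
    unfolding height_def knot_Suc using pieces_ge_1[of e] by (simp add: field_simps)
  moreover have "\<bar>1 - knot e m - knot e (Suc m)\<bar> \<le> 1"
    using knot_nonneg[of e m] knot_nonneg[of e "Suc m"] knot_le_1[of m e] knot_le_1[of "Suc m" e] assms by auto
  then have "\<bar>extent e / pieces e\<bar> * \<bar>1 - knot e m - knot e (Suc m)\<bar> \<le> \<bar>extent e / pieces e\<bar> * 1"
    by (intro mult_left_mono) auto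
  moreover have "0 \<le> extent e / pieces e" using pieces_ge_1[of e] extent_nonneg[of e] by simp
  ultimately show ?thesis by (simp add: abs_mult)
qed

text \<open>A chord advances by \<open>extent e / pieces e\<close> in the first coordinate. The
  contributions 9/8 of the height and 1/8 of the thickness are absorbed by the factor 2.\<close>

lemma T_SE_near_by:
  assumes "m \<le> level e" "near_by d x y"
  shows "near_by (2 * (extent e / pieces e) * d) (T (SE e m) x) (T (SE e m) y)"
proof -
  obtain a b c a' b' c' where xy: "x = (a, b, c)" "y = (a', b', c')" by (metis prod_cases3)
  have d: "\<bar>a - a'\<bar> \<le> d" "\<bar>b - b'\<bar> \<le> d" "\<bar>c - c'\<bar> \<le> d" and d0: "0 \<le> d"
    using assms(2) by (auto simp: xy near_by_iff)
  define r where "r = extent e / pieces e"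
  have r0: "0 \<le> r" using pieces_ge_1[of e] extent_nonneg[of e] by (simp add: r_def)
  have th: "thick e = r / 8" by (simp add: thick_def r_def)
  have X: "\<bar>(near_end e + (knot e m + a / pieces e) * (far_end e - near_end e)) -
      (near_end e + (knot e m + a' / pieces e) * (far_end e - near_end e))\<bar> \<le> r * d"
  proof -
    have "(near_end e + (knot e m + a / pieces e) * (far_end e - near_end e)) -
      (near_end e + (knot e m + a' / pieces e) * (far_end e - near_end e)) =
      (far_end e - near_end e) / pieces e * (a - a')"
      by (simp add: algebra_simps diff_divide_distrib)
    also have "\<bar>\<dots>\<bar> = r * \<bar>a - a'\<bar>" using pieces_ge_1[of e] by (simp add: abs_mult extent_def r_def)
    also have "\<dots> \<le> r * d" using d r0 by (intro mult_left_mono)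
    finally show ?thesis .
  qed
  define H where "H = chord_height e m a + thick e * b"
  define H' where "H' = chord_height e m a' + thick e * b'"
  have HH: "\<bar>H - H'\<bar> \<le> 9/8 * (r * d)"
  proof -
    define k where "k = height (extent e) (knot e (Suc m)) - height (extent e) (knot e m)"
    have "H - H' = k * (a - a') + thick e * (b - b')"
      by (simp add: H_def H'_def chord_height_def k_def algebra_simps)
    moreover have "\<bar>k * (a - a')\<bar> \<le> r * d"
      using knot_height_diff[OF assms(1)] d unfolding k_def[symmetric] abs_mult r_def[symmetric]
      by (intro mult_mono) auto
    moreover have "\<bar>thick e * (b - b')\<bar> \<le> r / 8 * d"
      using d r0 unfolding th abs_mult by (intro mult_mono) auto
    ultimately show ?thesis by linarith
  qed
  have s1: "0 < slope e" "slope e \<le> 1" "0 < width e" "width e \<le> 1"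
    using slope_pos[of e] width_pos[of e] slope_width_le_1[of e] by auto
  have "\<bar>(slope e * H + thick e * (width e * c)) - (slope e * H' + thick e * (width e * c'))\<bar> \<le> 2 * r * d"
  proof -
    have "(slope e * H + thick e * (width e * c)) - (slope e * H' + thick e * (width e * c')) =
        slope e * (H - H') + thick e * (width e * (c - c'))" by (simp add: algebra_simps)
    moreover have "\<bar>slope e * (H - H')\<bar> \<le> 1 * (9/8 * (r * d))"
      using HH s1 unfolding abs_mult by (intro mult_mono) auto
    moreover have "\<bar>thick e * (width e * (c - c'))\<bar> \<le> r / 8 * (1 * d)"
      using d r0 s1 unfolding th abs_mult by (intro mult_mono) auto
    moreover have "0 \<le> r * d" using r0 d0 by simp
    moreover have "2 * r * d = 2 * (r * d)" "r / 8 * (1 * d) = (r * d) / 8" by simp_all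
    ultimately show ?thesis by linarith
  qed
  moreover have "0 \<le> r * d" "2 * r * d = 2 * (r * d)" using r0 d0 by simp_all
  ultimately show ?thesis
    using X HH unfolding xy T.simps near_by_iff H_def[symmetric] H'_def[symmetric] r_def[symmetric]
    by linarith
qed

lemma T_contraction:
  assumes "valid \<sigma>" "near_by d x y"
  shows "near_by (d / 2) (T \<sigma> x) (T \<sigma> y)"
proof (cases \<sigma>)
  case (SE e m)
  have d0: "0 \<le> d" using assms(2) unfolding near_by_def by (meson abs_ge_zero order_trans)
  have *: "extent e / pieces e \<le> (1/4) / 1"
    using extent_le[of e] extent_nonneg[of e] pieces_ge_1[of e] by (intro frac_le) auto
  then have "2 * (extent e / pieces e) * d \<le> d / 2"
    using mult_right_mono[OF * d0] by linarith
  then show ?thesis using T_SE_near_by[of m e d x y] assms SE near_by_mono by auto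
next
  case SA
  obtain a b c a' b' c' where xy: "x = (a, b, c)" "y = (a', b', c')" by (metis prod_cases3)
  show ?thesis using assms(2) unfolding xy SA T.simps near_by_iff by linarith
next
  case SB
  obtain a b c a' b' c' where xy: "x = (a, b, c)" "y = (a', b', c')" by (metis prod_cases3)
  show ?thesis using assms(2) unfolding xy SB T.simps near_by_iff by linarith
qed

text \<open>Since \<open>w \<le> v\<close>, the term \<open>thick e * (width e * w)\<close> is at
  most \<open>width e\<close> times the height above the spine, which keeps the cell in its wedge of
  slopes. Height 0 forces \<open>v = 0\<close>, hence an end, because \<open>Delta\<close> is
  pinched.\<close>

lemma T_SE_range:
  assumes "m \<le> level e" "(x, v, w) \<in> Delta"
  defines "H \<equiv> chord_height e m x + thick e * v"
  shows "3/8 \<le> fst (T (SE e m) (x, v, w))" "fst (T (SE e m) (x, v, w)) \<le> 9/16"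
    and "0 \<le> H" "H \<le> 1/8" "slope e * H \<le> snd (snd (T (SE e m) (x, v, w)))"
    and "snd (snd (T (SE e m) (x, v, w))) \<le> (slope e + width e) * H"
    and "H = 0 \<Longrightarrow> (x, v, w) = src \<or> (x, v, w) = tgt"
proof -
  have D: "0 \<le> x" "x \<le> 1" "0 \<le> w" "w \<le> v" "v \<le> x" "v \<le> 1 - x" "min x (1 - x) \<le> 4 * v"
    using assms(2) by (auto simp: Delta_def)
  let ?l = "knot e m + x / pieces e"
  have l: "0 \<le> ?l" "?l \<le> 1"
  proof -
    show "0 \<le> ?l" using D pieces_ge_1[of e] knot_nonneg[of e m] by simp
    have "?l \<le> knot e m + 1 / pieces e" using D pieces_ge_1[of e] by (intro add_left_mono divide_right_mono) auto
    also have "\<dots> = knot e (Suc m)" by (simp add: knot_Suc)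
    also have "\<dots> \<le> 1" using assms(1) by (intro knot_le_1) simp
    finally show "?l \<le> 1" .
  qed
  have "near_end e + ?l * (far_end e - near_end e) = (1 - ?l) * near_end e + ?l * far_end e"
    by (simp add: algebra_simps)
  moreover have "(1 - ?l) * (3/8) + ?l * (3/8) \<le> (1 - ?l) * near_end e + ?l * far_end e"
    using l near_end_bounds[of e] far_end_bounds[of e] by (intro add_mono mult_left_mono) auto
  moreover have "(1 - ?l) * near_end e + ?l * far_end e \<le> (1 - ?l) * (9/16) + ?l * (9/16)"
    using l near_end_bounds[of e] far_end_bounds[of e] by (intro add_mono mult_left_mono) auto
  moreover have "(1 - ?l) * c + ?l * c = c" for c by (simp add: algebra_simps)
  ultimately show "3/8 \<le> fst (T (SE e m) (x, v, w))" "fst (T (SE e m) (x, v, w)) \<le> 9/16"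
    unfolding T.simps fst_conv by metis+
  have c0: "0 \<le> chord_height e m x" using D assms(1) by (intro chord_height_nonneg)
  have v0: "0 \<le> thick e * v" using D thick_pos[of e] by simp
  show "0 \<le> H" using c0 v0 by (simp add: H_def)
  have "chord_height e m x \<le> extent e / 4" using D assms(1) by (intro chord_height_le)
  moreover have "thick e * v \<le> 1/32 * 1"
    using D thick_le[of e] thick_pos[of e] by (intro mult_mono) auto
  ultimately show "H \<le> 1/8" using extent_le[of e] by (simp add: H_def)
  have w0: "0 \<le> thick e * (width e * w)" using D thick_pos[of e] width_pos[of e] by simp
  then show "slope e * H \<le> snd (snd (T (SE e m) (x, v, w)))" by (simp add: H_def)
  have "thick e * (width e * w) = width e * (thick e * w)" by simp
  also have "\<dots> \<le> width e * H"
    using D thick_pos[of e] width_pos[of e] c0 unfolding H_def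
    by (intro mult_left_mono add_increasing) auto
  finally show "snd (snd (T (SE e m) (x, v, w))) \<le> (slope e + width e) * H"
    unfolding T.simps snd_conv H_def[symmetric] by (simp add: distrib_right)
  assume "H = 0"
  then have "thick e * v = 0" using c0 v0 unfolding H_def by linarith
  then have "v = 0" using thick_pos[of e] by simp
  then show "(x, v, w) = src \<or> (x, v, w) = tgt" using D by (auto simp: src_def tgt_def min_def split: if_splits)
qed

lemma T_in_Delta: "valid \<sigma> \<Longrightarrow> y \<in> Delta \<Longrightarrow> T \<sigma> y \<in> Delta"
proof (cases \<sigma>)
  case (SE e m)
  assume *: "valid \<sigma>" "y \<in> Delta"
  obtain x v w where y: "y = (x, v, w)" by (metis prod_cases3)
  define H where "H = chord_height e m x + thick e * v"
  have m: "m \<le> level e" using * SE by simp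
  note R = T_SE_range[OF m *(2)[unfolded y], folded H_def]
  have "(slope e + width e) * H \<le> 1 * H" using R(3) slope_width_le_1[of e] by (intro mult_right_mono)
  moreover have "0 \<le> slope e * H" using R(3) slope_pos[of e] by simp
  moreover obtain X W where XW: "T \<sigma> y = (X, 1/8 + H, W)" "X = fst (T (SE e m) (x, v, w))"
      "W = snd (snd (T (SE e m) (x, v, w)))"
    unfolding y SE by (simp add: H_def)
  ultimately have "3/8 \<le> X" "X \<le> 9/16" "0 \<le> H" "H \<le> 1/8" "0 \<le> W" "W \<le> H"
    using R(1-6) by auto
  then show ?thesis unfolding XW(1) Delta_def by (auto simp: min_def)
next
  case SA
  assume "y \<in> Delta"
  then obtain x v w where "y = (x, v, w)" "0 \<le> x" "x \<le> 1" "0 \<le> w" "w \<le> v" "v \<le> x" "v \<le> 1 - x"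
    by (auto simp: Delta_def)
  then show ?thesis unfolding SA Delta_def by (auto simp: min_def)
next
  case SB
  assume "y \<in> Delta"
  then obtain x v w where y: "y = (x, v, w)" and *: "0 \<le> x" "x \<le> 1" "0 \<le> w" "w \<le> v" "v \<le> x" "v \<le> 1 - x"
    by (auto simp: Delta_def)
  have "0 \<le> 9/16 + 7/16 * x" "9/16 + 7/16 * x \<le> 1" "0 \<le> w/8" "w/8 \<le> 1/8 - x/8 + v/8"
    "1/8 - x/8 + v/8 \<le> 9/16 + 7/16 * x" "1/8 - x/8 + v/8 \<le> 1 - (9/16 + 7/16 * x)"
    using * by linarith+
  moreover have "1 - (9/16 + 7/16 * x) \<le> 4 * (1/8 - x/8 + v/8)"
  proof -
    have "4 * (1/8 - x/8 + v/8) = 1/2 - x/2 + v/2" by argo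
    then show ?thesis using * by linarith
  qed
  ultimately show ?thesis unfolding SB y T.simps Delta_def by (simp only: mem_Collect_eq case_prod_conv min_def) auto
qed

lemma T_inj: "valid \<sigma> \<Longrightarrow> T \<sigma> x = T \<sigma> y \<Longrightarrow> x = y"
proof (cases \<sigma>)
  case (SE e m)
  assume *: "valid \<sigma>" "T \<sigma> x = T \<sigma> y"
  obtain a b c a' b' c' where xy: "x = (a, b, c)" "y = (a', b', c')" by (metis prod_cases3)
  have p: "pieces e \<noteq> 0" using pieces_ge_1[of e] by simp
  have "a = a'" using *(2) near_neq_far[of e] p unfolding SE xy by simp
  moreover from this have "b = b'" using *(2) thick_pos[of e] unfolding SE xy by simp
  ultimately show ?thesis using *(2) thick_pos[of e] width_pos[of e] unfolding SE xy by simp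
next
  case SA
  assume "T \<sigma> x = T \<sigma> y"
  moreover obtain a b c a' b' c' where xy: "x = (a, b, c)" "y = (a', b', c')" by (metis prod_cases3)
  ultimately show ?thesis unfolding SA by simp
next
  case SB
  assume "T \<sigma> x = T \<sigma> y"
  moreover obtain a b c a' b' c' where xy: "x = (a, b, c)" "y = (a', b', c')" by (metis prod_cases3)
  ultimately show ?thesis unfolding SB by simp
qed

lemma T_SE_fst_mem:
  assumes "m \<le> level e" "y \<in> Delta"
  shows "\<exists>t. knot e m \<le> t \<and> t \<le> knot e (Suc m) \<and> fst (T (SE e m) y) = near_end e + t * (far_end e - near_end e)
    \<and> (t = knot e m \<longrightarrow> y = src) \<and> (t = knot e (Suc m) \<longrightarrow> y = tgt)"
proof -
  obtain x v w where y: "y = (x, v, w)" by (metis prod_cases3)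
  have D: "0 \<le> x" "x \<le> 1" "0 \<le> w" "w \<le> v" "v \<le> x" "v \<le> 1 - x"
    using assms(2) by (auto simp: Delta_def y)
  have p: "0 < pieces e" using pieces_ge_1[of e] by simp
  show ?thesis
    using D p by (intro exI[of _ "knot e m + x / pieces e"])
      (auto simp: y knot_Suc src_def tgt_def divide_right_mono)
qed

lemma less_convex_combination:
  fixes a b c t :: real
  assumes "0 < t" "t < 1" "c \<le> a" "c \<le> b" "a \<noteq> b"
  shows "c < (1 - t) * a + t * b"
proof -
  have eq: "(1 - t) * a + t * b = c + ((1 - t) * (a - c) + t * (b - c))" by (simp add: algebra_simps)
  have "0 \<le> (1 - t) * (a - c)" "0 \<le> t * (b - c)" using assms by auto
  moreover have "(1 - t) * (a - c) \<noteq> 0 \<or> t * (b - c) \<noteq> 0" using assms by auto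
  ultimately show ?thesis unfolding eq by linarith
qed

text \<open>At an interior parameter the first coordinate is a proper convex combination of two
  different numbers in [3/8, 9/16], so the extreme values occur only at ends of the arc.\<close>

lemma T_SE_fst_bound:
  assumes "m \<le> level e" "y \<in> Delta" and "fst (T (SE e m) y) = 3/8 \<or> fst (T (SE e m) y) = 9/16"
  shows "y = src \<or> y = tgt"
proof -
  obtain t where t: "knot e m \<le> t" "t \<le> knot e (Suc m)"
      "fst (T (SE e m) y) = near_end e + t * (far_end e - near_end e)"
      "t = knot e m \<longrightarrow> y = src" "t = knot e (Suc m) \<longrightarrow> y = tgt"
    using T_SE_fst_mem[OF assms(1,2)] by blast
  have "0 \<le> knot e m" "knot e (Suc m) \<le> 1" using assms(1) knot_nonneg knot_le_1 by simp_all
  then have t01: "0 \<le> t" "t \<le> 1" using t by auto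
  have eq: "fst (T (SE e m) y) = (1 - t) * near_end e + t * far_end e" using t(3) by (simp add: algebra_simps)
  have "t = 0 \<or> t = 1"
  proof (rule ccontr)
    assume "\<not> ?thesis"
    then have t': "0 < t" "t < 1" using t01 by auto
    have "3/8 < (1 - t) * near_end e + t * far_end e"
      by (rule less_convex_combination[OF t' near_end_bounds(1) far_end_bounds(1) near_neq_far])
    moreover have "- (9/16) < (1 - t) * - near_end e + t * - far_end e"
      using near_end_bounds(2)[of e] far_end_bounds(2)[of e] near_neq_far[of e]
      by (intro less_convex_combination[OF t']) auto
    ultimately show False using assms(3) eq by auto
  qed
  then show ?thesis using t(1,2,4,5) \<open>0 \<le> knot e m\<close> \<open>knot e (Suc m) \<le> 1\<close> by auto
qed

section \<open>Intersections of cells with each other and with the spokes\<close>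

text \<open>Three reasons keep cells apart: \<open>SA\<close> and \<open>SB\<close> lie beyond the
  extreme vertices, chords of one edge have non-overlapping parameters, and different edges occupy
  disjoint wedges of slopes. What remains are extreme positions, knots and points of height 0, and
  these are ends of cells.\<close>

lemma T_ends_on_overlap:
  assumes "valid \<sigma>" "valid \<tau>" "\<sigma> \<noteq> \<tau>" "x \<in> Delta" "y \<in> Delta" "T \<sigma> x = T \<tau> y"
  shows "x = src \<or> x = tgt"
proof -
  have A: "fst (T SA z) \<le> 3/8 \<and> (fst (T SA z) = 3/8 \<longrightarrow> z = tgt)" if "z \<in> Delta" for z
    using that by (cases z) (auto simp: Delta_def tgt_def)
  have B: "9/16 \<le> fst (T SB z) \<and> (fst (T SB z) = 9/16 \<longrightarrow> z = src)" if "z \<in> Delta" for z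
    using that by (cases z) (auto simp: Delta_def src_def)
  have E: "3/8 \<le> fst (T (SE e m) z) \<and> fst (T (SE e m) z) \<le> 9/16" if "z \<in> Delta" "m \<le> level e" for z e m
    using that T_SE_range(1,2) by (metis prod_cases3)
  have eq: "fst (T \<sigma> x) = fst (T \<tau> y)" using assms(6) by simp
  show ?thesis
  proof (cases \<sigma>)
    case SA
    then show ?thesis using A[OF assms(4)] B[OF assms(5)] E[OF assms(5)] eq assms(2,3)
      by (cases \<tau>) force+
  next
    case SB
    then show ?thesis using B[OF assms(4)] A[OF assms(5)] E[OF assms(5)] eq assms(2,3)
      by (cases \<tau>) force+
  next
    case (SE e m)
    have m: "m \<le> level e" using SE assms(1) by simp
    show ?thesis
    proof (cases \<tau>)
      case SA
      then have "fst (T \<sigma> x) = 3/8" using A[OF assms(5)] E[OF assms(4) m] eq SE by simp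
      then show ?thesis using T_SE_fst_bound[OF m assms(4)] SE by blast
    next
      case SB
      then have "fst (T \<sigma> x) = 9/16" using B[OF assms(5)] E[OF assms(4) m] eq SE by simp
      then show ?thesis using T_SE_fst_bound[OF m assms(4)] SE by blast
    next
      case (SE e' m')
      have m': "m' \<le> level e'" using SE assms(2) by simp
      show ?thesis
      proof (cases "e = e'")
        case True
        then have "m < m' \<or> m' < m" using assms(3) SE \<open>\<sigma> = SE e m\<close> by auto
        obtain t where t: "knot e m \<le> t" "t \<le> knot e (Suc m)"
          "fst (T \<sigma> x) = near_end e + t * (far_end e - near_end e)"
          "t = knot e m \<longrightarrow> x = src" "t = knot e (Suc m) \<longrightarrow> x = tgt"
          using T_SE_fst_mem[OF m assms(4)] \<open>\<sigma> = SE e m\<close> by blast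
        obtain t' where t': "knot e m' \<le> t'" "t' \<le> knot e (Suc m')"
          "fst (T \<tau> y) = near_end e + t' * (far_end e - near_end e)"
          using T_SE_fst_mem[OF m' assms(5)] SE True by blast
        have "t = t'" using t(3) t'(3) eq near_neq_far[of e] by simp
        moreover have "a < b \<Longrightarrow> knot e (Suc a) \<le> knot e b" for a b
          unfolding knot_def using pieces_ge_1[of e] by (intro divide_right_mono) auto
        ultimately show ?thesis using \<open>m < m' \<or> m' < m\<close> t t' by force
      next
        case False
        obtain a b c where x: "x = (a, b, c)" by (metis prod_cases3)
        obtain a' b' c' where y: "y = (a', b', c')" by (metis prod_cases3)
        define H where "H = chord_height e m a + thick e * b"
        note R = T_SE_range[OF m assms(4)[unfolded x], folded H_def]
        note R' = T_SE_range[OF m' assms(5)[unfolded y]]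
        have "T (SE e m) (a, b, c) = T (SE e' m') (a', b', c')"
          using assms(6) unfolding SE \<open>\<sigma> = SE e m\<close> x y .
        then have W: "snd (snd (T (SE e' m') (a', b', c'))) = snd (snd (T (SE e m) (a, b, c)))"
          and "fst (snd (T (SE e' m') (a', b', c'))) = fst (snd (T (SE e m) (a, b, c)))"
          by (simp_all only:)
        then have HH: "chord_height e' m' a' + thick e' * b' = H"
          by (simp add: H_def)
        have "H = 0"
        proof (rule ccontr)
          assume "H \<noteq> 0"
          then have "0 < H" using R(3) by simp
          then have lt: "u * H < u' * H" if "u < u'" for u u' :: real using that by simp
          show False using slopes_disjoint[OF False] lt R(5,6) R'(5,6)[unfolded HH W] by (smt (verit))
        qed
        then show ?thesis using R(7) x by simp
      qed
    qed
  qed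
qed

lemma spoke_coords:
  assumes "y \<in> spoke g"
  obtains t where "0 \<le> t" "t \<le> 1" "fst y = 1/2 + t * (spine_pos g - 1/2)"
    "fst (snd y) = 1/8 + height \<bar>spine_pos g - 1/2\<bar> t" "snd (snd y) = slope0 g * height \<bar>spine_pos g - 1/2\<bar> t"
    "y = spoke_arc g t"
  using assms unfolding spoke_def spoke_arc_def arc_def by auto

lemma spoke_fst_bounds:
  assumes "y \<in> spoke g" 
  shows "3/8 \<le> fst y" "fst y \<le> 9/16"
proof -
  obtain t where t: "0 \<le> t" "t \<le> 1" "fst y = 1/2 + t * (spine_pos g - 1/2)"
    using assms by (rule spoke_coords)
  have eq: "fst y = (1 - t) * (1/2) + t * spine_pos g" unfolding t(3) by argo
  have "(1 - t) * (3/8) + t * (3/8) \<le> fst y" "fst y \<le> (1 - t) * (9/16) + t * (9/16)"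
    unfolding eq using t spine_pos_bounds[of g] by (intro add_mono mult_left_mono; simp)+
  then show "3/8 \<le> fst y" "fst y \<le> 9/16" by argo+
qed

text \<open>A spoke and a cell along an edge have different slopes, so a common point has height 0
  above the spine. It is not the hub, since no end of an edge lies at 1/2.\<close>

lemma T_ends_on_spoke:
  assumes "valid \<sigma>" "x \<in> Delta" "T \<sigma> x \<in> spoke g"
  shows "(x = src \<or> x = tgt) \<and> T \<sigma> x \<noteq> hub"
proof (cases \<sigma>)
  case SA
  have "x = tgt" using assms spoke_fst_bounds(1)[OF assms(3)] SA by (cases x) (auto simp: Delta_def tgt_def)
  then show ?thesis using SA by (auto simp: T_src_tgt spine_pos_extreme spine_def hub_def)
next
  case SB
  have "x = src" using assms spoke_fst_bounds(2)[OF assms(3)] SB by (cases x) (auto simp: Delta_def src_def)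
  then show ?thesis using SB by (auto simp: T_src_tgt spine_pos_extreme spine_def hub_def)
next
  case (SE e m)
  have m: "m \<le> level e" using SE assms(1) by simp
  obtain a b c where x: "x = (a, b, c)" by (metis prod_cases3)
  define H where "H = chord_height e m a + thick e * b"
  note R = T_SE_range[OF m assms(2)[unfolded x], folded H_def]
  obtain t where t: "0 \<le> t" "t \<le> 1" 
    "fst (snd (T \<sigma> x)) = 1/8 + height \<bar>spine_pos g - 1/2\<bar> t" "snd (snd (T \<sigma> x)) = slope0 g * height \<bar>spine_pos g - 1/2\<bar> t"
    using assms(3) by (rule spoke_coords)
  have HH: "height \<bar>spine_pos g - 1/2\<bar> t = H" using t(3) SE x by (simp add: H_def)
  have W: "snd (snd (T (SE e m) (a, b, c))) = slope0 g * H" using t(4) unfolding HH SE x .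
  have H0: "H = 0"
  proof (rule ccontr)
    assume "H \<noteq> 0"
    then have "0 < H" using R(3) by simp
    then have lt: "u * H < u' * H" if "u < u'" for u u' :: real using that by simp
    show False using slope_spoke_disjoint[of g e] lt R(5,6)[unfolded W] by (smt (verit))
  qed
  then have ends: "x = src \<or> x = tgt" using R(7) x by simp
  then obtain k where k: "k \<le> Suc (level e)" "T \<sigma> x = edge_arc e (knot e k)"
    using SE m T_src_tgt(5,6)[of e m] by (metis Suc_le_mono le_SucI)
  have "height (extent e) (knot e k) = 0" using k(2) H0 HH t(3)
    by (simp add: edge_arc_def arc_def extent_def)
  then have "knot e k = 0 \<or> knot e k = 1" using extent_pos[of e] by (simp add: height_def)
  then have "T \<sigma> x = spine (near_end e) \<or> T \<sigma> x = spine (far_end e)" using k edge_arc_ends by metis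
  then show ?thesis using ends near_end_bounds[of e] far_end_bounds[of e] by (auto simp: spine_def hub_def)
qed

lemma hub_in_spoke: "hub \<in> spoke g"
  unfolding spoke_def using spoke_arc_ends(1)[of g] by force

lemma spokes_meet_at_hub:
  assumes "y \<in> spoke g" "y \<in> spoke h" "g \<noteq> h"
  shows "y = hub"
proof -
  obtain t where t: "0 \<le> t" "t \<le> 1" 
    "fst (snd y) = 1/8 + height \<bar>spine_pos g - 1/2\<bar> t" "snd (snd y) = slope0 g * height \<bar>spine_pos g - 1/2\<bar> t"
    "y = spoke_arc g t" using assms(1) by (rule spoke_coords)
  obtain u where u: "0 \<le> u" "u \<le> 1" 
    "fst (snd y) = 1/8 + height \<bar>spine_pos h - 1/2\<bar> u" "snd (snd y) = slope0 h * height \<bar>spine_pos h - 1/2\<bar> u"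
    "y = spoke_arc h u" using assms(2) by (rule spoke_coords)
  have "slope0 g \<noteq> slope0 h"
  proof -
    have "0 < slope0 n" for n by (simp add: slope0_def)
    then show ?thesis using assms(3) slope0_less[of g h] slope0_less[of h g]
      by (cases "g < h") (smt (verit) linorder_neqE_nat)+
  qed
  then have "height \<bar>spine_pos g - 1/2\<bar> t = 0" "height \<bar>spine_pos h - 1/2\<bar> u = 0" using t(3,4) u(3,4) by auto
  moreover have "spine_pos g \<noteq> 1/2" "spine_pos h \<noteq> 1/2" by (rule spine_pos_neq)+
  ultimately have "t = 0 \<or> t = 1" "u = 0 \<or> u = 1" by (auto simp: height_def)
  then show ?thesis using t(5) u(5) spoke_arc_ends spine_pos_inj[of g h] assms(3)
    by (auto simp: spine_def)
qed

section \<open>Accumulation of the cells at the spokes\<close>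

lemma far_end_half: "\<bar>far_end e - 1/2\<bar> \<le> (1/2) ^ (edge_spoke e + 3)"
proof (cases "\<exists>s k. e = Vv s k")
  case True
  then obtain s k where e: "e = Vv s k" by blast
  have "\<bar>bk_pos s k - 1/2\<bar> \<le> \<bar>spine_pos (bspoke s) - 1/2\<bar>"
    using bk_pos_bounds[of s k] by linarith
  then show ?thesis by (simp add: e spine_pos_dist)
next
  case False
  then have "far_end e = spine_pos (edge_spoke e)" by (cases e) auto
  then show ?thesis by (simp add: spine_pos_dist)
qed

text \<open>Apart from finitely many edges the near end is close to the hub. The far end is close to
  the hub as well if \<open>edge_spoke e\<close> is large; otherwise the level is large and the arc
  approaches the arc of its spoke.\<close>

lemma edge_tail:
  assumes "0 < \<epsilon>"
  obtains Bad where "finite Bad"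
    "\<And>e. e \<notin> Bad \<Longrightarrow> \<bar>near_end e - 1/2\<bar> \<le> \<epsilon>"
    "\<And>e. e \<notin> Bad \<Longrightarrow> \<bar>far_end e - 1/2\<bar> \<le> \<epsilon> \<or>
      \<bar>far_end e - spine_pos (edge_spoke e)\<bar> \<le> \<epsilon> \<and> 1 / pieces e \<le> \<epsilon> \<and>
      \<bar>slope e - slope0 (edge_spoke e)\<bar> \<le> \<epsilon>"
proof -
  obtain N1 where N1: "(1/2::real) ^ N1 < \<epsilon>" using real_arch_pow_inv[of \<epsilon> "1/2"] assms by auto
  obtain N2 where N2: "1 / real (Suc N2) < \<epsilon>" using nat_approx_posE[OF assms] .
  define N where "N = max N1 N2"
  have pw: "(1/2::real) ^ n \<le> \<epsilon>" if "n \<ge> N" for n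
  proof -
    have "(1/2::real) ^ n \<le> (1/2) ^ N1" using that by (intro power_decreasing) (auto simp: N_def)
    then show ?thesis using N1 by linarith
  qed
  have fr: "1 / real (n + 1) \<le> \<epsilon>" if "n \<ge> N" for n
  proof -
    have "1 / real (n + 1) \<le> 1 / real (Suc N2)" using that by (intro divide_left_mono) (auto simp: N_def)
    then show ?thesis using N2 by simp
  qed
  show thesis
  proof (rule that[of "{e. near_spoke e \<le> N} \<union> {e. edge_spoke e \<le> N \<and> level e \<le> N}"])
    show "finite ({e. near_spoke e \<le> N} \<union> {e. edge_spoke e \<le> N \<and> level e \<le> N})"
      using finite_edges_near_spoke finite_edges_spoke_level by simp
    fix e assume e: "e \<notin> {e. near_spoke e \<le> N} \<union> {e. edge_spoke e \<le> N \<and> level e \<le> N}"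
    show "\<bar>near_end e - 1/2\<bar> \<le> \<epsilon>"
      unfolding near_end_def spine_pos_dist using e by (intro pw) simp
    show "\<bar>far_end e - 1/2\<bar> \<le> \<epsilon> \<or>
      \<bar>far_end e - spine_pos (edge_spoke e)\<bar> \<le> \<epsilon> \<and> 1 / pieces e \<le> \<epsilon> \<and>
      \<bar>slope e - slope0 (edge_spoke e)\<bar> \<le> \<epsilon>"
    proof (cases "edge_spoke e \<le> N")
      case True
      then have "level e \<ge> N" using e by simp
      then show ?thesis using far_end_dist[of e] slope_dist[of e] pw[of "level e"] fr[of "level e"]
        unfolding pieces_def by linarith
    next
      case False
      then show ?thesis using far_end_half[of e] pw[of "edge_spoke e + 3"] by linarith
    qed
  qed
qed

definition close_to_spoke :: "real \<Rightarrow> sym \<Rightarrow> bool" where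
  "close_to_spoke \<delta> \<sigma> \<longleftrightarrow>
    (\<exists>e m. \<sigma> = SE e m \<and> (\<forall>y\<in>Delta. \<exists>z\<in>spoke (edge_spoke e). near_by \<delta> (T \<sigma> y) z))"

definition small_cell :: "real \<Rightarrow> sym \<Rightarrow> bool" where
  "small_cell \<delta> \<sigma> \<longleftrightarrow> (\<forall>x\<in>Delta. \<forall>y\<in>Delta. near_by \<delta> (T \<sigma> x) (T \<sigma> y))"

text \<open>The constant 6 adds up the errors of the last coordinate: \<epsilon> for chord against
  parabola, 2\<epsilon> for the extents, and \<epsilon> each for the thickness, the slopes and the
  width.\<close>

lemma cell_near_arc:
  assumes m: "m \<le> level e" and y: "(x, v, w) \<in> Delta"
    and near: "\<bar>near_end e - 1/2\<bar> \<le> \<epsilon>" and far: "\<bar>far_end e - spine_pos (edge_spoke e)\<bar> \<le> \<epsilon>"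
    and pcs: "1 / pieces e \<le> \<epsilon>" and slp: "\<bar>slope e - slope0 (edge_spoke e)\<bar> \<le> \<epsilon>"
  shows "near_by (6 * \<epsilon>) (T (SE e m) (x, v, w)) (spoke_arc (edge_spoke e) (knot e m + x / pieces e))"
    and "0 \<le> knot e m + x / pieces e" "knot e m + x / pieces e \<le> 1"
proof -
  have D: "0 \<le> x" "x \<le> 1" "0 \<le> w" "w \<le> v" "v \<le> x" "v \<le> 1 - x"
    using y by (auto simp: Delta_def)
  have p: "0 < pieces e" "1 \<le> pieces e" using pieces_ge_1[of e] by auto
  define d where "d = 1 / pieces e"
  have d: "0 < d" "d \<le> 1" "d \<le> \<epsilon>" using p pcs by (auto simp: d_def)
  define t where "t = knot e m + x / pieces e"
  have tk: "t = knot e m + x * d" by (simp add: t_def d_def)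
  have "x / pieces e \<le> 1 / pieces e" using D p by (intro divide_right_mono) auto
  then have "t \<le> knot e (Suc m)" by (simp add: t_def knot_Suc)
  moreover have "knot e (Suc m) \<le> 1" using m by (intro knot_le_1) simp
  moreover have "0 \<le> t" using D p knot_nonneg[of e m] by (simp add: t_def)
  ultimately have t: "0 \<le> t" "t \<le> 1" by auto
  then show "0 \<le> knot e m + x / pieces e" "knot e m + x / pieces e \<le> 1" by (simp_all add: t_def)
  let ?y = "spine_pos (edge_spoke e)"
  define q where "q = extent e"
  define q' where "q' = \<bar>?y - 1/2\<bar>"
  have q: "0 \<le> q" "q \<le> 1" "0 \<le> q'" "q' \<le> 1"
    using extent_nonneg extent_le[of e] spine_pos_bounds[of "edge_spoke e"] by (auto simp: q_def q'_def)
  have qq: "\<bar>q - q'\<bar> \<le> 2 * \<epsilon>" using near far unfolding q_def q'_def extent_def by linarith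
  have X: "\<bar>(near_end e + t * (far_end e - near_end e)) - (1/2 + t * (?y - 1/2))\<bar> \<le> \<epsilon>"
  proof -
    have "(near_end e + t * (far_end e - near_end e)) - (1/2 + t * (?y - 1/2)) =
        (1 - t) * (near_end e - 1/2) + t * (far_end e - ?y)" by argo
    moreover have "\<bar>(1 - t) * (near_end e - 1/2)\<bar> \<le> (1 - t) * \<epsilon>"
      unfolding abs_mult using t near by (intro mult_mono) auto
    moreover have "\<bar>t * (far_end e - ?y)\<bar> \<le> t * \<epsilon>"
      unfolding abs_mult using t far by (intro mult_mono) auto
    moreover have "(1 - t) * \<epsilon> + t * \<epsilon> = \<epsilon>" by (simp add: algebra_simps)
    ultimately show ?thesis by linarith
  qed
  have ch: "\<bar>chord_height e m x - height q t\<bar> \<le> \<epsilon>"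
  proof -
    have ks: "knot e (Suc m) = knot e m + d" by (simp add: knot_Suc d_def)
    \<comment> \<open>The gap between a parabola and its chord over a parameter interval of length
      \<open>d\<close>.\<close>
    have "height q t - chord_height e m x = q * (d * d) * (x * (1 - x))"
      unfolding chord_height_def height_def q_def[symmetric] ks tk by (simp add: algebra_simps)
    moreover have "0 \<le> q * (d * d) * (x * (1 - x))" using q d D by simp
    moreover have "q * (d * d) * (x * (1 - x)) \<le> 1 * (1 * \<epsilon>) * (1 * 1)"
      using q d D by (intro mult_mono mult_nonneg_nonneg) auto
    ultimately show ?thesis by linarith
  qed
  have hq: "\<bar>height q t - height q' t\<bar> \<le> 2 * \<epsilon>"
  proof -
    have "height q t - height q' t = (t * (1 - t)) * (q - q')" by (simp add: height_def algebra_simps)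
    moreover have "\<bar>(t * (1 - t)) * (q - q')\<bar> \<le> (1 * 1) * (2 * \<epsilon>)"
      unfolding abs_mult using t qq by (intro mult_mono) auto
    ultimately show ?thesis by linarith
  qed
  have thd: "thick e \<le> \<epsilon>" "0 \<le> thick e"
  proof -
    have "thick e = q / 8 * d" by (simp add: thick_def q_def d_def)
    also have "\<dots> \<le> 1 * \<epsilon>" using q d by (intro mult_mono) auto
    finally show "thick e \<le> \<epsilon>" by simp
    show "0 \<le> thick e" using thick_pos[of e] by simp
  qed
  have thv: "0 \<le> thick e * v" "thick e * v \<le> \<epsilon>"
  proof -
    show "0 \<le> thick e * v" using thd D by simp
    have "thick e * v \<le> \<epsilon> * 1" using thd D by (intro mult_mono) auto
    then show "thick e * v \<le> \<epsilon>" by simp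
  qed
  define H where "H = chord_height e m x + thick e * v"
  define H' where "H' = height q' t"
  have HH: "\<bar>H - H'\<bar> \<le> 4 * \<epsilon>" using ch hq thv unfolding H_def H'_def by linarith
  have sl: "0 < slope e" "slope e \<le> 1" "0 < width e" "width e \<le> 1"
    using slope_pos[of e] width_pos[of e] slope_width_le_1[of e] by auto
  have H'1: "0 \<le> H'" "H' \<le> 1" using height_nonneg[of q' t] height_le[of q' t] q t by (auto simp: H'_def)
  have W: "\<bar>(slope e * H + thick e * (width e * w)) - slope0 (edge_spoke e) * H'\<bar> \<le> 6 * \<epsilon>"
  proof -
    have "(slope e * H + thick e * (width e * w)) - slope0 (edge_spoke e) * H' =
        slope e * (H - H') + (slope e - slope0 (edge_spoke e)) * H' + thick e * (width e * w)"
      by (simp add: algebra_simps)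
    moreover have "\<bar>slope e * (H - H')\<bar> \<le> 1 * (4 * \<epsilon>)"
      unfolding abs_mult using sl HH by (intro mult_mono) auto
    moreover have "\<bar>(slope e - slope0 (edge_spoke e)) * H'\<bar> \<le> \<epsilon> * 1"
      unfolding abs_mult using slp H'1 by (intro mult_mono) auto
    moreover have "\<bar>thick e * (width e * w)\<bar> \<le> \<epsilon> * (1 * 1)"
      unfolding abs_mult using thd sl D by (intro mult_mono) auto
    ultimately show ?thesis by linarith
  qed
  have "0 < \<epsilon>" using d by simp
  then show "near_by (6 * \<epsilon>) (T (SE e m) (x, v, w)) (spoke_arc (edge_spoke e) (knot e m + x / pieces e))"
    using X HH W unfolding T.simps spoke_arc_def arc_def near_by_iff t_def[symmetric] H_def[symmetric]
      H'_def[symmetric] q'_def[symmetric] by auto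
qed

lemma cell_near_hub:
  assumes m: "m \<le> level e" and y: "(x, v, w) \<in> Delta"
    and near: "\<bar>near_end e - 1/2\<bar> \<le> \<epsilon>" and far: "\<bar>far_end e - 1/2\<bar> \<le> \<epsilon>"
  shows "near_by (6 * \<epsilon>) (T (SE e m) (x, v, w)) hub"
proof -
  have D: "0 \<le> x" "x \<le> 1" "0 \<le> w" "w \<le> v" "v \<le> x" "v \<le> 1 - x"
    using y by (auto simp: Delta_def)
  have q: "extent e \<le> 2 * \<epsilon>" "0 \<le> extent e" using near far unfolding extent_def by linarith+
  obtain t where t: "knot e m \<le> t" "t \<le> knot e (Suc m)"
      "fst (T (SE e m) (x, v, w)) = near_end e + t * (far_end e - near_end e)"
    using T_SE_fst_mem[OF m y] by blast
  have t01: "0 \<le> t" "t \<le> 1" using t knot_nonneg[of e m] knot_le_1[of "Suc m" e] m by auto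
  have "near_end e + t * (far_end e - near_end e) - 1/2 = (1 - t) * (near_end e - 1/2) + t * (far_end e - 1/2)"
    by argo
  moreover have "\<bar>(1 - t) * (near_end e - 1/2)\<bar> \<le> (1 - t) * \<epsilon>"
    unfolding abs_mult using t01 near by (intro mult_mono) auto
  moreover have "\<bar>t * (far_end e - 1/2)\<bar> \<le> t * \<epsilon>"
    unfolding abs_mult using t01 far by (intro mult_mono) auto
  moreover have "(1 - t) * \<epsilon> + t * \<epsilon> = \<epsilon>" by (simp add: algebra_simps)
  ultimately have X: "\<bar>fst (T (SE e m) (x, v, w)) - 1/2\<bar> \<le> \<epsilon>" unfolding t(3) by linarith
  define H where "H = chord_height e m x + thick e * v"
  note R = T_SE_range[OF m y, folded H_def]
  have "thick e * v \<le> extent e / 8 * 1" using thick_le[of e] thick_pos[of e] D q by (intro mult_mono) auto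
  then have H: "H \<le> 2 * \<epsilon>" using chord_height_le[OF m D(1,2)] q unfolding H_def by linarith
  have "(slope e + width e) * H \<le> 1 * H" using R(3) slope_width_le_1[of e] by (intro mult_right_mono)
  moreover have "0 \<le> slope e * H" using R(3) slope_pos[of e] by simp
  ultimately have W: "0 \<le> snd (snd (T (SE e m) (x, v, w)))" "snd (snd (T (SE e m) (x, v, w))) \<le> 2 * \<epsilon>"
    using R(5,6) H by linarith+
  obtain X W where XW: "T (SE e m) (x, v, w) = (X, 1/8 + H, W)" "X = fst (T (SE e m) (x, v, w))"
      "W = snd (snd (T (SE e m) (x, v, w)))"
    by (simp add: H_def)
  show ?thesis using X H W R(3) unfolding XW(1) hub_def near_by_iff XW(2,3)[symmetric] fst_conv snd_conv by linarith
qed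

text \<open>The basic finiteness property of the cells: compactness, local finiteness off the spokes
  and the gluing of partitions all come from it.\<close>

lemma finite_not_close_or_small:
  assumes "0 < \<delta>"
  shows "finite {\<sigma>. valid \<sigma> \<and> \<not> (close_to_spoke \<delta> \<sigma> \<and> small_cell \<delta> \<sigma>)}"
proof -
  define \<epsilon> where "\<epsilon> = \<delta> / 6"
  have eps: "0 < \<epsilon>" "6 * \<epsilon> = \<delta>" using assms by (auto simp: \<epsilon>_def)
  from edge_tail[OF eps(1)] obtain Bad where Bad: "finite Bad"
    "\<And>e. e \<notin> Bad \<Longrightarrow> \<bar>near_end e - 1/2\<bar> \<le> \<epsilon>"
    "\<And>e. e \<notin> Bad \<Longrightarrow> \<bar>far_end e - 1/2\<bar> \<le> \<epsilon> \<or>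
      \<bar>far_end e - spine_pos (edge_spoke e)\<bar> \<le> \<epsilon> \<and> 1 / pieces e \<le> \<epsilon> \<and>
      \<bar>slope e - slope0 (edge_spoke e)\<bar> \<le> \<epsilon>" by metis
  have "close_to_spoke \<delta> (SE e m) \<and> small_cell \<delta> (SE e m)" if "e \<notin> Bad" and m: "m \<le> level e" for e m
  proof
    show "close_to_spoke \<delta> (SE e m)"
      unfolding close_to_spoke_def
    proof (intro exI conjI ballI)
      fix y assume y: "y \<in> Delta"
      obtain x v w where xvw: "y = (x, v, w)" by (metis prod_cases3)
      from Bad(3)[OF \<open>e \<notin> Bad\<close>] show "\<exists>z\<in>spoke (edge_spoke e). near_by \<delta> (T (SE e m) y) z"
      proof
        assume "\<bar>far_end e - 1/2\<bar> \<le> \<epsilon>"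
        from cell_near_hub[OF m y[unfolded xvw] Bad(2)[OF \<open>e \<notin> Bad\<close>] this]
        show ?thesis unfolding eps(2) xvw using hub_in_spoke by blast
      next
        assume "\<bar>far_end e - spine_pos (edge_spoke e)\<bar> \<le> \<epsilon> \<and> 1 / pieces e \<le> \<epsilon> \<and>
          \<bar>slope e - slope0 (edge_spoke e)\<bar> \<le> \<epsilon>"
        then have *: "\<bar>far_end e - spine_pos (edge_spoke e)\<bar> \<le> \<epsilon>" "1 / pieces e \<le> \<epsilon>"
          "\<bar>slope e - slope0 (edge_spoke e)\<bar> \<le> \<epsilon>" by auto
        note cell_near_arc[OF m y[unfolded xvw] Bad(2)[OF \<open>e \<notin> Bad\<close>] *]
        then show ?thesis unfolding eps(2) xvw spoke_def by (meson atLeastAtMost_iff imageI)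
      qed
    qed simp
    have "extent e / pieces e \<le> 2 * \<epsilon>"
    proof (cases "\<bar>far_end e - 1/2\<bar> \<le> \<epsilon>")
      case True
      then have "extent e \<le> 2 * \<epsilon>" using Bad(2)[OF \<open>e \<notin> Bad\<close>] unfolding extent_def by linarith
      moreover have "extent e / pieces e \<le> extent e / 1"
        using extent_nonneg[of e] pieces_ge_1[of e] by (intro divide_left_mono) auto
      ultimately show ?thesis by simp
    next
      case False
      then have "1 / pieces e \<le> \<epsilon>" using Bad(3)[OF \<open>e \<notin> Bad\<close>] by blast
      moreover have "extent e / pieces e \<le> 1 / pieces e"
        using extent_le[of e] pieces_ge_1[of e] by (intro divide_right_mono) auto
      ultimately show ?thesis using eps by simp
    qed
    then have "2 * (extent e / pieces e) * 1 \<le> \<delta>" using eps by simp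
    then show "small_cell \<delta> (SE e m)"
      unfolding small_cell_def using T_SE_near_by[OF m Delta_near_by] near_by_mono by blast
  qed
  then have "{\<sigma>. valid \<sigma> \<and> \<not> (close_to_spoke \<delta> \<sigma> \<and> small_cell \<delta> \<sigma>)} \<subseteq>
      {SA, SB} \<union> (\<Union>e\<in>Bad. SE e ` {..level e})"
    by (auto elim!: valid.elims)
  then show ?thesis by (rule finite_subset) (use Bad(1) in auto)
qed

lemma continuous_spoke_arc: "continuous_on A (spoke_arc g)"
  unfolding spoke_arc_def arc_def height_def by (intro continuous_intros)

lemma compact_spoke: "compact (spoke g)"
  unfolding spoke_def by (intro compact_continuous_image continuous_spoke_arc compact_Icc)

lemma spoke_near_hub: "y \<in> spoke g \<Longrightarrow> near_by ((1/2) ^ g) y hub"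
proof -
  assume "y \<in> spoke g"
  then obtain t where t: "0 \<le> t" "t \<le> 1" "fst y = 1/2 + t * (spine_pos g - 1/2)"
    "fst (snd y) = 1/8 + height \<bar>spine_pos g - 1/2\<bar> t" "snd (snd y) = slope0 g * height \<bar>spine_pos g - 1/2\<bar> t"
    by (rule spoke_coords)
  define d where "d = \<bar>spine_pos g - 1/2\<bar>"
  have d: "0 \<le> d" "d \<le> (1/2) ^ g"
    unfolding d_def using spine_pos_dist[of g] half_pow_le[of 3 g] by (auto simp: add.commute)
  have "\<bar>t * (spine_pos g - 1/2)\<bar> \<le> 1 * d" unfolding abs_mult d_def using t by (intro mult_mono) auto
  moreover have h: "0 \<le> height d t" "height d t \<le> d" using height_nonneg height_le t d by auto
  moreover have "slope0 g * height d t \<le> 1 * height d t"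
    using h unfolding slope0_def by (intro mult_right_mono power_le_one) auto
  moreover have "0 \<le> slope0 g * height d t" using h by (simp add: slope0_def)
  ultimately show ?thesis using d t
    unfolding near_by_def coord_cases[of "\<lambda>a b. \<bar>a - b\<bar> \<le> (1/2) ^ g"] d_def[symmetric] by (auto simp: hub_def)
qed

text \<open>The spokes shrink to the hub, which lies on all of them, so only finitely many matter
  near any other point.\<close>

lemma closed_spokes: "closed (\<Union>g\<in>I. spoke g)"
proof (cases "I = {}")
  case False
  then have hub: "hub \<in> (\<Union>g\<in>I. spoke g)" using hub_in_spoke by blast
  show ?thesis
    unfolding closed_def open_contains_ball
  proof
    fix x assume x: "x \<in> - (\<Union>g\<in>I. spoke g)"
    then have "x \<noteq> hub" using hub by blast
    then have r: "0 < dist x hub / 2" by simp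
    obtain G where G: "(1/2::real) ^ G < dist x hub / 2 / 3" using real_arch_pow_inv[of "dist x hub / 2 / 3" "1/2"] r by auto
    have "closed (\<Union>g\<in>I \<inter> {..G}. spoke g)" using compact_spoke compact_imp_closed by (intro closed_UN) auto
    then have "open (- (\<Union>g\<in>I \<inter> {..G}. spoke g))" by (rule open_Compl)
    moreover have "x \<in> - (\<Union>g\<in>I \<inter> {..G}. spoke g)" using x by blast
    ultimately obtain \<epsilon> where eps: "0 < \<epsilon>" "ball x \<epsilon> \<subseteq> - (\<Union>g\<in>I \<inter> {..G}. spoke g)"
      unfolding open_contains_ball by blast
    have "ball x (min \<epsilon> (dist x hub / 2)) \<subseteq> - (\<Union>g\<in>I. spoke g)"
    proof
      fix y assume y: "y \<in> ball x (min \<epsilon> (dist x hub / 2))"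
      show "y \<in> - (\<Union>g\<in>I. spoke g)"
      proof
        assume "y \<in> (\<Union>g\<in>I. spoke g)"
        then obtain g where g: "g \<in> I" "y \<in> spoke g" by blast
        have "\<not> g \<le> G" using g eps(2) y by auto
        then have "(1/2::real) ^ g \<le> (1/2) ^ G" by (intro power_decreasing) auto
        then have "dist y hub < dist x hub / 2"
          using dist_le_of_near_by[OF spoke_near_hub[OF g(2)]] G by linarith
        moreover have "dist x hub \<le> dist x y + dist y hub" by (rule dist_triangle)
        ultimately show False using y by simp
      qed
    qed
    then show "\<exists>e>0. ball x e \<subseteq> - (\<Union>g\<in>I. spoke g)"
      using eps(1) r by (intro exI[of _ "min \<epsilon> (dist x hub / 2)"]) simp
  qed
qed simp

text \<open>For \<open>I = UNIV\<close> this is local finiteness away from all spokes. If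
  \<open>I\<close> omits just one spoke \<open>g\<close>, it says that near a point of
  \<open>g\<close> other than the hub only cells of edges with \<open>edge_spoke e = g\<close> can
  accumulate.\<close>

lemma cells_locally_finite:
  assumes "x \<notin> (\<Union>g\<in>I. spoke g)"
  obtains \<delta> where "0 < \<delta>"
    "finite {\<sigma>. valid \<sigma> \<and> (\<exists>y\<in>Delta. dist x (T \<sigma> y) < \<delta>) \<and> \<not> (\<exists>e m. \<sigma> = SE e m \<and> edge_spoke e \<notin> I)}"
proof -
  obtain d where d: "0 < d" "ball x d \<subseteq> - (\<Union>g\<in>I. spoke g)"
    using closed_spokes[of I] assms unfolding closed_def open_contains_ball by blast
  have "{\<sigma>. valid \<sigma> \<and> (\<exists>y\<in>Delta. dist x (T \<sigma> y) < d/2) \<and> \<not> (\<exists>e m. \<sigma> = SE e m \<and> edge_spoke e \<notin> I)}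
      \<subseteq> {\<sigma>. valid \<sigma> \<and> \<not> (close_to_spoke (d/6) \<sigma> \<and> small_cell (d/6) \<sigma>)}"
  proof clarify
    fix \<sigma> y assume \<sigma>: "\<not> (\<exists>e m. \<sigma> = SE e m \<and> edge_spoke e \<notin> I)" and y: "y \<in> Delta" "dist x (T \<sigma> y) < d/2"
      and "close_to_spoke (d/6) \<sigma>"
    then obtain e m z where z: "\<sigma> = SE e m" "z \<in> spoke (edge_spoke e)" "near_by (d/6) (T \<sigma> y) z"
      unfolding close_to_spoke_def by metis
    have "dist (T \<sigma> y) z \<le> d/2" using dist_le_of_near_by[OF z(3)] by simp
    then have "dist x z < d" using y(2) dist_triangle[of x z "T \<sigma> y"] by simp
    moreover have "edge_spoke e \<in> I" using \<sigma> z(1) by blast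
    ultimately show False using d(2) z(2) by auto
  qed
  then show thesis using d(1) finite_not_close_or_small[of "d/6"]
    by (intro that[of "d/2"]) (auto elim: finite_subset)
qed

section \<open>The continuum attached to a colouring\<close>

abbreviation spokes :: "pt set" where "spokes \<equiv> (\<Union>g. spoke g)"

text \<open>Colours are read relative to the label \<open>p\<close>. The copy along
  \<open>Co s\<close> is present only if the moves \<open>s\<close> made after \<open>p\<close> end
  at a coloured position. The case \<open>s = []\<close> is left out: \<open>SA\<close> and
  \<open>SB\<close> link the ends of \<open>Co []\<close> to \<open>src\<close> and
  \<open>tgt\<close>, so separating them is the task itself.\<close>

definition active :: "(position \<Rightarrow> bool) \<Rightarrow> position \<Rightarrow> sym \<Rightarrow> bool" where
  "active c p \<sigma> \<longleftrightarrow> valid \<sigma> \<and> (\<forall>s m. \<sigma> = SE (Co s) m \<longrightarrow> s \<noteq> [] \<and> c (s @ p))"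

definition label :: "position \<Rightarrow> sym \<Rightarrow> position" where
  "label p \<sigma> = (case \<sigma> of SE (Co s) m \<Rightarrow> s @ p | _ \<Rightarrow> [])"

lemma label_simps [simp]:
  "label p SA = []" "label p SB = []" "label p (SE (St i j s) m) = []" "label p (SE (En i j s) m) = []"
  "label p (SE (Vv s k) m) = []" "label p (SE (Co s) m) = s @ p"
  by (simp_all add: label_def)

lemma active_simps [simp]:
  "active c p SA" "active c p SB" "active c p (SE (St i j s) m) \<longleftrightarrow> m \<le> 2 * j"
  "active c p (SE (En i j s) m) \<longleftrightarrow> m \<le> 2 * j + 1"
  "active c p (SE (Vv s k) m) \<longleftrightarrow> m \<le> Suc k"
  "active c p (SE (Co s) m) \<longleftrightarrow> m = 0 \<and> s \<noteq> [] \<and> c (s @ p)"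
  by (auto simp: active_def)

lemma active_valid: "active c p \<sigma> \<Longrightarrow> valid \<sigma>"
  by (simp add: active_def)

primrec approx_set :: "(position \<Rightarrow> bool) \<Rightarrow> nat \<Rightarrow> position \<Rightarrow> pt set" where
  "approx_set c 0 = (\<lambda>p. Delta)"
| "approx_set c (Suc n) =
    (\<lambda>p. spokes \<union> (\<Union>\<sigma>\<in>Collect (active c p). T \<sigma> ` approx_set c n (label p \<sigma>)))"

definition game_continuum :: "(position \<Rightarrow> bool) \<Rightarrow> position \<Rightarrow> pt set" where
  "game_continuum c p = (\<Inter>n. approx_set c n p)"

lemma T_continuous: "continuous_on A (T \<sigma>)"
proof -
  have "continuous_on A (\<lambda>y. T \<sigma> (fst y, fst (snd y), snd (snd y)))"
  proof (cases \<sigma>)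
    case (SE e m)
    show ?thesis unfolding SE T.simps chord_height_def divide_inverse by (rule continuous_intros)+
  next
    case SA
    show ?thesis unfolding SA T.simps divide_inverse by (rule continuous_intros)+
  next
    case SB
    show ?thesis unfolding SB T.simps divide_inverse by (rule continuous_intros)+
  qed
  then show ?thesis by simp
qed

lemma spoke_subset_Delta: "spoke g \<subseteq> Delta"
proof
  fix y assume "y \<in> spoke g"
  then obtain t where t: "0 \<le> t" "t \<le> 1" "fst y = 1/2 + t * (spine_pos g - 1/2)"
    "fst (snd y) = 1/8 + height \<bar>spine_pos g - 1/2\<bar> t" "snd (snd y) = slope0 g * height \<bar>spine_pos g - 1/2\<bar> t"
    by (rule spoke_coords)
  have X: "3/8 \<le> fst y" "fst y \<le> 9/16" using spoke_fst_bounds[OF \<open>y \<in> spoke g\<close>] .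
  define d where "d = \<bar>spine_pos g - 1/2\<bar>"
  define h where "h = height d t"
  have "0 \<le> h" "h \<le> d / 4"
    unfolding h_def d_def using t height_nonneg height_quarter by auto
  moreover have "d \<le> 1/8" unfolding d_def using spine_pos_bounds[of g] by linarith
  ultimately have "h \<le> 1/8" "0 \<le> h" by linarith+
  have "slope0 g * h \<le> 1 * h" using \<open>0 \<le> h\<close> unfolding slope0_def by (intro mult_right_mono power_le_one) auto
  moreover have "0 \<le> slope0 g * h" using \<open>0 \<le> h\<close> by (simp add: slope0_def)
  ultimately have "0 \<le> snd (snd y)" "snd (snd y) \<le> h" "0 \<le> h" "h \<le> 1/8" "fst (snd y) = 1/8 + h"
    using t h_def d_def \<open>0 \<le> h\<close> \<open>h \<le> 1/8\<close> by auto
  then have "(fst y, fst (snd y), snd (snd y)) \<in> Delta" using X unfolding Delta_def by (auto simp: min_def)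
  then show "y \<in> Delta" by simp
qed

lemma approx_set_subset: "approx_set c n p \<subseteq> Delta"
proof (induction n arbitrary: p)
  case (Suc n)
  have "T \<sigma> ` approx_set c n (label p \<sigma>) \<subseteq> Delta" if "active c p \<sigma>" for \<sigma>
    using Suc.IH[of "label p \<sigma>"] T_in_Delta[OF active_valid[OF that]] by blast
  then show ?case using spoke_subset_Delta unfolding approx_set.simps by blast
qed simp

lemma approx_set_decreasing: "approx_set c (Suc n) p \<subseteq> approx_set c n p"
proof (induction n arbitrary: p)
  case 0
  show ?case using approx_set_subset[of c "Suc 0" p] by simp
next
  case (Suc n)
  have "T \<sigma> ` approx_set c (Suc n) (label p \<sigma>) \<subseteq> T \<sigma> ` approx_set c n (label p \<sigma>)" for \<sigma>
    using Suc.IH by (rule image_mono)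
  then show ?case
    unfolding approx_set.simps(2)[of c "Suc n"] approx_set.simps(2)[of c n] by (intro Un_mono UN_mono) auto
qed

lemma approx_set_antimono: "m \<le> n \<Longrightarrow> approx_set c n p \<subseteq> approx_set c m p"
  using lift_Suc_antimono_le[of "\<lambda>n. approx_set c n p", OF approx_set_decreasing] .

text \<open>Off the spokes only finitely many compact cells come near a point, so even an infinite
  union is closed.\<close>

lemma closed_spokes_Un_cells:
  assumes "\<And>\<sigma>. \<sigma> \<in> \<Sigma> \<Longrightarrow> valid \<sigma> \<and> compact (C \<sigma>) \<and> C \<sigma> \<subseteq> Delta"
  shows "closed (spokes \<union> (\<Union>\<sigma>\<in>\<Sigma>. T \<sigma> ` C \<sigma>))"
  unfolding closed_def open_contains_ball
proof
  fix x assume x: "x \<in> - (spokes \<union> (\<Union>\<sigma>\<in>\<Sigma>. T \<sigma> ` C \<sigma>))"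
  then have "x \<notin> spokes" by blast
  then obtain \<delta> where \<delta>: "0 < \<delta>" and "finite {\<sigma>. valid \<sigma> \<and> (\<exists>y\<in>Delta. dist x (T \<sigma> y) < \<delta>) \<and>
      \<not> (\<exists>e m. \<sigma> = SE e m \<and> edge_spoke e \<notin> UNIV)}"
    by (rule cells_locally_finite)
  then have fin: "finite {\<sigma>. valid \<sigma> \<and> (\<exists>y\<in>Delta. dist x (T \<sigma> y) < \<delta>)}" (is "finite ?F") by simp
  have "closed (\<Union>\<sigma>\<in>?F \<inter> \<Sigma>. T \<sigma> ` C \<sigma>)"
  proof (rule closed_UN)
    show "finite (?F \<inter> \<Sigma>)" using fin by blast
    show "\<forall>\<sigma>\<in>?F \<inter> \<Sigma>. closed (T \<sigma> ` C \<sigma>)"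
      using assms compact_continuous_image[OF T_continuous] compact_imp_closed by blast
  qed
  with closed_spokes[of UNIV] have "open (- (spokes \<union> (\<Union>\<sigma>\<in>?F \<inter> \<Sigma>. T \<sigma> ` C \<sigma>)))"
    by (rule open_Compl[OF closed_Un])
  moreover have "x \<in> - (spokes \<union> (\<Union>\<sigma>\<in>?F \<inter> \<Sigma>. T \<sigma> ` C \<sigma>))" using x by blast
  ultimately obtain \<epsilon> where \<epsilon>: "0 < \<epsilon>" "ball x \<epsilon> \<subseteq> - (spokes \<union> (\<Union>\<sigma>\<in>?F \<inter> \<Sigma>. T \<sigma> ` C \<sigma>))"
    by (rule openE)
  have "ball x (min \<epsilon> \<delta>) \<subseteq> - (spokes \<union> (\<Union>\<sigma>\<in>\<Sigma>. T \<sigma> ` C \<sigma>))"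
  proof
    fix y assume y: "y \<in> ball x (min \<epsilon> \<delta>)"
    then have "y \<in> ball x \<epsilon>" by simp
    then have ye: "y \<in> - (spokes \<union> (\<Union>\<sigma>\<in>?F \<inter> \<Sigma>. T \<sigma> ` C \<sigma>))" using \<epsilon>(2) by blast
    have "y \<notin> T \<sigma> ` C \<sigma>" if \<sigma>: "\<sigma> \<in> \<Sigma>" for \<sigma>
    proof
      assume "y \<in> T \<sigma> ` C \<sigma>"
      then obtain u where "u \<in> C \<sigma>" "y = T \<sigma> u" by blast
      moreover from this have "valid \<sigma>" "u \<in> Delta" "dist x (T \<sigma> u) < \<delta>" using assms[OF \<sigma>] y by auto
      ultimately have "\<sigma> \<in> ?F" by blast
      then show False using ye \<sigma> \<open>y \<in> T \<sigma> ` C \<sigma>\<close> by blast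
    qed
    then show "y \<in> - (spokes \<union> (\<Union>\<sigma>\<in>\<Sigma>. T \<sigma> ` C \<sigma>))" using ye by blast
  qed
  then show "\<exists>e>0. ball x e \<subseteq> - (spokes \<union> (\<Union>\<sigma>\<in>\<Sigma>. T \<sigma> ` C \<sigma>))"
    using \<epsilon>(1) \<delta> by (intro exI[of _ "min \<epsilon> \<delta>"]) simp
qed

lemma compact_approx_set: "compact (approx_set c n p)"
proof (induction n arbitrary: p)
  case (Suc n)
  have "closed (approx_set c (Suc n) p)"
    unfolding approx_set.simps using Suc approx_set_subset active_valid
    by (intro closed_spokes_Un_cells) auto
  then have "compact (Delta \<inter> approx_set c (Suc n) p)" using compact_Delta by (intro compact_Int_closed)
  then show ?case using approx_set_subset by (metis inf.absorb2)
qed (simp add: compact_Delta)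

lemma game_continuum_subset: "game_continuum c p \<subseteq> Delta"
  unfolding game_continuum_def using approx_set_subset by blast

lemma compact_game_continuum: "compact (game_continuum c p)"
proof -
  have "closed (game_continuum c p)"
    unfolding game_continuum_def using compact_approx_set compact_imp_closed by (intro closed_INT) auto
  then have "compact (Delta \<inter> game_continuum c p)" using compact_Delta by (intro compact_Int_closed)
  then show ?thesis using game_continuum_subset by (metis inf.absorb2)
qed

lemma spokes_subset_game_continuum: "spokes \<subseteq> game_continuum c p"
proof -
  have "spokes \<subseteq> approx_set c n p" for n using spoke_subset_Delta by (cases n) auto
  then show ?thesis unfolding game_continuum_def by blast
qed

lemma cell_subset_game_continuum:
  assumes "active c p \<sigma>"
  shows "T \<sigma> ` game_continuum c (label p \<sigma>) \<subseteq> game_continuum c p"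
proof -
  have "T \<sigma> ` game_continuum c (label p \<sigma>) \<subseteq> approx_set c n p" for n
  proof (cases n)
    case 0
    have "T \<sigma> y \<in> Delta" if "y \<in> game_continuum c (label p \<sigma>)" for y
      by (rule T_in_Delta[OF active_valid[OF assms] subsetD[OF game_continuum_subset that]])
    then show ?thesis unfolding 0 approx_set.simps by (intro image_subsetI)
  next
    case (Suc m)
    have "game_continuum c (label p \<sigma>) \<subseteq> approx_set c m (label p \<sigma>)"
      unfolding game_continuum_def by blast
    then show ?thesis using assms Suc by auto
  qed
  then show ?thesis unfolding game_continuum_def[of c p] by blast
qed

text \<open>For a point off the spokes finitely many cells are candidates at all stages, so one of
  them serves infinitely often. Its map is injective, hence the preimage is the same at all these
  stages.\<close>

lemma game_continuum_unfold:
  "game_continuum c p = spokes \<union> (\<Union>\<sigma>\<in>Collect (active c p). T \<sigma> ` game_continuum c (label p \<sigma>))"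
proof
  show "spokes \<union> (\<Union>\<sigma>\<in>Collect (active c p). T \<sigma> ` game_continuum c (label p \<sigma>)) \<subseteq> game_continuum c p"
    using spokes_subset_game_continuum cell_subset_game_continuum by blast
  show "game_continuum c p \<subseteq> spokes \<union> (\<Union>\<sigma>\<in>Collect (active c p). T \<sigma> ` game_continuum c (label p \<sigma>))"
  proof
    fix x assume x: "x \<in> game_continuum c p"
    show "x \<in> spokes \<union> (\<Union>\<sigma>\<in>Collect (active c p). T \<sigma> ` game_continuum c (label p \<sigma>))"
    proof (cases "x \<in> spokes")
      case False
      obtain \<delta> where \<delta>: "0 < \<delta>" and "finite {\<sigma>. valid \<sigma> \<and> (\<exists>y\<in>Delta. dist x (T \<sigma> y) < \<delta>) \<and>
          \<not> (\<exists>e m. \<sigma> = SE e m \<and> edge_spoke e \<notin> UNIV)}"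
        using False by (rule cells_locally_finite)
      then have fin: "finite {\<sigma>. valid \<sigma> \<and> (\<exists>y\<in>Delta. dist x (T \<sigma> y) < \<delta>)}" (is "finite ?F") by simp
      have ex: "\<exists>\<sigma>. active c p \<sigma> \<and> x \<in> T \<sigma> ` approx_set c n (label p \<sigma>)" for n
      proof -
        have "x \<in> approx_set c (Suc n) p" using x unfolding game_continuum_def by blast
        then show ?thesis using False unfolding approx_set.simps by blast
      qed
      then obtain f where f: "\<And>n. active c p (f n)" "\<And>n. x \<in> T (f n) ` approx_set c n (label p (f n))"
        by metis
      have "f n \<in> ?F" for n
      proof -
        obtain u where u: "u \<in> approx_set c n (label p (f n))" "x = T (f n) u" using f(2)[of n] by blast
        then have "u \<in> Delta" "dist x (T (f n) u) < \<delta>" using approx_set_subset[of c n] \<delta> by auto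
        then show ?thesis using active_valid[OF f(1)[of n]] by blast
      qed
      then have "finite (range f)" using fin by (meson finite_subset image_subsetI)
      then obtain \<sigma> where "infinite {n. f n = \<sigma>}"
        using pigeonhole_infinite[of UNIV f] by auto
      then have inf: "\<exists>n\<ge>m. f n = \<sigma>" for m
        unfolding infinite_nat_iff_unbounded_le by blast
      then have act: "active c p \<sigma>" using f(1) by metis
      obtain m y where y: "x = T \<sigma> y" using inf f(2) by (metis imageE)
      have "y \<in> approx_set c m (label p \<sigma>)" for m
      proof -
        obtain n where n: "n \<ge> m" "f n = \<sigma>" using inf by blast
        then obtain y' where "y' \<in> approx_set c n (label p \<sigma>)" "x = T \<sigma> y'" using f(2)[of n] by auto
        then have "y \<in> approx_set c n (label p \<sigma>)" using T_inj[OF active_valid[OF act]] y by metis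
        then show ?thesis using approx_set_antimono[OF n(1)] by blast
      qed
      then show ?thesis using act y unfolding game_continuum_def by blast
    qed simp
  qed
qed

lemma ends_in_game_continuum: "src \<in> game_continuum c p" "tgt \<in> game_continuum c p"
proof -
  have "src \<in> approx_set c n p \<and> tgt \<in> approx_set c n p" for n
  proof (induction n arbitrary: p)
    case 0
    show ?case by (simp add: src_in_Delta tgt_in_Delta)
  next
    case (Suc n)
    have "src \<in> T SA ` approx_set c n (label p SA)" "tgt \<in> T SB ` approx_set c n (label p SB)"
      using Suc T_src_tgt(1,4) by (metis imageI)+
    moreover have "active c p SA" "active c p SB" by simp_all
    ultimately show ?case unfolding approx_set.simps by blast
  qed
  then show "src \<in> game_continuum c p" "tgt \<in> game_continuum c p"
    unfolding game_continuum_def by auto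
qed

text \<open>Only finitely many cells come near a point off the spokes, and by induction each of them
  is controlled by finitely many colours.\<close>

lemma approx_set_upper_semicontinuous:
  assumes "x \<notin> approx_set c n p"
  shows "\<exists>\<delta>>0. \<exists>A. finite A \<and> (\<forall>c'. (\<forall>q\<in>A. c' q = c q) \<longrightarrow> ball x \<delta> \<inter> approx_set c' n p = {})"
  using assms
proof (induction n arbitrary: x p)
  case 0
  then have "x \<in> - Delta" by simp
  moreover have "open (- Delta)" using compact_Delta by (intro open_Compl compact_imp_closed)
  ultimately obtain \<delta> where "0 < \<delta>" "ball x \<delta> \<subseteq> - Delta" using openE by metis
  then show ?case by (intro exI[of _ \<delta>]) (auto intro!: exI[of _ "{}"])
next
  case (Suc n)
  then have x: "x \<notin> spokes" "\<And>\<sigma>. active c p \<sigma> \<Longrightarrow> x \<notin> T \<sigma> ` approx_set c n (label p \<sigma>)" by auto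
  obtain \<delta> where \<delta>: "0 < \<delta>" and "finite {\<sigma>. valid \<sigma> \<and> (\<exists>y\<in>Delta. dist x (T \<sigma> y) < \<delta>) \<and>
      \<not> (\<exists>e m. \<sigma> = SE e m \<and> edge_spoke e \<notin> UNIV)}"
    using x(1) by (rule cells_locally_finite)
  then have fin: "finite {\<sigma>. valid \<sigma> \<and> (\<exists>y\<in>Delta. dist x (T \<sigma> y) < \<delta>)}" (is "finite ?F") by simp
  have "open (- spokes)" using closed_spokes[of UNIV] by (rule open_Compl)
  moreover have "x \<in> - spokes" using x(1) by blast
  ultimately obtain \<delta>' where \<delta>': "0 < \<delta>'" "ball x \<delta>' \<subseteq> - spokes" by (rule openE)
  have "\<exists>d>0. \<exists>A. finite A \<and> (\<forall>c'. (\<forall>q\<in>A. c' q = c q) \<longrightarrow> active c' p \<sigma> \<longrightarrow>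
      ball x d \<inter> T \<sigma> ` approx_set c' n (label p \<sigma>) = {})" if \<sigma>: "valid \<sigma>" for \<sigma>
  proof (cases "active c p \<sigma>")
    case False
    then obtain s m where "\<sigma> = SE (Co s) m" "\<not> (s \<noteq> [] \<and> c (s @ p))" using \<sigma> unfolding active_def by blast
    \<comment> \<open>Keeping the colour of this one position keeps the cell inactive.\<close>
    then show ?thesis
      by (intro exI[of _ 1] conjI zero_less_one exI[of _ "{s @ p}"]) (auto simp: active_def)
  next
    case True
    show ?thesis
    proof (cases "x \<in> T \<sigma> ` Delta")
      case False
      have "compact (T \<sigma> ` Delta)" by (rule compact_continuous_image[OF T_continuous compact_Delta])
      then have "open (- (T \<sigma> ` Delta))" by (intro open_Compl compact_imp_closed)
      moreover have "x \<in> - (T \<sigma> ` Delta)" using False by blast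
      ultimately obtain d where "0 < d" "ball x d \<subseteq> - (T \<sigma> ` Delta)" by (rule openE)
      moreover have "T \<sigma> ` approx_set c' n (label p \<sigma>) \<subseteq> T \<sigma> ` Delta" for c'
        using approx_set_subset by (rule image_mono)
      ultimately have "ball x d \<inter> T \<sigma> ` approx_set c' n (label p \<sigma>) = {}" for c' by blast
      then show ?thesis using \<open>0 < d\<close> by blast
    next
      case True
      then obtain y where y: "y \<in> Delta" "x = T \<sigma> y" by blast
      then have "y \<notin> approx_set c n (label p \<sigma>)" using x(2)[OF \<open>active c p \<sigma>\<close>] by blast
      from Suc.IH[OF this] obtain d A where dA: "0 < d" "finite A"
        "\<And>c'. (\<forall>q\<in>A. c' q = c q) \<Longrightarrow> ball y d \<inter> approx_set c' n (label p \<sigma>) = {}"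
        by blast
      have "compact (T \<sigma> ` (Delta - ball y d))"
        by (rule compact_continuous_image[OF T_continuous compact_diff[OF compact_Delta open_ball]])
      then have "open (- (T \<sigma> ` (Delta - ball y d)))" by (intro open_Compl compact_imp_closed)
      moreover have "x \<in> - (T \<sigma> ` (Delta - ball y d))"
      proof
        assume "x \<in> T \<sigma> ` (Delta - ball y d)"
        then obtain y' where "y' \<in> Delta - ball y d" "T \<sigma> y' = T \<sigma> y" using y(2) by fastforce
        then show False using T_inj[OF \<sigma>, of y' y] dA(1) by simp
      qed
      ultimately obtain d' where d': "0 < d'" "ball x d' \<subseteq> - (T \<sigma> ` (Delta - ball y d))"
        by (rule openE)
      have "ball x d' \<inter> T \<sigma> ` approx_set c' n (label p \<sigma>) = {}" if "\<forall>q\<in>A. c' q = c q" for c'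
      proof -
        have "approx_set c' n (label p \<sigma>) \<subseteq> Delta - ball y d"
          using dA(3)[OF that] approx_set_subset by blast
        then show ?thesis using d'(2) by blast
      qed
      then show ?thesis using d'(1) dA(2) by blast
    qed
  qed
  then obtain d A where dA: "\<And>\<sigma>. valid \<sigma> \<Longrightarrow> 0 < d \<sigma>" "\<And>\<sigma>. valid \<sigma> \<Longrightarrow> finite (A \<sigma>)"
    "\<And>\<sigma> c'. valid \<sigma> \<Longrightarrow> (\<forall>q\<in>A \<sigma>. c' q = c q) \<Longrightarrow> active c' p \<sigma> \<Longrightarrow>
      ball x (d \<sigma>) \<inter> T \<sigma> ` approx_set c' n (label p \<sigma>) = {}" by metis
  define r where "r = Min (insert \<delta> (insert \<delta>' (d ` ?F)))"
  have r: "0 < r" "r \<le> \<delta>" "r \<le> \<delta>'" "\<And>\<sigma>. \<sigma> \<in> ?F \<Longrightarrow> r \<le> d \<sigma>"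
  proof -
    have fin': "finite (insert \<delta> (insert \<delta>' (d ` ?F)))" using fin by blast
    have "\<forall>u\<in>insert \<delta> (insert \<delta>' (d ` ?F)). 0 < u" using \<delta> \<delta>'(1) dA(1) by blast
    then show "0 < r" unfolding r_def using fin' by (subst Min_gr_iff) simp_all
    show "r \<le> \<delta>" "r \<le> \<delta>'" unfolding r_def using fin' by (intro Min_le; simp)+
    show "r \<le> d \<sigma>" if "\<sigma> \<in> ?F" for \<sigma> unfolding r_def using fin' that by (intro Min_le) blast+
  qed
  have "ball x r \<inter> approx_set c' (Suc n) p = {}" if c': "\<forall>q\<in>(\<Union>\<sigma>\<in>?F. A \<sigma>). c' q = c q" for c'
  proof (rule ccontr)
    assume "\<not> ?thesis"
    then obtain y where "y \<in> ball x r" and y2: "y \<in> approx_set c' (Suc n) p" by blast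
    then have y: "dist x y < r" by simp
    then have "y \<in> ball x \<delta>'" using r(3) by simp
    then have "y \<notin> spokes" using \<delta>'(2) by blast
    then obtain \<sigma> where \<sigma>: "active c' p \<sigma>" "y \<in> T \<sigma> ` approx_set c' n (label p \<sigma>)"
      using y2 unfolding approx_set.simps by blast
    obtain u where "u \<in> approx_set c' n (label p \<sigma>)" "y = T \<sigma> u" using \<sigma>(2) by blast
    then have "u \<in> Delta" "dist x (T \<sigma> u) < \<delta>" using y r(2) approx_set_subset[of c' n] by (blast, simp)
    then have F: "\<sigma> \<in> ?F" using active_valid[OF \<sigma>(1)] by blast
    then have "ball x (d \<sigma>) \<inter> T \<sigma> ` approx_set c' n (label p \<sigma>) = {}"
      using c' \<sigma>(1) F by (intro dA(3)[OF active_valid]) blast+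
    moreover have "y \<in> ball x (d \<sigma>)" using y r(4)[OF F] by simp
    ultimately show False using \<sigma>(2) by blast
  qed
  moreover have "finite (\<Union>\<sigma>\<in>?F. A \<sigma>)" using fin dA(2) by (intro finite_UN_I) blast+
  ultimately show ?case using r(1) by blast
qed

lemma game_continuum_upper_semicontinuous:
  assumes "x \<notin> game_continuum c p"
  shows "\<exists>\<delta>>0. \<exists>A. finite A \<and> (\<forall>c'. (\<forall>q\<in>A. c' q = c q) \<longrightarrow> ball x \<delta> \<inter> game_continuum c' p = {})"
proof -
  obtain n where "x \<notin> approx_set c n p" using assms unfolding game_continuum_def by blast
  then obtain \<delta> A where *: "0 < \<delta>" "finite A"
    "\<And>c'. (\<forall>q\<in>A. c' q = c q) \<Longrightarrow> ball x \<delta> \<inter> approx_set c' n p = {}"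
    using approx_set_upper_semicontinuous by metis
  have "game_continuum c' p \<subseteq> approx_set c' n p" for c' unfolding game_continuum_def by blast
  then have "\<forall>c'. (\<forall>q\<in>A. c' q = c q) \<longrightarrow> ball x \<delta> \<inter> game_continuum c' p = {}" using *(3) by blast
  then show ?thesis using *(1,2) by blast
qed

text \<open>The point is followed through up to \<open>n\<close> cells, each halving distances; it
  suffices to preserve the colours that make these cells active.\<close>

lemma game_continuum_lower_semicontinuous:
  assumes "x \<in> game_continuum c p"
  shows "\<exists>A. finite A \<and> (\<forall>c'. (\<forall>q\<in>A. c' q = c q) \<longrightarrow> (\<exists>y\<in>game_continuum c' p. near_by ((1/2) ^ n) x y))"
  using assms
proof (induction n arbitrary: x p)
  case 0
  then have "near_by 1 x src" using game_continuum_subset Delta_near_by src_in_Delta by blast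
  then show ?case using ends_in_game_continuum(1) unfolding power_0 by blast
next
  case (Suc n)
  show ?case
  proof (cases "x \<in> spokes")
    case True
    then have "x \<in> game_continuum c' p" for c' using spokes_subset_game_continuum by blast
    moreover have "near_by ((1/2) ^ Suc n) x x" by (simp add: near_by_def)
    ultimately show ?thesis by blast
  next
    case False
    then obtain \<sigma> y where \<sigma>: "active c p \<sigma>" "y \<in> game_continuum c (label p \<sigma>)" "x = T \<sigma> y"
      using Suc.prems game_continuum_unfold[of c p] by blast
    obtain A where A: "finite A"
      "\<And>c'. (\<forall>q\<in>A. c' q = c q) \<Longrightarrow> \<exists>z\<in>game_continuum c' (label p \<sigma>). near_by ((1/2) ^ n) y z"
      using Suc.IH[OF \<sigma>(2)] by blast
    \<comment> \<open>For a copy along \<open>Co s\<close> the colour deciding its activity is the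
      one of its label.\<close>
    have "\<exists>z\<in>game_continuum c' p. near_by ((1/2) ^ Suc n) x z"
      if c': "\<forall>q\<in>insert (label p \<sigma>) A. c' q = c q" for c'
    proof -
      have "\<forall>q\<in>A. c' q = c q" using c' by simp
      then obtain z where z: "z \<in> game_continuum c' (label p \<sigma>)" "near_by ((1/2) ^ n) y z" using A(2) by blast
      have "active c' p \<sigma>" using \<sigma>(1) c' unfolding active_def by auto
      then have "T \<sigma> z \<in> game_continuum c' p" using z(1) cell_subset_game_continuum by blast
      moreover have "near_by ((1/2) ^ Suc n) x (T \<sigma> z)"
        using T_contraction[OF active_valid[OF \<sigma>(1)] z(2)] \<sigma>(3) by (simp add: field_simps)
      ultimately show ?thesis by blast
    qed
    then show ?thesis using A(1) by (intro exI[of _ "insert (label p \<sigma>) A"]) blast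
  qed
qed

section \<open>Words, vertices and the removed points\<close>

instance edge :: countable by countable_datatype
instance sym :: countable by countable_datatype

primrec word_map :: "sym list \<Rightarrow> pt \<Rightarrow> pt" where
  "word_map [] y = y"
| "word_map (\<sigma> # w) y = T \<sigma> (word_map w y)"

lemma word_map_append: "word_map (v @ w) y = word_map v (word_map w y)"
  by (induction v) auto

lemma word_map_in_Delta: "list_all valid w \<Longrightarrow> y \<in> Delta \<Longrightarrow> word_map w y \<in> Delta"
  by (induction w) (simp_all add: T_in_Delta)

lemma word_map_continuous: "continuous_on A (word_map w)"
proof (induction w)
  case Nil
  have "word_map [] = (\<lambda>y. y)" by (rule ext) simp
  then show ?case by (simp add: continuous_on_id)
next
  case (Cons \<sigma> w)
  have "word_map (\<sigma> # w) = T \<sigma> \<circ> word_map w" by (rule ext) simp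
  then show ?case using continuous_on_compose[OF Cons T_continuous] by simp
qed

lemma word_map_contraction:
  "list_all valid w \<Longrightarrow> near_by d x y \<Longrightarrow> near_by ((1/2) ^ length w * d) (word_map w x) (word_map w y)"
proof (induction w)
  case (Cons \<sigma> w)
  then have "near_by ((1/2) ^ length w * d / 2) (T \<sigma> (word_map w x)) (T \<sigma> (word_map w y))"
    by (intro T_contraction) simp_all
  then show ?case by (simp add: field_simps)
qed simp

definition corner :: "pt \<Rightarrow> bool" where "corner y \<longleftrightarrow> y = src \<or> y = tgt"

definition vertices :: "pt set" where
  "vertices = {word_map w y | w y. list_all valid w \<and> corner y}"

text \<open>Nested cells shrink to points of this kind, so these are the points that must not be
  removed.\<close>

definition deep :: "pt \<Rightarrow> bool" where
  "deep x \<longleftrightarrow> (\<forall>n. \<exists>w. list_all valid w \<and> n \<le> length w \<and> x \<in> word_map w ` Delta)"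

lemma corner_in_Delta: "corner y \<Longrightarrow> y \<in> Delta"
  using src_in_Delta tgt_in_Delta unfolding corner_def by blast

text \<open>\<open>src\<close> and \<open>tgt\<close> are fixed by \<open>T SA\<close> and
  \<open>T SB\<close>.\<close>

lemma corner_deep:
  assumes "corner y"
  shows "\<exists>w. list_all valid w \<and> length w = n \<and> y = word_map w y"
proof -
  have "src = word_map (replicate n SA) src" "tgt = word_map (replicate n SB) tgt"
    by (induction n) (simp_all add: T_src_tgt(1,4))
  moreover have "list_all valid (replicate n SA)" "list_all valid (replicate n SB)"
    by (simp_all add: list_all_length)
  ultimately show ?thesis using assms unfolding corner_def by (metis length_replicate)
qed

lemma vertices_deep:
  assumes "x \<in> vertices"
  shows "deep x"
  unfolding deep_def
proof
  fix n
  obtain w y where w: "list_all valid w" "corner y" "x = word_map w y"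
    using assms unfolding vertices_def by blast
  obtain v where v: "list_all valid v" "length v = n" "y = word_map v y" using corner_deep[OF w(2)] by blast
  have "x = word_map (w @ v) y" using w(3) v(3) by (simp add: word_map_append)
  then have "x \<in> word_map (w @ v) ` Delta" using corner_in_Delta[OF w(2)] by blast
  moreover have "list_all valid (w @ v)" "n \<le> length (w @ v)" using w(1) v(1,2) by simp_all
  ultimately show "\<exists>w. list_all valid w \<and> n \<le> length w \<and> x \<in> word_map w ` Delta" by blast
qed

lemma overlap_corner:
  assumes "valid \<sigma>" "valid \<tau>" "\<sigma> \<noteq> \<tau>" "x \<in> Delta" "y \<in> Delta" "T \<sigma> x = T \<tau> y"
  shows "corner x" "corner y"
  using T_ends_on_overlap[OF assms] T_ends_on_overlap[OF assms(2,1) assms(3)[symmetric] assms(5,4) assms(6)[symmetric]]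
  unfolding corner_def by auto

text \<open>If the two words begin with different symbols, the image of the hub in the first cell
  would be a corner. Corners lie in cells of every depth, which contradicts the induction hypothesis
  for the shorter word.\<close>

lemma hub_not_deep:
  assumes "list_all valid v" "list_all valid w" "length v < length w"
  shows "word_map v hub \<notin> word_map w ` Delta"
  using assms
proof (induction v arbitrary: w)
  case Nil
  then obtain \<tau> w' where w: "w = \<tau> # w'" by (cases w) auto
  show ?case
  proof
    assume "word_map [] hub \<in> word_map w ` Delta"
    then obtain y where "y \<in> Delta" "T \<tau> (word_map w' y) = hub" unfolding w by auto
    moreover have "hub \<in> spoke 0" by (rule hub_in_spoke)
    ultimately show False
      using T_ends_on_spoke[of \<tau> "word_map w' y" 0] word_map_in_Delta[of w' y] Nil w by simp
  qed
next
  case (Cons \<sigma> v)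
  then obtain \<tau> w' where w: "w = \<tau> # w'" by (cases w) auto
  have val: "valid \<sigma>" "list_all valid v" "valid \<tau>" "list_all valid w'" "length v < length w'"
    using Cons.prems w by simp_all
  have hubD: "hub \<in> Delta" using hub_in_spoke spoke_subset_Delta by blast
  show ?case
  proof
    assume "word_map (\<sigma> # v) hub \<in> word_map w ` Delta"
    then obtain y where y: "y \<in> Delta" "T \<sigma> (word_map v hub) = T \<tau> (word_map w' y)" unfolding w by auto
    show False
    proof (cases "\<sigma> = \<tau>")
      case True
      then have "word_map v hub = word_map w' y" using T_inj[OF val(1)] y(2) by simp
      then show False using Cons.IH[OF val(2,4,5)] y(1) by blast
    next
      case False
      then have "corner (word_map v hub)"
        using overlap_corner(1)[OF val(1,3) False word_map_in_Delta[OF val(2) hubD]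
          word_map_in_Delta[OF val(4) y(1)] y(2)] by blast
      then obtain u where u: "list_all valid u" "length u = Suc (length v)" "word_map v hub = word_map u (word_map v hub)"
        using corner_deep by blast
      have "word_map v hub \<in> Delta" using word_map_in_Delta val hubD by simp
      then have "word_map v hub \<in> word_map u ` Delta" using u(3) by (metis imageI)
      then show False using Cons.IH[OF val(2) u(1)] u(2) by simp
    qed
  qed
qed

text \<open>The induction used for the hub, with the difference that a spoke point may be a corner
  of a cell, and then it is a vertex.\<close>

lemma spoke_point_deep_vertex:
  assumes "y \<in> spokes" "list_all valid v" "list_all valid w" "length v < length w"
    and "word_map v y \<in> word_map w ` Delta"
  shows "word_map v y \<in> vertices"
  using assms
proof (induction v arbitrary: w)
  case Nil
  then obtain \<tau> w' where w: "w = \<tau> # w'" by (cases w) auto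
  obtain g where g: "y \<in> spoke g" using Nil by blast
  obtain u where u: "u \<in> Delta" "y = T \<tau> (word_map w' u)" using Nil(5) unfolding w by auto
  have "valid \<tau>" "word_map w' u \<in> Delta" using Nil w u word_map_in_Delta by simp_all
  then have "corner (word_map w' u)" using T_ends_on_spoke g u(2) unfolding corner_def by blast
  moreover have "y = word_map [\<tau>] (word_map w' u)" using u(2) by simp
  ultimately show ?case using \<open>valid \<tau>\<close> unfolding vertices_def
    by (intro CollectI exI[of _ "[\<tau>]"] exI[of _ "word_map w' u"]) simp
next
  case (Cons \<sigma> v)
  then obtain \<tau> w' where w: "w = \<tau> # w'" by (cases w) auto
  have val: "valid \<sigma>" "list_all valid v" "valid \<tau>" "list_all valid w'" "length v < length w'"
    using Cons.prems w by simp_all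
  have yD: "y \<in> Delta" using Cons.prems(1) spoke_subset_Delta by blast
  obtain u where u: "u \<in> Delta" "T \<sigma> (word_map v y) = T \<tau> (word_map w' u)"
    using Cons.prems(5) unfolding w by auto
  have "word_map v y \<in> vertices \<or> corner (word_map v y)"
  proof (cases "\<sigma> = \<tau>")
    case True
    then have "word_map v y = word_map w' u" using T_inj[OF val(1)] u(2) by simp
    then have "word_map v y \<in> word_map w' ` Delta" using u(1) by blast
    then show ?thesis using Cons.IH[OF Cons.prems(1) val(2,4,5)] by blast
  next
    case False
    then show ?thesis
      using overlap_corner(1)[OF val(1,3) False word_map_in_Delta[OF val(2) yD]
          word_map_in_Delta[OF val(4) u(1)] u(2)] by blast
  qed
  moreover have "word_map v y \<in> vertices" if "corner (word_map v y)"
    unfolding vertices_def using that by (intro CollectI exI[of _ "[]"] exI[of _ "word_map v y"]) simp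
  ultimately obtain q z where q: "list_all valid q" "corner z" "word_map v y = word_map q z"
    unfolding vertices_def by blast
  then have "word_map (\<sigma> # v) y = word_map (\<sigma> # q) z" "list_all valid (\<sigma> # q)" using val by simp_all
  then show ?case unfolding vertices_def
    by (intro CollectI exI[of _ "\<sigma> # q"] exI[of _ z]) (simp add: q(2))
qed

definition quadratic_curve :: "(real \<Rightarrow> pt) \<Rightarrow> bool" where
  "quadratic_curve f \<longleftrightarrow> (\<forall>k. \<exists>a b c. \<forall>t. coord k (f t) = a + b * t + c * t\<^sup>2)"

lemma quadratic_spoke_arc: "quadratic_curve (spoke_arc g)"
  unfolding quadratic_curve_def
proof
  fix k
  define q where "q = \<bar>spine_pos g - 1/2\<bar>"
  have h: "height q t = q * t + (- q) * t\<^sup>2" for t by (simp add: height_def power2_eq_square algebra_simps)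
  have c0: "coord 0 (spoke_arc g t) = 1/2 + (spine_pos g - 1/2) * t + 0 * t\<^sup>2"
    and c1: "coord (Suc 0) (spoke_arc g t) = 1/8 + q * t + (- q) * t\<^sup>2"
    and c2: "coord 2 (spoke_arc g t) = 0 + (slope0 g * q) * t + (- (slope0 g * q)) * t\<^sup>2" for t
    by (simp_all add: spoke_arc_def arc_def q_def[symmetric] h algebra_simps)
  have "coord k = coord 2" if "k \<noteq> 0" "k \<noteq> 1" using that by (intro ext) (simp add: coord_def)
  then consider "k = 0" | "k = Suc 0" | "coord k = coord 2" by fastforce
  then show "\<exists>a b c. \<forall>t. coord k (spoke_arc g t) = a + b * t + c * t\<^sup>2"
  proof cases
    case 1
    show ?thesis unfolding 1 c0 by blast
  next
    case 2
    show ?thesis unfolding 2 c1 by blast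
  next
    case 3
    show ?thesis unfolding 3 c2 by blast
  qed
qed

lemma T_affine: "\<exists>p q r s. \<forall>y. coord k (T \<sigma> y) = p + q * coord 0 y + r * coord 1 y + s * coord 2 y"
proof -
  have "\<exists>p q r s. \<forall>a b c. coord k (T \<sigma> (a, b, c)) = p + q * a + r * b + s * c"
  proof (cases \<sigma>)
    case (SE e m)
    define h0 where "h0 = height (extent e) (knot e m)"
    define h1 where "h1 = height (extent e) (knot e (Suc m)) - height (extent e) (knot e m)"
    have ch: "chord_height e m a = h0 + a * h1" for a by (simp add: chord_height_def h0_def h1_def)
    have "coord k (T \<sigma> (a, b, c)) =
      (if k = 0 then near_end e + knot e m * (far_end e - near_end e) else if k = 1 then 1/8 + h0 else slope e * h0) +
      (if k = 0 then (far_end e - near_end e) / pieces e else if k = 1 then h1 else slope e * h1) * a +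
      (if k = 0 then 0 else if k = 1 then thick e else slope e * thick e) * b +
      (if k = 0 then 0 else if k = 1 then 0 else thick e * width e) * c" for a b c
      by (auto simp: SE coord_def ch algebra_simps add_divide_distrib diff_divide_distrib)
    then show ?thesis by blast
  next
    case SA
    have "coord k (T \<sigma> (a, b, c)) = 0 + (if k = 0 then 3/8 else if k = 1 then 1/8 else 0) * a +
      (if k = 1 then 1/8 else 0) * b + (if k = 0 \<or> k = 1 then 0 else 1/8) * c" for a b c
      by (auto simp: SA coord_def)
    then show ?thesis by blast
  next
    case SB
    have "coord k (T \<sigma> (a, b, c)) = (if k = 0 then 9/16 else if k = 1 then 1/8 else 0) +
      (if k = 0 then 7/16 else if k = 1 then -1/8 else 0) * a +
      (if k = 1 then 1/8 else 0) * b + (if k = 0 \<or> k = 1 then 0 else 1/8) * c" for a b c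
      by (auto simp: SB coord_def)
    then show ?thesis by blast
  qed
  then show ?thesis by (metis coord_simps One_nat_def prod_cases3)
qed

lemma quadratic_T: "quadratic_curve f \<Longrightarrow> quadratic_curve (\<lambda>t. T \<sigma> (f t))"
  unfolding quadratic_curve_def
proof
  fix k assume f: "\<forall>k. \<exists>a b c. \<forall>t. coord k (f t) = a + b * t + c * t\<^sup>2"
  obtain a b c where abc: "\<And>k t. coord k (f t) = a k + b k * t + c k * t\<^sup>2" using f by metis
  obtain p q r s where "\<And>y. coord k (T \<sigma> y) = p + q * coord 0 y + r * coord 1 y + s * coord 2 y"
    using T_affine by blast
  then have "coord k (T \<sigma> (f t)) = p + q * coord 0 (f t) + r * coord 1 (f t) + s * coord 2 (f t)" for t
    by blast
  then have "coord k (T \<sigma> (f t)) = (p + q * a 0 + r * a 1 + s * a 2) + (q * b 0 + r * b 1 + s * b 2) * t +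
      (q * c 0 + r * c 1 + s * c 2) * t\<^sup>2" for t
    unfolding abc by (simp add: algebra_simps)
  then show "\<exists>a b c. \<forall>t. coord k (T \<sigma> (f t)) = a + b * t + c * t\<^sup>2" by blast
qed

lemma quadratic_word_map: "quadratic_curve (\<lambda>t. word_map w (spoke_arc g t))"
  by (induction w) (simp_all add: quadratic_spoke_arc quadratic_T)

text \<open>A polynomial of degree at most 2 takes a value infinitely often only if it is constant,
  and then it has just one value.\<close>

lemma infinite_level_set_unique:
  assumes "quadratic_curve f"
  shows "\<exists>a. {s. infinite {t. coord k (f t) = s}} \<subseteq> {a}"
proof -
  obtain a b c where f: "\<And>t. coord k (f t) = a + b * t + c * t\<^sup>2"
    using assms unfolding quadratic_curve_def by metis
  have "s = a" if "infinite {t. coord k (f t) = s}" for s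
  proof -
    have "poly [:a - s, b, c:] t = coord k (f t) - s" for t
      by (simp add: f power2_eq_square algebra_simps)
    then have "{t. poly [:a - s, b, c:] t = 0} = {t. coord k (f t) = s}" by (simp only:) simp
    then have "infinite {t. poly [:a - s, b, c:] t = 0}" using that by (simp only:) simp
    then have "[:a - s, b, c:] = 0" using poly_roots_finite by blast
    then show ?thesis by simp
  qed
  then show ?thesis by blast
qed

text \<open>The removed points: the images of the hub, and countably many further points which are dense on
  every image of a spoke. The levels \<open>S\<close> are chosen such that no vertex is removed.\<close>

definition removed :: "real set \<Rightarrow> pt set" where
  "removed S = {word_map w hub | w. list_all valid w} \<union>
    {word_map w y | w y. list_all valid w \<and> y \<in> spokes \<and> (\<exists>k. coord k (word_map w y) \<in> S)}"

definition good_levels :: "real set \<Rightarrow> bool" where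
  "good_levels S \<longleftrightarrow> (\<forall>a b. a < b \<longrightarrow> (\<exists>s\<in>S. a < s \<and> s < b)) \<and>
    (\<forall>y\<in>vertices. \<forall>k. coord k y \<notin> S)"

text \<open>Images of the hub are never deep, and a deep image of a spoke point is a vertex, whose
  coordinates avoid \<open>S\<close>.\<close>

lemma deep_not_removed:
  assumes "good_levels S" "deep x"
  shows "x \<notin> removed S"
proof
  assume "x \<in> removed S"
  then consider (hub) w where "list_all valid w" "x = word_map w hub"
    | (level) w y k where "list_all valid w" "x = word_map w y" "y \<in> spokes" "coord k x \<in> S"
    unfolding removed_def by blast
  then show False
  proof cases
    case hub
    obtain v where "list_all valid v" "Suc (length w) \<le> length v" "x \<in> word_map v ` Delta"
      using assms(2) unfolding deep_def by blast
    then show False using hub_not_deep[of w v] hub by simp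
  next
    case level
    obtain v where "list_all valid v" "Suc (length w) \<le> length v" "x \<in> word_map v ` Delta"
      using assms(2) unfolding deep_def by blast
    then have "x \<in> vertices" using spoke_point_deep_vertex[of y w v] level by simp
    then show False using assms(1) level(4) unfolding good_levels_def by blast
  qed
qed

lemma good_levels_exist: "\<exists>S. good_levels S \<and> countable (removed S)"
proof -
  \<comment> \<open>The forbidden levels: coordinates of vertices, and values which a coordinate
    takes infinitely often on the curve of some spoke.\<close>
  define bad where "bad = (\<Union>k. coord k ` vertices) \<union>
    (\<Union>w. \<Union>g. \<Union>k. {s. infinite {t. coord k (word_map w (spoke_arc g t)) = s}})"
  have "vertices \<subseteq> (\<lambda>(w, y). word_map w y) ` (UNIV \<times> {src, tgt})"
    unfolding vertices_def corner_def by force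
  then have "countable vertices" by (rule countable_subset) simp
  moreover have "countable {s. infinite {t. coord k (word_map w (spoke_arc g t)) = s}}" for w g k
    using infinite_level_set_unique[OF quadratic_word_map, of k w g] by (metis countable_empty countable_insert countable_subset)
  ultimately have "countable bad" unfolding bad_def by (intro countable_Un countable_UN countable_image) auto
  then have "countable ((\<lambda>(b, q). b - q) ` (bad \<times> \<rat>))" by (intro countable_image countable_SIGMA) (auto simp: countable_rat)
  then obtain u where u: "u \<notin> (\<lambda>(b, q). b - q) ` (bad \<times> \<rat>)"
    using uncountable_UNIV_real by (metis UNIV_eq_I)
  \<comment> \<open>A translate of the rationals disjoint from the countable set
    \<open>bad\<close>.\<close>
  define S where "S = (\<lambda>q. q + u) ` \<rat>"
  have S: "countable S" unfolding S_def by (intro countable_image countable_rat)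
  have disj: "s \<notin> bad" if s: "s \<in> S" for s
  proof
    assume "s \<in> bad"
    obtain q where "q \<in> \<rat>" "s = q + u" using s S_def by blast
    then have "u = (\<lambda>(b, q). b - q) (s, q)" by simp
    then show False using u \<open>s \<in> bad\<close> \<open>q \<in> \<rat>\<close> by blast
  qed
  have "\<exists>s\<in>S. a < s \<and> s < b" if "a < b" for a b
  proof -
    have "a - u < b - u" using that by simp
    from Rats_dense_in_real[OF this] obtain q where "q \<in> \<rat>" "a - u < q" "q < b - u" by blast
    then show ?thesis unfolding S_def by (intro bexI[of _ "q + u"]) auto
  qed
  moreover have "coord k y \<notin> S" if "y \<in> vertices" for y k
  proof
    assume "coord k y \<in> S"
    moreover have "coord k y \<in> bad" unfolding bad_def by (intro UnI1 UN_I[of k] UNIV_I imageI that)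
    ultimately show False using disj by blast
  qed
  ultimately have "good_levels S" unfolding good_levels_def by blast
  moreover have "countable (removed S)"
  proof -
    have "finite {t. coord k (word_map w (spoke_arc g t)) = s}" if "s \<in> S" for k w g s
    proof (rule ccontr)
      assume "infinite {t. coord k (word_map w (spoke_arc g t)) = s}"
      then have "s \<in> bad" unfolding bad_def by (intro UnI2 UN_I[OF UNIV_I] CollectI)
      then show False using disj[OF that] by simp
    qed
    then have "countable (\<Union>w. \<Union>g. \<Union>k. \<Union>s\<in>S. (\<lambda>t. word_map w (spoke_arc g t)) ` {t. coord k (word_map w (spoke_arc g t)) = s})"
      using S by (intro countable_UN countable_image) (auto intro: countable_finite)
    moreover have "countable (range (\<lambda>w. word_map w hub))" by (rule countable_image) simp
    moreover have "removed S \<subseteq> range (\<lambda>w. word_map w hub) \<union>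
        (\<Union>w. \<Union>g. \<Union>k. \<Union>s\<in>S. (\<lambda>t. word_map w (spoke_arc g t)) ` {t. coord k (word_map w (spoke_arc g t)) = s})"
      unfolding removed_def spoke_def by blast
    ultimately show ?thesis by (meson countable_Un countable_subset)
  qed
  ultimately show ?thesis by blast
qed

section \<open>Locally constant functions and gluing over the cells\<close>

text \<open>A Boolean function with this property encodes a clopen subset of \<open>A\<close>; its
  values outside \<open>A\<close> are irrelevant.\<close>

definition locally_constant_on :: "'a::metric_space set \<Rightarrow> ('a \<Rightarrow> bool) \<Rightarrow> bool" where
  "locally_constant_on A \<phi> \<longleftrightarrow> (\<forall>x\<in>A. \<exists>\<delta>>0. \<forall>y\<in>A. dist x y < \<delta> \<longrightarrow> \<phi> y = \<phi> x)"

lemma locally_constant_on_const: "locally_constant_on A (\<lambda>_. b)"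
  unfolding locally_constant_on_def by (auto intro: exI[of _ 1])

lemma positive_distance:
  fixes x :: pt
  assumes "compact C" "x \<notin> C"
  shows "\<exists>\<delta>>0. \<forall>y\<in>C. \<delta> \<le> dist x y"
proof -
  have "open (- C)" using assms(1) by (intro open_Compl compact_imp_closed)
  moreover have "x \<in> - C" using assms(2) by simp
  ultimately obtain \<delta> where "0 < \<delta>" "ball x \<delta> \<subseteq> - C" by (rule openE)
  moreover from this have "\<delta> \<le> dist x y" if "y \<in> C" for y
    using that by (meson ComplD mem_ball not_le subsetD)
  ultimately show ?thesis by blast
qed

text \<open>Cells meet each other and the spokes only at corners, so agreement at corners makes the
  glued function well defined. The danger is accumulation at a spoke; by \<open>fin\<close> only
  finitely many nearby cells deviate from the value there, and these are handled one at a
  time.\<close>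

lemma glue_cells:
  fixes R :: "pt set" and c :: "position \<Rightarrow> bool" and p :: position
  defines "F \<equiv> \<lambda>\<sigma>. game_continuum c (label p \<sigma>) - T \<sigma> -` R"
  assumes cells: "\<And>\<sigma>. active c p \<sigma> \<Longrightarrow> locally_constant_on (F \<sigma>) (\<phi> \<sigma>)"
    and spoke: "locally_constant_on (spokes - R) K"
    and K: "\<And>\<sigma> y. active c p \<sigma> \<Longrightarrow> corner y \<Longrightarrow> T \<sigma> y \<in> spokes \<Longrightarrow> \<phi> \<sigma> y = K (T \<sigma> y)"
    and agree: "\<And>\<sigma> \<tau> y z. active c p \<sigma> \<Longrightarrow> active c p \<tau> \<Longrightarrow> \<sigma> \<noteq> \<tau> \<Longrightarrow> corner y \<Longrightarrow> corner z \<Longrightarrow>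
      T \<sigma> y = T \<tau> z \<Longrightarrow> T \<sigma> y \<notin> spokes \<Longrightarrow> \<phi> \<sigma> y = \<phi> \<tau> z"
    and fin: "\<And>x. x \<in> spokes - R \<Longrightarrow>
      \<exists>\<delta>>0. finite {\<sigma>. active c p \<sigma> \<and> (\<exists>y\<in>F \<sigma>. dist x (T \<sigma> y) < \<delta> \<and> \<phi> \<sigma> y \<noteq> K x)}"
  shows "\<exists>\<psi>. locally_constant_on (game_continuum c p - R) \<psi> \<and> (\<forall>x\<in>spokes - R. \<psi> x = K x) \<and>
    (\<forall>\<sigma>. active c p \<sigma> \<longrightarrow> (\<forall>y\<in>F \<sigma>. \<psi> (T \<sigma> y) = \<phi> \<sigma> y))"
proof -
  \<comment> \<open>Off the spokes the value does not depend on the chosen cell: a point shared by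
    two cells is a corner of both, and \<open>agree\<close> applies.\<close>
  define \<psi> where "\<psi> x = (if x \<in> spokes then K x else
    (\<exists>\<sigma> y. active c p \<sigma> \<and> y \<in> game_continuum c (label p \<sigma>) \<and> x = T \<sigma> y \<and> \<phi> \<sigma> y))" for x
  have \<psi>_cell: "\<psi> (T \<sigma> y) = \<phi> \<sigma> y" if \<sigma>: "active c p \<sigma>" and y: "y \<in> game_continuum c (label p \<sigma>)" for \<sigma> y
  proof (cases "T \<sigma> y \<in> spokes")
    case True
    have yD: "y \<in> Delta" using y game_continuum_subset by blast
    obtain g where "T \<sigma> y \<in> spoke g" using True by blast
    then have "corner y" using T_ends_on_spoke[OF active_valid[OF \<sigma>] yD] unfolding corner_def by blast
    then show ?thesis using K[OF \<sigma> _ True] True by (simp add: \<psi>_def)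
  next
    case False
    have "\<phi> \<tau> z = \<phi> \<sigma> y" if \<tau>: "active c p \<tau>" and z: "z \<in> game_continuum c (label p \<tau>)" and eq: "T \<sigma> y = T \<tau> z" for \<tau> z
    proof (cases "\<sigma> = \<tau>")
      case True
      then have "y = z" using T_inj[OF active_valid[OF \<sigma>]] eq by blast
      then show ?thesis using True by simp
    next
      case neq: False
      have D: "y \<in> Delta" "z \<in> Delta" using y z game_continuum_subset by blast+
      note overlap_corner[OF active_valid[OF \<sigma>] active_valid[OF \<tau>] neq D eq]
      then show ?thesis using agree[OF \<sigma> \<tau> neq _ _ eq False] by simp
    qed
    then show ?thesis using False \<sigma> y unfolding \<psi>_def by (smt (verit))
  qed
  have "locally_constant_on (game_continuum c p - R) \<psi>"
    unfolding locally_constant_on_def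
  proof
    fix x assume x: "x \<in> game_continuum c p - R"
    \<comment> \<open>Both cases give the same information: nearby spoke points, and all but
      finitely many of the nearby cells, have the value \<open>\<psi> x\<close>.\<close>
    obtain \<delta> where \<delta>: "0 < \<delta>" "\<And>y. y \<in> spokes - R \<Longrightarrow> dist x y < \<delta> \<Longrightarrow> \<psi> y = \<psi> x"
      and fin': "finite {\<sigma>. active c p \<sigma> \<and> (\<exists>y\<in>F \<sigma>. dist x (T \<sigma> y) < \<delta> \<and> \<phi> \<sigma> y \<noteq> \<psi> x)}"
    proof (cases "x \<in> spokes")
      case True
      then have xs: "x \<in> spokes - R" using x by simp
      obtain \<delta>1 where \<delta>1: "0 < \<delta>1"
        and f1: "finite {\<sigma>. active c p \<sigma> \<and> (\<exists>y\<in>F \<sigma>. dist x (T \<sigma> y) < \<delta>1 \<and> \<phi> \<sigma> y \<noteq> K x)}"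
        using fin[OF xs] by blast
      obtain \<delta>2 where \<delta>2: "0 < \<delta>2" "\<forall>y\<in>spokes - R. dist x y < \<delta>2 \<longrightarrow> K y = K x"
        using spoke xs unfolding locally_constant_on_def by blast
      have xK: "\<psi> x = K x" using True by (simp add: \<psi>_def)
      show thesis
      proof (rule that[of "min \<delta>1 \<delta>2"])
        show "\<psi> y = \<psi> x" if "y \<in> spokes - R" "dist x y < min \<delta>1 \<delta>2" for y
        proof -
          have "\<psi> y = K y" using that(1) by (simp add: \<psi>_def)
          also have "\<dots> = K x" using \<delta>2(2)[rule_format, OF that(1)] that(2) by simp
          finally show ?thesis using xK by simp
        qed
        show "finite {\<sigma>. active c p \<sigma> \<and> (\<exists>y\<in>F \<sigma>. dist x (T \<sigma> y) < min \<delta>1 \<delta>2 \<and> \<phi> \<sigma> y \<noteq> \<psi> x)}"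
          unfolding xK by (rule finite_subset[OF _ f1]) fastforce
      qed (use \<delta>1 \<delta>2 in simp)
    next
      case False
      obtain \<delta>1 where \<delta>1: "0 < \<delta>1" and "finite {\<sigma>. valid \<sigma> \<and> (\<exists>y\<in>Delta. dist x (T \<sigma> y) < \<delta>1) \<and>
          \<not> (\<exists>e m. \<sigma> = SE e m \<and> edge_spoke e \<notin> UNIV)}"
        using False by (rule cells_locally_finite)
      then have f1: "finite {\<sigma>. valid \<sigma> \<and> (\<exists>y\<in>Delta. dist x (T \<sigma> y) < \<delta>1)}" by simp
      have "open (- spokes)" using closed_spokes[of UNIV] by (rule open_Compl)
      moreover have "x \<in> - spokes" using False by blast
      ultimately obtain \<delta>2 where \<delta>2: "0 < \<delta>2" "ball x \<delta>2 \<subseteq> - spokes" by (rule openE)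
      show thesis
      proof (rule that[of "min \<delta>1 \<delta>2"])
        show "\<psi> y = \<psi> x" if "y \<in> spokes - R" "dist x y < min \<delta>1 \<delta>2" for y
        proof -
          have "y \<in> ball x \<delta>2" using that(2) by simp
          then show ?thesis using \<delta>2(2) that(1) by blast
        qed
        show "finite {\<sigma>. active c p \<sigma> \<and> (\<exists>y\<in>F \<sigma>. dist x (T \<sigma> y) < min \<delta>1 \<delta>2 \<and> \<phi> \<sigma> y \<noteq> \<psi> x)}"
        proof (rule finite_subset[OF _ f1], rule subsetI)
          fix \<sigma> assume "\<sigma> \<in> {\<sigma>. active c p \<sigma> \<and> (\<exists>y\<in>F \<sigma>. dist x (T \<sigma> y) < min \<delta>1 \<delta>2 \<and> \<phi> \<sigma> y \<noteq> \<psi> x)}"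
          then obtain y where "active c p \<sigma>" "y \<in> F \<sigma>" "dist x (T \<sigma> y) < min \<delta>1 \<delta>2" by blast
          moreover from this have "y \<in> Delta" using game_continuum_subset unfolding F_def by blast
          ultimately show "\<sigma> \<in> {\<sigma>. valid \<sigma> \<and> (\<exists>y\<in>Delta. dist x (T \<sigma> y) < \<delta>1)}"
            using active_valid by (intro CollectI conjI bexI[of _ y]) simp_all
        qed
      qed (use \<delta>1 \<delta>2 in simp)
    qed
    define Bad where "Bad = {\<sigma>. active c p \<sigma> \<and> (\<exists>y\<in>F \<sigma>. dist x (T \<sigma> y) < \<delta> \<and> \<phi> \<sigma> y \<noteq> \<psi> x)}"
    have "\<exists>d>0. \<forall>y\<in>F \<sigma>. dist x (T \<sigma> y) < d \<longrightarrow> \<phi> \<sigma> y = \<psi> x" if \<sigma>: "active c p \<sigma>" for \<sigma>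
    proof (cases "x \<in> T \<sigma> ` game_continuum c (label p \<sigma>)")
      case False
      have "compact (T \<sigma> ` game_continuum c (label p \<sigma>))"
        by (rule compact_continuous_image[OF T_continuous compact_game_continuum])
      from positive_distance[OF this False] obtain d where
        d: "0 < d" "\<forall>y\<in>T \<sigma> ` game_continuum c (label p \<sigma>). d \<le> dist x y" by blast
      have "\<not> dist x (T \<sigma> y) < d" if "y \<in> F \<sigma>" for y
        using that d(2) unfolding F_def by (simp add: not_less)
      then show ?thesis using d(1) by blast
    next
      case True
      then obtain y0 where y0: "y0 \<in> game_continuum c (label p \<sigma>)" "x = T \<sigma> y0" by blast
      then have "y0 \<in> F \<sigma>" using x unfolding F_def by simp
      then obtain d0 where d0: "0 < d0" "\<forall>y\<in>F \<sigma>. dist y0 y < d0 \<longrightarrow> \<phi> \<sigma> y = \<phi> \<sigma> y0"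
        using cells[OF \<sigma>] unfolding locally_constant_on_def by blast
      \<comment> \<open>Compactness makes the inverse of \<open>T \<sigma>\<close> continuous at
        \<open>x\<close>: points of the cell close to \<open>x\<close> come from the ball around
        \<open>y0\<close>.\<close>
      have comp: "compact (T \<sigma> ` (game_continuum c (label p \<sigma>) - ball y0 d0))"
        by (rule compact_continuous_image[OF T_continuous compact_diff[OF compact_game_continuum open_ball]])
      have "x \<notin> T \<sigma> ` (game_continuum c (label p \<sigma>) - ball y0 d0)"
      proof
        assume "x \<in> T \<sigma> ` (game_continuum c (label p \<sigma>) - ball y0 d0)"
        then obtain y' where "y' \<notin> ball y0 d0" "T \<sigma> y' = T \<sigma> y0" using y0(2) by (metis DiffD2 imageE)
        then show False using T_inj[OF active_valid[OF \<sigma>], of y' y0] d0(1) by simp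
      qed
      from positive_distance[OF comp this] obtain d where d: "0 < d"
        "\<forall>y\<in>T \<sigma> ` (game_continuum c (label p \<sigma>) - ball y0 d0). d \<le> dist x y" by blast
      have "\<phi> \<sigma> y = \<psi> x" if y: "y \<in> F \<sigma>" "dist x (T \<sigma> y) < d" for y
      proof -
        have "y \<in> ball y0 d0"
        proof (rule ccontr)
          assume "y \<notin> ball y0 d0"
          then have "T \<sigma> y \<in> T \<sigma> ` (game_continuum c (label p \<sigma>) - ball y0 d0)"
            using y(1) unfolding F_def by blast
          then have "d \<le> dist x (T \<sigma> y)" using d(2) by blast
          then show False using y(2) by simp
        qed
        then have "\<phi> \<sigma> y = \<phi> \<sigma> y0" using d0(2) y(1) by simp
        then show ?thesis using \<psi>_cell[OF \<sigma> y0(1)] y0(2) by simp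
      qed
      then show ?thesis using d(1) by blast
    qed
    then obtain d where d: "\<And>\<sigma>. active c p \<sigma> \<Longrightarrow> 0 < d \<sigma>"
      "\<And>\<sigma> y. active c p \<sigma> \<Longrightarrow> y \<in> F \<sigma> \<Longrightarrow> dist x (T \<sigma> y) < d \<sigma> \<Longrightarrow> \<phi> \<sigma> y = \<psi> x" by metis
    define r where "r = Min (insert \<delta> (d ` Bad))"
    have finB: "finite (insert \<delta> (d ` Bad))" using fin' unfolding Bad_def by simp
    have "\<forall>u\<in>insert \<delta> (d ` Bad). 0 < u" using \<delta>(1) d(1) unfolding Bad_def by blast
    then have r: "0 < r" unfolding r_def using finB by (subst Min_gr_iff) simp_all
    have r\<delta>: "r \<le> \<delta>" and rd: "\<sigma> \<in> Bad \<Longrightarrow> r \<le> d \<sigma>" for \<sigma>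
      unfolding r_def using finB by (intro Min_le; blast)+
    have "\<psi> y = \<psi> x" if y: "y \<in> game_continuum c p - R" "dist x y < r" for y
    proof (cases "y \<in> spokes")
      case True
      then show ?thesis using \<delta>(2)[of y] y r\<delta> by simp
    next
      case False
      then obtain \<sigma> z where z: "active c p \<sigma>" "z \<in> game_continuum c (label p \<sigma>)" "y = T \<sigma> z"
        using y(1) game_continuum_unfold[of c p] by blast
      then have zF: "z \<in> F \<sigma>" using y(1) unfolding F_def by simp
      have "\<phi> \<sigma> z = \<psi> x"
      proof (cases "\<sigma> \<in> Bad")
        case True
        then show ?thesis using d(2)[OF z(1) zF] rd[OF True] y(2) z(3) by simp
      next
        case False
        then show ?thesis using z zF y(2) r\<delta> unfolding Bad_def by force
      qed
      then show ?thesis using \<psi>_cell[OF z(1,2)] z(3) by simp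
    qed
    then show "\<exists>\<delta>>0. \<forall>y\<in>game_continuum c p - R. dist x y < \<delta> \<longrightarrow> \<psi> y = \<psi> x" using r by blast
  qed
  moreover have "\<forall>x\<in>spokes - R. \<psi> x = K x" by (simp add: \<psi>_def)
  moreover have "\<forall>\<sigma>. active c p \<sigma> \<longrightarrow> (\<forall>y\<in>F \<sigma>. \<psi> (T \<sigma> y) = \<phi> \<sigma> y)"
    using \<psi>_cell unfolding F_def by blast
  ultimately show ?thesis by blast
qed

lemma spine_mem_spoke:
  assumes "spine x \<in> spoke g" "x \<noteq> 1/2"
  shows "x = spine_pos g"
proof -
  obtain t where t: "0 \<le> t" "t \<le> 1" "fst (spine x) = 1/2 + t * (spine_pos g - 1/2)"
    "fst (snd (spine x)) = 1/8 + height \<bar>spine_pos g - 1/2\<bar> t"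
    using assms(1) by (rule spoke_coords)
  have "height \<bar>spine_pos g - 1/2\<bar> t = 0" using t(4) by (simp add: spine_def)
  then have "t = 0 \<or> t = 1" using spine_pos_neq[of g] by (simp add: height_def)
  then show ?thesis using t(3) assms(2) by (auto simp: spine_def)
qed

lemma bk_pos_lower: "1/2 + 3/4 * (1/2) ^ (bspoke s + 3) \<le> bk_pos s k"
proof -
  have "(1/2::real) ^ (k + 2) \<le> 1/4" using half_pow_le[of k 2] by (simp add: power2_eq_square)
  then have "(1/2) ^ (bspoke s + 3) * (3/4) \<le> (1/2) ^ (bspoke s + 3) * (1 - (1/2::real) ^ (k + 2))"
    by (intro mult_left_mono) auto
  then show ?thesis unfolding bk_pos_def by linarith
qed

text \<open>The offset of a vertex with a larger number is at most half of that of
  \<open>b(s)\<close>, whereas \<open>b_k(s)\<close> keeps at least 3/4 of it.\<close>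

lemma bspoke_pos_gap:
  assumes "bspoke s < g"
  shows "spine_pos g < bk_pos s k"
proof -
  have "(1/2::real) ^ (g + 3) \<le> (1/2) ^ (Suc (bspoke s + 3))" using assms by (intro power_decreasing) auto
  then have "(1/2::real) ^ (g + 3) \<le> 1/2 * (1/2) ^ (bspoke s + 3)" unfolding power_Suc .
  moreover have "0 < (1/2::real) ^ (bspoke s + 3)" by simp
  moreover have "spine_pos g \<le> 1/2 + (1/2) ^ (g + 3)" by (simp add: spine_pos_def)
  ultimately show ?thesis using bk_pos_lower[of s k] by linarith
qed

lemma bk_pos_not_spine_pos: "bk_pos s k \<noteq> spine_pos g"
proof (cases "bspoke s < g")
  case True
  then show ?thesis using bspoke_pos_gap[of s g k] by simp
next
  case False
  show ?thesis
  proof (cases "even g")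
    case True
    then have "spine_pos g < 1/2" by (simp add: spine_pos_def)
    then show ?thesis using bk_pos_bounds(1)[of s k] by simp
  next
    case odd: False
    have "(1/2::real) ^ (bspoke s + 3) \<le> (1/2) ^ (g + 3)" using False by (intro power_decreasing) auto
    moreover have "odd (bspoke s)" by (simp add: bspoke_def)
    ultimately have "spine_pos (bspoke s) \<le> spine_pos g" using odd by (simp add: spine_pos_def)
    then show ?thesis using bk_pos_bounds(2)[of s k] by simp
  qed
qed

lemma bk_pos_inj: "bk_pos s k = bk_pos t l \<Longrightarrow> s = t \<and> k = l"
proof -
  assume eq: "bk_pos s k = bk_pos t l"
  have "\<not> bspoke s < bspoke t" using bspoke_pos_gap[of s "bspoke t" k] bk_pos_bounds(2)[of t l] eq by force
  moreover have "\<not> bspoke t < bspoke s" using bspoke_pos_gap[of t "bspoke s" l] bk_pos_bounds(2)[of s k] eq by force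
  ultimately have st: "s = t" by (metis bspoke_eq linorder_neqE_nat)
  then have "(1/2::real) ^ (k + 2) = (1/2) ^ (l + 2)" using eq by (simp add: bk_pos_def)
  then show ?thesis using st by (simp add: power_inject_exp')
qed

lemma corner_edge_arc:
  assumes "corner y" "m \<le> level e"
  obtains k where "k \<le> Suc (level e)" "T (SE e m) y = edge_arc e (knot e k)"
    "k = 0 \<longrightarrow> m = 0 \<and> y = src" "k = Suc (level e) \<longrightarrow> m = level e \<and> y = tgt"
proof (cases "y = src")
  case True
  then show ?thesis using assms T_src_tgt(5)[of e m] by (intro that[of m]) simp_all
next
  case False
  then have "y = tgt" using assms(1) corner_def by blast
  then show ?thesis using assms T_src_tgt(6)[of e m] False by (intro that[of "Suc m"]) simp_all
qed

lemma edge_arc_flat: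
  assumes "fst (snd (edge_arc e (knot e k))) = 1/8"
  shows "knot e k = 0 \<or> knot e k = 1"
  using assms extent_pos[of e] by (simp add: edge_arc_def arc_def height_def extent_def)

lemma knot_eq_ends: "knot e k = 0 \<longleftrightarrow> k = 0" "knot e k = 1 \<longleftrightarrow> k = Suc (level e)"
  by (simp_all add: knot_def pieces_def divide_eq_1_iff) linarith?

text \<open>Different slopes force height 0, so the corner is an end of the whole edge. The
  condition on \<open>far_end e\<close> excludes the edges \<open>Vv\<close>, whose far ends are not
  vertices of the spine.\<close>

lemma corner_on_spoke:
  assumes "corner y" "m \<le> level e" "T (SE e m) y \<in> spoke g"
  shows "(g = near_spoke e \<and> m = 0 \<and> y = src) \<or>
    (g = edge_spoke e \<and> m = level e \<and> y = tgt \<and> far_end e = spine_pos (edge_spoke e))"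
proof -
  obtain k where k: "k \<le> Suc (level e)" "T (SE e m) y = edge_arc e (knot e k)"
    "k = 0 \<longrightarrow> m = 0 \<and> y = src" "k = Suc (level e) \<longrightarrow> m = level e \<and> y = tgt"
    using corner_edge_arc[OF assms(1,2)] .
  obtain t where t: "fst (snd (T (SE e m) y)) = 1/8 + height \<bar>spine_pos g - 1/2\<bar> t"
    "snd (snd (T (SE e m) y)) = slope0 g * height \<bar>spine_pos g - 1/2\<bar> t"
    using assms(3) by (rule spoke_coords)
  define H where "H = height \<bar>far_end e - near_end e\<bar> (knot e k)"
  have "H = height \<bar>spine_pos g - 1/2\<bar> t" using t(1) unfolding k(2) by (simp add: edge_arc_def arc_def H_def)
  then have "slope e * H = slope0 g * H" using t(2) unfolding k(2) by (simp add: edge_arc_def arc_def H_def)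
  moreover have "slope e \<noteq> slope0 g" using slope_spoke_disjoint[of g e] width_pos[of e] by auto
  ultimately have "H = 0" by simp
  then have "fst (snd (edge_arc e (knot e k))) = 1/8" by (simp add: edge_arc_def arc_def H_def)
  from edge_arc_flat[OF this] show ?thesis
  proof
    assume "knot e k = 0"
    then have k0: "k = 0" by (simp add: knot_eq_ends)
    then have "spine (near_end e) \<in> spoke g" using assms(3) k(2) edge_arc_ends(1)[of e] \<open>knot e k = 0\<close> by simp
    then have "near_end e = spine_pos g" using near_end_bounds(3) by (intro spine_mem_spoke)
    then have "g = near_spoke e" using spine_pos_inj[of "near_spoke e" g] by (simp add: near_end_def)
    then show ?thesis using k(3) k0 by simp
  next
    assume "knot e k = 1"
    then have k1: "k = Suc (level e)" by (simp add: knot_eq_ends)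
    then have "spine (far_end e) \<in> spoke g" using assms(3) k(2) edge_arc_ends(2)[of e] \<open>knot e k = 1\<close> by simp
    then have far: "far_end e = spine_pos g" using far_end_bounds(3) by (intro spine_mem_spoke)
    then have "far_end e = spine_pos (edge_spoke e)"
      using bk_pos_not_spine_pos by (cases e) auto
    moreover from this have "g = edge_spoke e" using far spine_pos_inj[of g "edge_spoke e"] by simp
    ultimately show ?thesis using k(4) k1 by simp
  qed
qed

lemma spine_pos_in_spoke: "spine (spine_pos g) \<in> spoke g"
  unfolding spoke_def by (rule image_eqI[of _ _ 1]) (simp_all add: spoke_arc_ends)

text \<open>The other ends of \<open>SA\<close> and \<open>SB\<close> belong to no further cell. An
  inner knot belongs to one edge because different edges have different slopes, and each point
  \<open>b_k(s)\<close> is the end of a single edge.\<close>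

lemma corner_off_spokes:
  assumes "valid \<sigma>" "valid \<tau>" "\<sigma> \<noteq> \<tau>" "corner y" "corner z" "T \<sigma> y = T \<tau> z" "T \<sigma> y \<notin> spokes"
  shows "\<exists>e m m'. \<sigma> = SE e m \<and> \<tau> = SE e m'"
proof -
  have off: "\<exists>e m. \<sigma> = SE e m" if "valid \<sigma>" "valid \<tau>" "\<sigma> \<noteq> \<tau>" "corner y" "corner z" "T \<sigma> y = T \<tau> z" "T \<sigma> y \<notin> spokes"
    for \<sigma> \<tau> y z
  proof (cases \<sigma>)
    case SA
    have D: "z \<in> Delta" using corner_in_Delta that by blast
    have "y = src" using that(4,7) SA T_src_tgt(2) spine_pos_in_spoke unfolding corner_def by (metis UN_I UNIV_I)
    then have z0: "fst (T \<tau> z) = 0" using that(6)[symmetric] SA by (simp add: T_src_tgt src_def)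
    show ?thesis
    proof (cases \<tau>)
      case (SE e m)
      then have "3/8 \<le> fst (T \<tau> z)"
        using T_SE_range(1)[of m e "fst z" "fst (snd z)" "snd (snd z)"] D that(2) by simp
      then show ?thesis using z0 by simp
    next
      case SB
      then show ?thesis using z0 that(5) by (auto simp: corner_def T_src_tgt spine_def tgt_def spine_pos_extreme)
    qed (use that(3) SA in simp)
  next
    case SB
    have D: "z \<in> Delta" using corner_in_Delta that by blast
    have "y = tgt" using that(4,7) SB T_src_tgt(3) spine_pos_in_spoke unfolding corner_def by (metis UN_I UNIV_I)
    then have z1: "fst (T \<tau> z) = 1" using that(6)[symmetric] SB by (simp add: T_src_tgt tgt_def)
    show ?thesis
    proof (cases \<tau>)
      case (SE e m)
      then have "fst (T \<tau> z) \<le> 9/16"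
        using T_SE_range(2)[of m e "fst z" "fst (snd z)" "snd (snd z)"] D that(2) by simp
      then show ?thesis using z1 by simp
    next
      case SA
      then show ?thesis using z1 that(5) by (auto simp: corner_def T_src_tgt spine_def src_def spine_pos_extreme)
    qed (use that(3) SB in simp)
  qed blast
  obtain e m where \<sigma>: "\<sigma> = SE e m" using off[OF assms] by blast
  have "T \<tau> z \<notin> spokes" using assms(6,7) by simp
  then obtain e' m' where \<tau>: "\<tau> = SE e' m'" using off[OF assms(2,1) assms(3)[symmetric] assms(5,4) assms(6)[symmetric]] by blast
  have m: "m \<le> level e" "m' \<le> level e'" using assms(1,2) \<sigma> \<tau> by simp_all
  have "e = e'"
  proof (rule ccontr)
    assume ne: "e \<noteq> e'"
    obtain k where k: "T (SE e m) y = edge_arc e (knot e k)" using corner_edge_arc[OF assms(4) m(1)] by metis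
    obtain k' where k': "T (SE e' m') z = edge_arc e' (knot e' k')" using corner_edge_arc[OF assms(5) m(2)] by metis
    have eq: "edge_arc e (knot e k) = edge_arc e' (knot e' k')" using assms(6) \<sigma> \<tau> k k' by simp
    define H where "H = height \<bar>far_end e - near_end e\<bar> (knot e k)"
    have HH: "height \<bar>far_end e' - near_end e'\<bar> (knot e' k') = H"
      using eq by (simp add: edge_arc_def arc_def H_def)
    have "slope e * H = slope e' * height \<bar>far_end e' - near_end e'\<bar> (knot e' k')"
      using eq unfolding edge_arc_def arc_def H_def by blast
    then have "slope e * H = slope e' * H" unfolding HH .
    moreover have "slope e \<noteq> slope e'" using slopes_disjoint[OF ne] width_pos[of e] width_pos[of e'] by auto
    ultimately have "H = 0" by simp
    then have "knot e k = 0 \<or> knot e k = 1" "knot e' k' = 0 \<or> knot e' k' = 1"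
      using HH by (intro edge_arc_flat; simp add: edge_arc_def arc_def H_def)+
    then have P: "T \<sigma> y = spine (near_end e) \<or> T \<sigma> y = spine (far_end e)"
      "T \<sigma> y = spine (near_end e') \<or> T \<sigma> y = spine (far_end e')"
      using k k' \<sigma> \<tau> assms(6) edge_arc_ends by metis+
    have off': "\<exists>s k. e = Vv s k \<and> T \<sigma> y = spine (bk_pos s k)"
      if "T \<sigma> y = spine (near_end e) \<or> T \<sigma> y = spine (far_end e)" for e
    proof -
      have "T \<sigma> y \<noteq> spine (spine_pos g)" for g using assms(7) spine_pos_in_spoke by (metis UN_I UNIV_I)
      then show ?thesis using that unfolding near_end_def by (cases e) auto
    qed
    obtain s l where s: "e = Vv s l" "T \<sigma> y = spine (bk_pos s l)" using off'[OF P(1)] by blast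
    obtain s' l' where s': "e' = Vv s' l'" "T \<sigma> y = spine (bk_pos s' l')" using off'[OF P(2)] by blast
    have "bk_pos s l = bk_pos s' l'" using s(2) s'(2) by (simp add: spine_def)
    then show False using bk_pos_inj s(1) s'(1) ne by blast
  qed
  then show ?thesis using \<sigma> \<tau> by blast
qed

section \<open>A winning strategy cuts the cells\<close>

text \<open>The two properties of the removed set that survive pulling it back along a word.\<close>

definition good_removed :: "pt set \<Rightarrow> bool" where
  "good_removed R \<longleftrightarrow> hub \<in> R \<and> vertices \<inter> R = {}"

definition cut :: "(position \<Rightarrow> bool) \<Rightarrow> position \<Rightarrow> pt set \<Rightarrow> bool" where
  "cut c p R \<longleftrightarrow> (\<exists>\<phi>. locally_constant_on (game_continuum c p - R) \<phi> \<and> \<not> \<phi> src \<and> \<phi> tgt)"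

lemma corner_vertex: "corner y \<Longrightarrow> y \<in> vertices"
  unfolding vertices_def by (intro CollectI exI[of _ "[]"] exI[of _ y]) simp

inductive consistent :: "(position \<Rightarrow> nat) \<Rightarrow> position \<Rightarrow> bool" for f where
  consistent_Nil: "consistent f []"
| consistent_Cons: "consistent f p \<Longrightarrow> i = f p \<Longrightarrow> consistent f ((i, j) # p)"

text \<open>The strategy \<open>f\<close> separates the vertices into the ones on the side of \<open>src\<close> and the ones on the side
  of \<open>tgt\<close>. The side of a position which is not consistent with \<open>f\<close> is decided at the first deviation.\<close>

primrec side :: "(position \<Rightarrow> nat) \<Rightarrow> position \<Rightarrow> position \<Rightarrow> bool option" where
  "side f p [] = None"
| "side f p (x # s) = (case side f p s of None \<Rightarrow>
      (if fst x < f (s @ p) then Some False else if f (s @ p) < fst x then Some True else None) | Some b \<Rightarrow> Some b)"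

definition usid :: "(position \<Rightarrow> nat) \<Rightarrow> position \<Rightarrow> position \<Rightarrow> nat \<Rightarrow> bool" where
  "usid f p s k = (case side f p s of None \<Rightarrow> f (s @ p) < k | Some b \<Rightarrow> b)"

definition bsid :: "(position \<Rightarrow> nat) \<Rightarrow> position \<Rightarrow> position \<Rightarrow> bool" where
  "bsid f p s = (case side f p s of None \<Rightarrow> True | Some b \<Rightarrow> b)"

text \<open>Together with \<open>bsid_child\<close>: the edges \<open>St i j s\<close> and
  \<open>En i j s\<close> join vertices on the same side.\<close>

lemma usid_child: "usid f p ((i, j) # s) 0 = usid f p s i"
  by (cases "side f p s") (simp_all add: usid_def)

lemma bsid_child: "bsid f p ((i, j) # s) = usid f p s (Suc i)"
  by (cases "side f p s") (simp_all add: usid_def bsid_def)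

lemma side_None_consistent: "side f p s = None \<Longrightarrow> consistent f p \<Longrightarrow> consistent f (s @ p)"
proof (induction s)
  case (Cons x s)
  obtain i j where x: "x = (i, j)" by fastforce
  have "side f p s = None" using Cons.prems(1) by (cases "side f p s") auto
  moreover from this have "i = f (s @ p)" using Cons.prems(1) x by (auto split: if_splits)
  ultimately show ?case using Cons x consistent_Cons by simp
qed simp

definition spoke_side :: "(position \<Rightarrow> nat) \<Rightarrow> position \<Rightarrow> pt \<Rightarrow> bool" where
  "spoke_side f p x \<longleftrightarrow> (\<exists>s k. x \<in> spoke (uspoke s k) - {hub} \<and> usid f p s k) \<or>
    (\<exists>s. x \<in> spoke (bspoke s) - {hub} \<and> bsid f p s)"

lemma spoke_side_u: "x \<in> spoke (uspoke s k) \<Longrightarrow> x \<noteq> hub \<Longrightarrow> spoke_side f p x = usid f p s k"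
  unfolding spoke_side_def using spokes_meet_at_hub uspoke_eq uspoke_neq_bspoke by (metis Diff_iff singletonD)

lemma spoke_side_b: "x \<in> spoke (bspoke s) \<Longrightarrow> x \<noteq> hub \<Longrightarrow> spoke_side f p x = bsid f p s"
  unfolding spoke_side_def using spokes_meet_at_hub bspoke_eq uspoke_neq_bspoke by (metis Diff_iff singletonD)

lemma spine_not_hub: "spine (spine_pos g) \<noteq> hub"
  using spine_pos_neq[of g] by (simp add: spine_def hub_def)

lemma near_spoke_arc_const:
  assumes "x \<in> spoke g" "x \<noteq> hub"
  shows "\<exists>\<delta>>0. \<forall>y\<in>spokes. dist x y < \<delta> \<longrightarrow> y \<in> spoke g \<and> y \<noteq> hub"
proof -
  have "x \<notin> (\<Union>h\<in>{h. h \<noteq> g}. spoke h)" using assms spokes_meet_at_hub by blast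
  then have "x \<in> - (\<Union>h\<in>{h. h \<noteq> g}. spoke h)" by blast
  moreover have "open (- (\<Union>h\<in>{h. h \<noteq> g}. spoke h))" using closed_spokes by (rule open_Compl)
  ultimately obtain \<delta> where \<delta>: "0 < \<delta>" "ball x \<delta> \<subseteq> - (\<Union>h\<in>{h. h \<noteq> g}. spoke h)" using openE by metis
  have "y \<in> spoke g \<and> y \<noteq> hub" if y: "y \<in> spokes" "dist x y < \<delta>" for y
  proof -
    have "y \<in> ball x \<delta>" using y(2) by simp
    then have "y \<notin> spoke h" if "h \<noteq> g" for h using \<delta>(2) that by blast
    moreover obtain h where "y \<in> spoke h" using y(1) by blast
    moreover have "Suc g \<noteq> g" by simp
    ultimately show ?thesis using hub_in_spoke by metis
  qed
  then show ?thesis using \<delta>(1) by blast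
qed

text \<open>The sides prescribed by \<open>f\<close> are constant on each spoke without the hub and
  compatible with all edges except the edges \<open>Co s\<close> with undecided \<open>s\<close>,
  whose ends lie on different sides. Undecided positions are consistent with \<open>f\<close>, so if
  the copy along such an edge is present, it is cut by hypothesis.\<close>

lemma cut_step:
  assumes R: "good_removed R" and p: "consistent f p"
    and IH: "\<And>s. s \<noteq> [] \<Longrightarrow> consistent f (s @ p) \<Longrightarrow> c (s @ p) \<Longrightarrow> cut c (s @ p) (T (SE (Co s) 0) -` R)"
  shows "cut c p R"
proof -
  define F where "F \<sigma> = game_continuum c (label p \<sigma>) - T \<sigma> -` R" for \<sigma>
  have "\<exists>\<phi>. side f p s = None \<longrightarrow> s \<noteq> [] \<longrightarrow> c (s @ p) \<longrightarrow>
      locally_constant_on (F (SE (Co s) 0)) \<phi> \<and> \<not> \<phi> src \<and> \<phi> tgt" for s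
    using IH[of s] side_None_consistent[OF _ p, of s] unfolding cut_def F_def by auto
  then obtain \<theta> where \<theta>: "\<And>s. side f p s = None \<Longrightarrow> s \<noteq> [] \<Longrightarrow> c (s @ p) \<Longrightarrow>
      locally_constant_on (F (SE (Co s) 0)) (\<theta> s) \<and> \<not> \<theta> s src \<and> \<theta> s tgt" by metis
  define eside where "eside e = (case e of St i j s \<Rightarrow> usid f p s i | En i j s \<Rightarrow> usid f p s (Suc i)
      | Co s \<Rightarrow> usid f p s 0 | Vv s k \<Rightarrow> usid f p s k)" for e
  \<comment> \<open>Only the undecided copies along \<open>Co s\<close> need a partition of their
    own; every other cell gets a constant.\<close>
  define \<phi> where "\<phi> \<sigma> y = (case \<sigma> of SA \<Rightarrow> False | SB \<Rightarrow> True
      | SE e m \<Rightarrow> (case e of Co s \<Rightarrow> (if side f p s = None then \<theta> s y else eside e) | _ \<Rightarrow> eside e))" for \<sigma> y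
  define K where "K = spoke_side f p"
  have K_near: "K (spine (near_end e)) = eside e" for e
  proof (cases e)
    case (En i j s)
    then show ?thesis unfolding K_def eside_def near_end_def
      by (simp add: spoke_side_b[OF spine_pos_in_spoke spine_not_hub] bsid_child)
  qed (simp_all add: K_def eside_def near_end_def spoke_side_u[OF spine_pos_in_spoke spine_not_hub] usid_child)
  have hubR: "hub \<in> R" using R unfolding good_removed_def by blast
  have notR: "T \<sigma> y \<notin> R" if "valid \<sigma>" "corner y" for \<sigma> y
  proof -
    have "T \<sigma> y \<in> vertices" unfolding vertices_def
      using that by (intro CollectI exI[of _ "[\<sigma>]"] exI[of _ y]) simp
    then show ?thesis using R unfolding good_removed_def by blast
  qed
  have Kcorner: "\<phi> \<sigma> y = K (T \<sigma> y)" if \<sigma>: "active c p \<sigma>" and y: "corner y" and sp: "T \<sigma> y \<in> spokes" for \<sigma> y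
  proof (cases \<sigma>)
    case SA
    have "y = tgt"
    proof (rule ccontr)
      assume "y \<noteq> tgt"
      then have "T \<sigma> y = src" using y SA by (auto simp: corner_def T_src_tgt)
      then show False using sp spoke_fst_bounds(1) by (fastforce simp: src_def)
    qed
    then have "T \<sigma> y = spine (spine_pos (uspoke [] 0))" using SA by (simp add: T_src_tgt)
    then show ?thesis using spoke_side_u[OF spine_pos_in_spoke spine_not_hub, of f p "[]" 0] SA
      by (simp add: K_def \<phi>_def usid_def)
  next
    case SB
    have "y = src"
    proof (rule ccontr)
      assume "y \<noteq> src"
      then have "T \<sigma> y = tgt" using y SB by (auto simp: corner_def T_src_tgt)
      then show False using sp spoke_fst_bounds(2) by (fastforce simp: tgt_def)
    qed
    then have "T \<sigma> y = spine (spine_pos (bspoke []))" using SB by (simp add: T_src_tgt)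
    then show ?thesis using spoke_side_b[OF spine_pos_in_spoke spine_not_hub, of f p "[]"] SB
      by (simp add: K_def \<phi>_def bsid_def)
  next
    case (SE e m)
    have m: "m \<le> level e" using active_valid[OF \<sigma>] SE by simp
    obtain g where g: "T (SE e m) y \<in> spoke g" using sp SE by blast
    from corner_on_spoke[OF y m g] show ?thesis
    proof (elim disjE conjE)
      assume *: "g = near_spoke e" "m = 0" "y = src"
      have "T \<sigma> y = spine (near_end e)" using * SE edge_arc_ends(1)[of e] by (simp add: T_src_tgt knot_ends)
      then have "K (T \<sigma> y) = eside e" using K_near by simp
      moreover have "\<phi> \<sigma> y = eside e"
      proof (cases "\<exists>s. e = Co s \<and> side f p s = None")
        case True
        then obtain s where s: "e = Co s" "side f p s = None" by blast
        then have "s \<noteq> []" "c (s @ p)" using \<sigma> SE by auto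
        then show ?thesis using \<theta>[OF s(2)] s * SE by (simp add: \<phi>_def eside_def usid_def)
      next
        case False
        then show ?thesis by (auto simp: \<phi>_def SE split: edge.splits)
      qed
      ultimately show ?thesis by simp
    next
      assume *: "g = edge_spoke e" "m = level e" "y = tgt" "far_end e = spine_pos (edge_spoke e)"
      have TT: "T \<sigma> y = spine (spine_pos (edge_spoke e))"
        using * SE edge_arc_ends(2)[of e] by (simp add: T_src_tgt knot_ends)
      show ?thesis
      proof (cases e)
        case (Co s)
        have s: "s \<noteq> []" "c (s @ p)" using \<sigma> SE Co by auto
        have "K (T \<sigma> y) = bsid f p s" unfolding TT K_def Co edge_spoke.simps
          by (rule spoke_side_b[OF spine_pos_in_spoke spine_not_hub])
        moreover have "\<phi> \<sigma> y = bsid f p s"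
        proof (cases "side f p s")
          case None
          then show ?thesis using \<theta>[of s] s *(3) by (simp add: \<phi>_def bsid_def SE Co)
        next
          case (Some b)
          then show ?thesis by (simp add: \<phi>_def bsid_def eside_def usid_def SE Co)
        qed
        ultimately show ?thesis by simp
      next
        case (Vv s k)
        then show ?thesis using *(4) bk_pos_not_spine_pos by simp
      next
        case (St i j s)
        have "K (T \<sigma> y) = usid f p s i" unfolding TT K_def St edge_spoke.simps
          by (rule spoke_side_u[OF spine_pos_in_spoke spine_not_hub])
        then show ?thesis by (simp add: SE St \<phi>_def eside_def)
      next
        case (En i j s)
        have "K (T \<sigma> y) = usid f p s (Suc i)" unfolding TT K_def En edge_spoke.simps
          by (rule spoke_side_u[OF spine_pos_in_spoke spine_not_hub])
        then show ?thesis by (simp add: SE En \<phi>_def eside_def)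
      qed
    qed
  qed
  have "\<exists>\<psi>. locally_constant_on (game_continuum c p - R) \<psi> \<and> (\<forall>x\<in>spokes - R. \<psi> x = K x) \<and>
    (\<forall>\<sigma>. active c p \<sigma> \<longrightarrow> (\<forall>y\<in>game_continuum c (label p \<sigma>) - T \<sigma> -` R. \<psi> (T \<sigma> y) = \<phi> \<sigma> y))"
  proof (rule glue_cells)
    fix \<sigma> assume \<sigma>: "active c p \<sigma>"
    show "locally_constant_on (game_continuum c (label p \<sigma>) - T \<sigma> -` R) (\<phi> \<sigma>)"
    proof (cases "\<exists>s m. \<sigma> = SE (Co s) m \<and> side f p s = None")
      case True
      then obtain s m where s: "\<sigma> = SE (Co s) m" "side f p s = None" by blast
      then have "m = 0" "s \<noteq> []" "c (s @ p)" using \<sigma> by auto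
      moreover have "\<phi> \<sigma> = \<theta> s" using s by (intro ext) (simp add: \<phi>_def)
      ultimately show ?thesis using \<theta>[of s] s unfolding F_def by simp
    next
      case False
      then have "\<phi> \<sigma> = (\<lambda>_. \<phi> \<sigma> src)" by (intro ext) (auto simp: \<phi>_def split: sym.splits edge.splits)
      then show ?thesis using locally_constant_on_const by metis
    qed
  next
    show "locally_constant_on (spokes - R) K"
      unfolding locally_constant_on_def
    proof
      fix x assume x: "x \<in> spokes - R"
      then obtain g where g: "x \<in> spoke g" by blast
      have xh: "x \<noteq> hub" using x hubR by blast
      obtain \<delta> where \<delta>: "0 < \<delta>" "\<forall>y\<in>spokes. dist x y < \<delta> \<longrightarrow> y \<in> spoke g \<and> y \<noteq> hub"
        using near_spoke_arc_const[OF g xh] by blast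
      have "K y = K x" if "y \<in> spoke g" "y \<noteq> hub" for y
      proof (cases g rule: spoke_cases)
        case (1 s k)
        then show ?thesis using spoke_side_u g xh that unfolding K_def by metis
      next
        case (2 s)
        then show ?thesis using spoke_side_b g xh that unfolding K_def by metis
      qed
      then show "\<exists>\<delta>>0. \<forall>y\<in>spokes - R. dist x y < \<delta> \<longrightarrow> K y = K x" using \<delta> by blast
    qed
  next
    show "\<phi> \<sigma> y = K (T \<sigma> y)" if "active c p \<sigma>" "corner y" "T \<sigma> y \<in> spokes" for \<sigma> y
      using Kcorner that .
  next
    fix \<sigma> \<tau> y z assume *: "active c p \<sigma>" "active c p \<tau>" "\<sigma> \<noteq> \<tau>" "corner y" "corner z" "T \<sigma> y = T \<tau> z"
      "T \<sigma> y \<notin> spokes"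
    then obtain e m m' where e: "\<sigma> = SE e m" "\<tau> = SE e m'"
      using corner_off_spokes[OF active_valid[OF *(1)] active_valid[OF *(2)] *(3-7)] by blast
    \<comment> \<open>\<open>Co s\<close> has level 0 and thus a single chord, so two different
      cells of \<open>e\<close> cannot lie on it.\<close>
    have "\<not> (\<exists>s. e = Co s)" using * e by auto
    then show "\<phi> \<sigma> y = \<phi> \<tau> z" by (auto simp: \<phi>_def e split: edge.splits)
  next
    fix x assume x: "x \<in> spokes - R"
    then obtain g where g: "x \<in> spoke g" by blast
    have xh: "x \<noteq> hub" using x hubR by blast
    have "x \<notin> (\<Union>h\<in>{h. h \<noteq> g}. spoke h)" using g xh spokes_meet_at_hub by blast
    then obtain \<delta> where \<delta>: "0 < \<delta>" "finite {\<sigma>. valid \<sigma> \<and> (\<exists>y\<in>Delta. dist x (T \<sigma> y) < \<delta>) \<and>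
        \<not> (\<exists>e m. \<sigma> = SE e m \<and> edge_spoke e \<notin> {h. h \<noteq> g})}" (is "finite ?A")
      by (rule cells_locally_finite)
    define Ex where "Ex = (\<Union>s\<in>{s. bspoke s = g}. \<Union>e\<in>insert (Co s) (Vv s ` {..f (s @ p)}). SE e ` {..level e})"
    have "finite {s. bspoke s = g}"
    proof (cases "\<exists>s. bspoke s = g")
      case True
      then obtain s where "bspoke s = g" by blast
      then have "{s. bspoke s = g} \<subseteq> {s}" by auto
      then show ?thesis by (rule finite_subset) simp
    next
      case False
      then show ?thesis by simp
    qed
    then have "finite Ex" unfolding Ex_def by (intro finite_UN_I) auto
    moreover have "{\<sigma>. active c p \<sigma> \<and> (\<exists>y\<in>game_continuum c (label p \<sigma>) - T \<sigma> -` R. dist x (T \<sigma> y) < \<delta> \<and> \<phi> \<sigma> y \<noteq> K x)} \<subseteq> ?A \<union> Ex"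
    proof
      fix \<sigma> assume "\<sigma> \<in> {\<sigma>. active c p \<sigma> \<and> (\<exists>y\<in>game_continuum c (label p \<sigma>) - T \<sigma> -` R. dist x (T \<sigma> y) < \<delta> \<and> \<phi> \<sigma> y \<noteq> K x)}"
      then obtain y where \<sigma>: "active c p \<sigma>" "y \<in> game_continuum c (label p \<sigma>)" "dist x (T \<sigma> y) < \<delta>" "\<phi> \<sigma> y \<noteq> K x" by blast
      have yD: "y \<in> Delta" using \<sigma>(2) game_continuum_subset by blast
      show "\<sigma> \<in> ?A \<union> Ex"
      proof (rule ccontr)
        assume no: "\<sigma> \<notin> ?A \<union> Ex"
        then obtain e m where e: "\<sigma> = SE e m" "edge_spoke e = g" using \<sigma> yD active_valid by blast
        have m: "m \<le> level e" using active_valid[OF \<sigma>(1)] e by simp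
        show False
        proof (cases e)
          case (St i j s)
          then show False using \<sigma>(4) e spoke_side_u[of x s i f p] g xh by (simp add: \<phi>_def eside_def K_def)
        next
          case (En i j s)
          then show False using \<sigma>(4) e spoke_side_u[of x s "Suc i" f p] g xh by (simp add: \<phi>_def eside_def K_def)
        next
          case (Co s)
          then have "\<sigma> \<in> Ex" using e m unfolding Ex_def by auto
          then show False using no by blast
        next
          case (Vv s k)
          have "f (s @ p) < k"
          proof (rule ccontr)
            assume "\<not> f (s @ p) < k"
            then have "e \<in> insert (Co s) (Vv s ` {..f (s @ p)})" "s \<in> {s. bspoke s = g}" "\<sigma> \<in> SE e ` {..level e}"
              using e m Vv by auto
            then have "\<sigma> \<in> Ex" unfolding Ex_def by blast
            then show False using no by blast
          qed
          then have eq: "usid f p s k = bsid f p s" by (cases "side f p s") (simp_all add: usid_def bsid_def)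
          have "\<phi> \<sigma> y = usid f p s k" by (simp add: \<phi>_def eside_def e Vv)
          moreover have "K x = bsid f p s" unfolding K_def using e Vv g xh by (intro spoke_side_b) simp_all
          ultimately show False using \<sigma>(4) eq by simp
        qed
      qed
    qed
    ultimately show "\<exists>\<delta>>0. finite {\<sigma>. active c p \<sigma> \<and>
        (\<exists>y\<in>game_continuum c (label p \<sigma>) - T \<sigma> -` R. dist x (T \<sigma> y) < \<delta> \<and> \<phi> \<sigma> y \<noteq> K x)}"
      using \<delta> by (meson finite_Un finite_subset)
  qed
  then obtain \<psi> where \<psi>: "locally_constant_on (game_continuum c p - R) \<psi>" "\<forall>x\<in>spokes - R. \<psi> x = K x"
    "\<forall>\<sigma>. active c p \<sigma> \<longrightarrow> (\<forall>y\<in>game_continuum c (label p \<sigma>) - T \<sigma> -` R. \<psi> (T \<sigma> y) = \<phi> \<sigma> y)"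
    by (elim exE conjE)
  have "\<psi> (T SA src) = \<phi> SA src"
    using notR[of SA src] ends_in_game_continuum by (intro \<psi>(3)[rule_format]) (simp_all add: corner_def)
  moreover have "\<psi> (T SB tgt) = \<phi> SB tgt"
    using notR[of SB tgt] ends_in_game_continuum by (intro \<psi>(3)[rule_format]) (simp_all add: corner_def)
  ultimately have "\<not> \<psi> src \<and> \<psi> tgt" by (simp add: T_src_tgt \<phi>_def)
  then show ?thesis unfolding cut_def using \<psi>(1) by blast
qed

lemma consistent_moves:
  "consistent f p \<Longrightarrow> k < length p \<Longrightarrow> fst (rev p ! k) = f (rev (take k (rev p)))"
proof (induction p rule: consistent.induct)
  case (consistent_Cons p i j)
  show ?case
  proof (cases "k < length p")
    case True
    then show ?thesis using consistent_Cons by (simp add: nth_append)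
  next
    case False
    then have "k = length p" using consistent_Cons.prems by simp
    then show ?thesis using consistent_Cons by (simp add: nth_append)
  qed
qed simp

text \<open>The positions are initial parts of one play that follows \<open>f\<close>. The play is
  read off from the reversed lists and passes through infinitely many coloured positions.\<close>

lemma infinitely_many_colours_lose:
  assumes cons: "\<And>n. consistent f (ps n)"
    and ext: "\<And>n. \<exists>s. s \<noteq> [] \<and> ps (Suc n) = s @ ps n" and col: "\<And>n. c (ps (Suc n))"
  shows "\<not> colour_win c f"
proof
  assume win: "colour_win c f"
  have len_Suc: "length (ps n) < length (ps (Suc n))" for n using ext[of n] by auto
  have len: "n \<le> length (ps n)" for n
  proof (induction n)
    case (Suc n)
    then show ?case using len_Suc[of n] by simp
  qed simp
  have pre: "take (length (ps n)) (rev (ps (n + d))) = rev (ps n)" for n d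
  proof (induction d)
    case (Suc d)
    obtain s where s: "ps (Suc (n + d)) = s @ ps (n + d)" using ext by blast
    have "length (ps n) \<le> length (ps (n + d))"
      using lift_Suc_mono_le[of "\<lambda>n. length (ps n)" n "n + d"] len_Suc by (simp add: less_imp_le)
    then show ?case using Suc s by simp
  qed simp
  define x where "x m = rev (ps (Suc m)) ! m" for m
  define \<gamma> where "\<gamma> i = (if even i then fst (x (i div 2)) else snd (x (i div 2)))" for i
  have x: "x m = rev (ps n) ! m" if "m < length (ps n)" for m n
  proof (cases "Suc m \<le> n")
    case True
    then obtain d where "n = Suc m + d" by (metis le_Suc_ex)
    then have "take (length (ps (Suc m))) (rev (ps n)) = rev (ps (Suc m))" using pre by metis
    moreover have "m < length (ps (Suc m))" using len[of "Suc m"] by simp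
    ultimately show ?thesis unfolding x_def by (metis nth_take)
  next
    case False
    then obtain d where "Suc m = n + d" by (metis le_Suc_ex nat_le_linear)
    then have "take (length (ps n)) (rev (ps (Suc m))) = rev (ps n)" using pre by metis
    then show ?thesis unfolding x_def using that by (metis nth_take)
  qed
  have rl: "round_list \<gamma> m = rev (take m (rev (ps n)))" if "m \<le> length (ps n)" for m n
    using that
  proof (induction m)
    case (Suc m)
    have "(\<gamma> (2 * m), \<gamma> (Suc (2 * m))) = rev (ps n) ! m" using Suc.prems x[of m n] by (simp add: \<gamma>_def)
    then show ?case using Suc by (simp add: take_Suc_conv_app_nth)
  qed simp
  have "\<gamma> (2 * k) = f (round_list \<gamma> k)" for k
  proof -
    have k: "k < length (ps (Suc k))" using len[of "Suc k"] by simp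
    have "\<gamma> (2 * k) = fst (rev (ps (Suc k)) ! k)" using x[OF k] by (simp add: \<gamma>_def)
    also have "\<dots> = f (rev (take k (rev (ps (Suc k)))))" by (rule consistent_moves[OF cons k])
    finally show ?thesis using rl[of k "Suc k"] k by simp
  qed
  then obtain n0 where n0: "\<And>n. n \<ge> n0 \<Longrightarrow> \<not> c (round_list \<gamma> (Suc n))"
    using win unfolding colour_win_def by blast
  obtain m where m: "length (ps (Suc n0)) = Suc m" using len_Suc[of n0] by (cases "length (ps (Suc n0))") auto
  have "round_list \<gamma> (Suc m) = ps (Suc n0)" using rl[of "Suc m" "Suc n0"] m by simp
  then have "\<not> c (ps (Suc n0))" using n0[of m] len[of "Suc n0"] m by simp
  then show False using col by blast
qed

lemma word_map_vertices: "list_all valid w \<Longrightarrow> y \<in> vertices \<Longrightarrow> word_map w y \<in> vertices"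
proof -
  assume w: "list_all valid w" and "y \<in> vertices"
  then obtain v z where "list_all valid v" "corner z" "y = word_map v z" unfolding vertices_def by blast
  then show ?thesis using w unfolding vertices_def
    by (intro CollectI exI[of _ "w @ v"] exI[of _ z]) (simp add: word_map_append)
qed

lemma good_removed_word:
  assumes "good_levels S" "list_all valid w"
  shows "good_removed (word_map w -` removed S)"
proof -
  have "word_map w hub \<in> removed S" using assms(2) unfolding removed_def by blast
  moreover have "word_map w y \<notin> removed S" if "y \<in> vertices" for y
    using deep_not_removed[OF assms(1) vertices_deep[OF word_map_vertices[OF assms(2) that]]] .
  ultimately show ?thesis unfolding good_removed_def by (simp add: disjoint_iff) blast?
qed

lemma vimage_word_map_snoc: "T \<sigma> -` (word_map w -` R) = word_map (w @ [\<sigma>]) -` R"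
  by (simp add: word_map_append vimage_def)

text \<open>By \<open>cut_step\<close> an uncut copy contains an uncut copy at a longer coloured
  position consistent with \<open>f\<close>. Iterating this produces a play that follows
  \<open>f\<close> and is lost.\<close>

lemma winning_imp_cut:
  assumes S: "good_levels S" and win: "colour_win c f" and w: "list_all valid w"
  shows "cut c [] (word_map w -` removed S)"
proof (rule ccontr)
  assume not_cut: "\<not> cut c [] (word_map w -` removed S)"
  define P where "P n pw \<longleftrightarrow> consistent f (fst pw) \<and> list_all valid (snd pw) \<and>
      \<not> cut c (fst pw) (word_map (snd pw) -` removed S)" for n :: nat and pw
  define Q where "Q n pw pw' \<longleftrightarrow> (\<exists>s. s \<noteq> [] \<and> fst pw' = s @ fst pw) \<and> c (fst pw')"
    for n :: nat and pw pw' :: "position \<times> sym list"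
  have "\<exists>g. \<forall>n. P n (g n) \<and> Q n (g n) (g (Suc n))"
  proof (rule dependent_nat_choice)
    show "\<exists>x. P 0 x" unfolding P_def using not_cut w by (intro exI[of _ "([], w)"]) (simp add: consistent_Nil)
    fix pw n assume "P n pw"
    then have pw: "consistent f (fst pw)" "list_all valid (snd pw)" "\<not> cut c (fst pw) (word_map (snd pw) -` removed S)"
      unfolding P_def by simp_all
    have "\<exists>s. s \<noteq> [] \<and> consistent f (s @ fst pw) \<and> c (s @ fst pw) \<and>
        \<not> cut c (s @ fst pw) (T (SE (Co s) 0) -` (word_map (snd pw) -` removed S))"
    proof (rule ccontr)
      assume "\<not> ?thesis"
      then have "cut c (fst pw) (word_map (snd pw) -` removed S)"
        using cut_step[OF good_removed_word[OF S pw(2)] pw(1), of c] by blast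
      then show False using pw(3) by blast
    qed
    then obtain s where s: "s \<noteq> []" "consistent f (s @ fst pw)" "c (s @ fst pw)"
      "\<not> cut c (s @ fst pw) (word_map (snd pw @ [SE (Co s) 0]) -` removed S)"
      unfolding vimage_word_map_snoc by blast
    show "\<exists>y. P (Suc n) y \<and> Q n pw y"
      using s pw(2) by (intro exI[of _ "(s @ fst pw, snd pw @ [SE (Co s) 0])"]) (auto simp: P_def Q_def)
  qed
  then obtain g where g: "\<And>n. P n (g n)" "\<And>n. Q n (g n) (g (Suc n))" by blast
  have "\<not> colour_win c f"
    by (rule infinitely_many_colours_lose[of f "\<lambda>n. fst (g n)"]) (use g in \<open>auto simp: P_def Q_def\<close>)
  then show False using win by blast
qed

lemma winning_imp_all_cut:
  assumes S: "good_levels S" and win: "colour_win c f" and w: "list_all valid w"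
  shows "cut c p (word_map w -` removed S)"
proof -
  define R where "R = word_map w -` removed S"
  have R: "good_removed R" unfolding R_def by (rule good_removed_word[OF S w])
  have "cut c [] (T SA -` R)" "cut c [] (T SB -` R)"
    unfolding R_def vimage_word_map_snoc using w by (intro winning_imp_cut[OF S win]; simp)+
  text \<open>Every cell starts with a cell labelled by the empty position, so it suffices to cut there.\<close>
  then obtain \<theta> where \<theta>: "locally_constant_on (game_continuum c [] - T SA -` R) \<theta>" "\<not> \<theta> src" "\<theta> tgt"
    unfolding cut_def by blast
  define \<phi> where "\<phi> \<sigma> y = (if \<sigma> = SA then \<theta> y else True)" for \<sigma> y
  have "\<exists>\<psi>. locally_constant_on (game_continuum c p - R) \<psi> \<and> (\<forall>x\<in>spokes - R. \<psi> x = True) \<and>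
    (\<forall>\<sigma>. active c p \<sigma> \<longrightarrow> (\<forall>y\<in>game_continuum c (label p \<sigma>) - T \<sigma> -` R. \<psi> (T \<sigma> y) = \<phi> \<sigma> y))"
  proof (rule glue_cells)
    fix \<sigma> assume \<sigma>: "active c p \<sigma>"
    have "\<phi> SA = \<theta>" "\<sigma> \<noteq> SA \<Longrightarrow> \<phi> \<sigma> = (\<lambda>_. True)" by (auto simp: \<phi>_def)
    then show "locally_constant_on (game_continuum c (label p \<sigma>) - T \<sigma> -` R) (\<phi> \<sigma>)"
      using \<theta>(1) locally_constant_on_const by (cases "\<sigma> = SA") auto
  next
    show "locally_constant_on (spokes - R) (\<lambda>_. True)" by (rule locally_constant_on_const)
  next
    fix \<sigma> y assume "active c p \<sigma>" "corner y" "T \<sigma> y \<in> spokes"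
    moreover have "y \<noteq> src" if "\<sigma> = SA" "T \<sigma> y \<in> spokes"
      using that spoke_fst_bounds(1) by (fastforce simp: T_src_tgt src_def)
    ultimately show "\<phi> \<sigma> y = True" using \<theta>(3) by (auto simp: \<phi>_def corner_def)
  next
    fix \<sigma> \<tau> y z assume *: "active c p \<sigma>" "active c p \<tau>" "\<sigma> \<noteq> \<tau>" "corner y" "corner z" "T \<sigma> y = T \<tau> z"
      "T \<sigma> y \<notin> spokes"
    then obtain e m m' where "\<sigma> = SE e m" "\<tau> = SE e m'"
      using corner_off_spokes[OF active_valid[OF *(1)] active_valid[OF *(2)] *(3-7)] by blast
    then show "\<phi> \<sigma> y = \<phi> \<tau> z" by (simp add: \<phi>_def)
  next
    fix x assume "x \<in> spokes - R"
    have "{\<sigma>. active c p \<sigma> \<and> (\<exists>y\<in>game_continuum c (label p \<sigma>) - T \<sigma> -` R. dist x (T \<sigma> y) < 1 \<and> \<phi> \<sigma> y \<noteq> True)} \<subseteq> {SA}"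
    proof (rule subsetI, rule ccontr)
      fix \<sigma> assume *: "\<sigma> \<in> {\<sigma>. active c p \<sigma> \<and> (\<exists>y\<in>game_continuum c (label p \<sigma>) - T \<sigma> -` R. dist x (T \<sigma> y) < 1 \<and> \<phi> \<sigma> y \<noteq> True)}" "\<sigma> \<notin> {SA}"
      then have "\<phi> \<sigma> y = True" for y unfolding \<phi>_def by simp
      then show False using *(1) by blast
    qed
    then have "finite {\<sigma>. active c p \<sigma> \<and> (\<exists>y\<in>game_continuum c (label p \<sigma>) - T \<sigma> -` R. dist x (T \<sigma> y) < 1 \<and> \<phi> \<sigma> y \<noteq> True)}"
      by (rule finite_subset) simp
    then show "\<exists>\<delta>>0. finite {\<sigma>. active c p \<sigma> \<and>
        (\<exists>y\<in>game_continuum c (label p \<sigma>) - T \<sigma> -` R. dist x (T \<sigma> y) < \<delta> \<and> \<phi> \<sigma> y \<noteq> True)}"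
      using zero_less_one by blast
  qed
  then obtain \<psi> where \<psi>: "locally_constant_on (game_continuum c p - R) \<psi>" "\<forall>x\<in>spokes - R. \<psi> x = True"
    "\<forall>\<sigma>. active c p \<sigma> \<longrightarrow> (\<forall>y\<in>game_continuum c (label p \<sigma>) - T \<sigma> -` R. \<psi> (T \<sigma> y) = \<phi> \<sigma> y)"
    by (elim exE conjE)
  have "src \<notin> R" "tgt \<notin> R" using R corner_vertex unfolding good_removed_def corner_def by blast+
  then have "\<psi> (T SA src) = \<phi> SA src" "\<psi> (T SB tgt) = \<phi> SB tgt"
    using ends_in_game_continuum by (intro \<psi>(3)[rule_format]; simp add: T_src_tgt)+
  then have "\<not> \<psi> src \<and> \<psi> tgt" using \<theta>(2) by (simp add: T_src_tgt \<phi>_def)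
  then show ?thesis unfolding cut_def R_def[symmetric] using \<psi>(1) by blast
qed

section \<open>Clopen partitions along hyperplanes\<close>

lemma locally_constant_on_Not: "locally_constant_on A \<phi> \<Longrightarrow> locally_constant_on A (\<lambda>x. \<not> \<phi> x)"
  unfolding locally_constant_on_def by meson

lemma locally_constant_on_conj:
  assumes "locally_constant_on A \<phi>" "locally_constant_on A \<psi>"
  shows "locally_constant_on A (\<lambda>x. \<phi> x \<and> \<psi> x)"
  unfolding locally_constant_on_def
proof
  fix x assume x: "x \<in> A"
  obtain a where a: "0 < a" "\<forall>y\<in>A. dist x y < a \<longrightarrow> \<phi> y = \<phi> x" using assms(1) x unfolding locally_constant_on_def by blast
  obtain b where b: "0 < b" "\<forall>y\<in>A. dist x y < b \<longrightarrow> \<psi> y = \<psi> x" using assms(2) x unfolding locally_constant_on_def by blast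
  show "\<exists>\<delta>>0. \<forall>y\<in>A. dist x y < \<delta> \<longrightarrow> (\<phi> y \<and> \<psi> y) = (\<phi> x \<and> \<psi> x)"
    using a b by (intro exI[of _ "min a b"]) simp
qed

lemma coord_word_map_le:
  assumes "list_all valid w" "near_by d x y"
  shows "\<bar>coord k (word_map w x) - coord k (word_map w y)\<bar> \<le> (1/2) ^ length w * d"
  using word_map_contraction[OF assms] unfolding near_by_def by blast

text \<open>The hyperplane at a level from \<open>S\<close> meets the images of the spokes only in removed points. Hence
  it can be turned into a clopen partition by cutting all cells of a given depth which it crosses.\<close>

lemma level_partition:
  assumes S: "good_levels S" and s: "s \<in> S"
    and cuts: "\<And>w p. list_all valid w \<Longrightarrow> cut c p (word_map w -` removed S)"
    and w: "list_all valid w"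
  shows "\<exists>\<phi>. locally_constant_on (game_continuum c p - word_map w -` removed S) \<phi> \<and>
    (\<forall>y. corner y \<longrightarrow> \<phi> y = (coord k (word_map w y) < s)) \<and>
    (\<forall>y\<in>game_continuum c p - word_map w -` removed S.
      (1/2) ^ (length w + n) < \<bar>coord k (word_map w y) - s\<bar> \<longrightarrow> \<phi> y = (coord k (word_map w y) < s))"
  using w
proof (induction n arbitrary: w p)
  \<comment> \<open>The whole cell varies by no more than the tolerance, so essentially only the
    values at the two ends are prescribed. If they differ, a cut or its complement realizes
    them.\<close>
  case 0
  define R where "R = word_map w -` removed S"
  define h where "h y = coord k (word_map w y)" for y
  have near: "\<bar>h x - h y\<bar> \<le> (1/2) ^ length w" if "x \<in> Delta" "y \<in> Delta" for x y
    using coord_word_map_le[OF 0 Delta_near_by[OF that], of k] by (simp add: h_def)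
  have E: "y \<in> Delta" if "y \<in> game_continuum c p - R" for y using that game_continuum_subset by blast
  have D: "src \<in> Delta" "tgt \<in> Delta" by (rule src_in_Delta, rule tgt_in_Delta)
  show ?case unfolding R_def[symmetric] h_def[symmetric] corner_def
  proof (cases "(h src < s) = (h tgt < s)")
    case True
    have "(1/2) ^ (length w + 0) < \<bar>h y - s\<bar> \<longrightarrow> (h src < s) = (h y < s)" if "y \<in> game_continuum c p - R" for y
      using near[OF D(1) E[OF that]] by auto
    then show "\<exists>\<phi>. locally_constant_on (game_continuum c p - R) \<phi> \<and> (\<forall>y. y = src \<or> y = tgt \<longrightarrow> \<phi> y = (h y < s)) \<and>
      (\<forall>y\<in>game_continuum c p - R. (1/2) ^ (length w + 0) < \<bar>h y - s\<bar> \<longrightarrow> \<phi> y = (h y < s))"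
      using True locally_constant_on_const by (intro exI[of _ "\<lambda>_. h src < s"]) blast
  next
    case False
    obtain \<theta> where \<theta>: "locally_constant_on (game_continuum c p - R) \<theta>" "\<not> \<theta> src" "\<theta> tgt"
      using cuts[OF 0] unfolding cut_def R_def by blast
    define \<phi> where "\<phi> = (if h tgt < s then \<theta> else (\<lambda>x. \<not> \<theta> x))"
    have "locally_constant_on (game_continuum c p - R) \<phi>"
      unfolding \<phi>_def using \<theta>(1) locally_constant_on_Not[OF \<theta>(1)] by (cases "h tgt < s") simp_all
    moreover have "\<phi> src = (h src < s)" "\<phi> tgt = (h tgt < s)" using False \<theta> by (auto simp: \<phi>_def)
    moreover have "\<not> (1/2) ^ (length w + 0) < \<bar>h y - s\<bar>" if "y \<in> game_continuum c p - R" for y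
      using near[OF E[OF that] D(1)] near[OF E[OF that] D(2)] False by auto
    ultimately show "\<exists>\<phi>. locally_constant_on (game_continuum c p - R) \<phi> \<and> (\<forall>y. y = src \<or> y = tgt \<longrightarrow> \<phi> y = (h y < s)) \<and>
      (\<forall>y\<in>game_continuum c p - R. (1/2) ^ (length w + 0) < \<bar>h y - s\<bar> \<longrightarrow> \<phi> y = (h y < s))"
      by (intro exI[of _ \<phi>]) blast
  qed
next
  case (Suc n)
  define R where "R = word_map w -` removed S"
  define h where "h y = coord k (word_map w y)" for y
  define F where "F \<sigma> = game_continuum c (label p \<sigma>) - T \<sigma> -` R" for \<sigma>
  have hT: "coord k (word_map (w @ [\<sigma>]) y) = h (T \<sigma> y)" for \<sigma> y by (simp add: h_def word_map_append)
  have FR: "game_continuum c (label p \<sigma>) - word_map (w @ [\<sigma>]) -` removed S = F \<sigma>" for \<sigma>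
    unfolding F_def R_def vimage_word_map_snoc ..
  have FD: "y \<in> Delta" if "y \<in> F \<sigma>" for y \<sigma> using that game_continuum_subset unfolding F_def by blast
  \<comment> \<open>The last clause demands the exact value on cells which the hyperplane does not
    cross. Near a spoke point off the hyperplane all small cells are of this kind, so only finitely
    many cells can deviate.\<close>
  have "\<exists>\<phi>. active c p \<sigma> \<longrightarrow> locally_constant_on (F \<sigma>) \<phi> \<and> (\<forall>y. corner y \<longrightarrow> \<phi> y = (h (T \<sigma> y) < s)) \<and>
      (\<forall>y\<in>F \<sigma>. (1/2) ^ (length w + Suc n) < \<bar>h (T \<sigma> y) - s\<bar> \<longrightarrow> \<phi> y = (h (T \<sigma> y) < s)) \<and>
      (\<forall>b. (\<forall>y\<in>Delta. (h (T \<sigma> y) < s) = b) \<longrightarrow> (\<forall>y\<in>F \<sigma>. \<phi> y = b))" for \<sigma>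
  proof (cases "active c p \<sigma> \<and> \<not> (\<exists>b. \<forall>y\<in>Delta. (h (T \<sigma> y) < s) = b)")
    case True
    then have "list_all valid (w @ [\<sigma>])" using Suc.prems active_valid by auto
    from Suc.IH[OF this, of "label p \<sigma>"] show ?thesis using True
      unfolding FR hT by (elim exE) (simp, blast)
  next
    case False
    show ?thesis
    proof (cases "active c p \<sigma>")
      case True
      then obtain b where b: "\<forall>y\<in>Delta. (h (T \<sigma> y) < s) = b" using False by blast
      then have "\<forall>y. corner y \<longrightarrow> b = (h (T \<sigma> y) < s)" using corner_in_Delta by blast
      moreover have "\<forall>y\<in>F \<sigma>. b = (h (T \<sigma> y) < s)" using b FD by blast
      moreover have "\<forall>b'. (\<forall>y\<in>Delta. (h (T \<sigma> y) < s) = b') \<longrightarrow> b = b'" using b src_in_Delta by blast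
      ultimately show ?thesis using locally_constant_on_const by (intro exI[of _ "\<lambda>_. b"]) blast
    qed simp
  qed
  then obtain \<phi> where "\<forall>\<sigma>. active c p \<sigma> \<longrightarrow> locally_constant_on (F \<sigma>) (\<phi> \<sigma>) \<and> (\<forall>y. corner y \<longrightarrow> \<phi> \<sigma> y = (h (T \<sigma> y) < s)) \<and>
      (\<forall>y\<in>F \<sigma>. (1/2) ^ (length w + Suc n) < \<bar>h (T \<sigma> y) - s\<bar> \<longrightarrow> \<phi> \<sigma> y = (h (T \<sigma> y) < s)) \<and>
      (\<forall>b. (\<forall>y\<in>Delta. (h (T \<sigma> y) < s) = b) \<longrightarrow> (\<forall>y\<in>F \<sigma>. \<phi> \<sigma> y = b))"
    by (rule exE[OF choice[OF allI]])
  then have \<phi>: "\<And>\<sigma>. active c p \<sigma> \<Longrightarrow> locally_constant_on (F \<sigma>) (\<phi> \<sigma>)"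
    "\<And>\<sigma> y. active c p \<sigma> \<Longrightarrow> corner y \<Longrightarrow> \<phi> \<sigma> y = (h (T \<sigma> y) < s)"
    "\<And>\<sigma> y. active c p \<sigma> \<Longrightarrow> y \<in> F \<sigma> \<Longrightarrow> (1/2) ^ (length w + Suc n) < \<bar>h (T \<sigma> y) - s\<bar> \<Longrightarrow> \<phi> \<sigma> y = (h (T \<sigma> y) < s)"
    "\<And>\<sigma> b y. active c p \<sigma> \<Longrightarrow> (\<forall>y\<in>Delta. (h (T \<sigma> y) < s) = b) \<Longrightarrow> y \<in> F \<sigma> \<Longrightarrow> \<phi> \<sigma> y = b" by blast+
  \<comment> \<open>Spoke points on the hyperplane are removed, so the side of the hyperplane is
    locally constant on the remaining ones.\<close>
  have hs: "h x \<noteq> s" if "x \<in> spokes - R" for x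
    using that s Suc.prems unfolding R_def removed_def h_def by blast
  have hlip: "\<bar>h x - h y\<bar> \<le> d" if "near_by d x y" for x y d
  proof -
    have "0 \<le> d" using that unfolding near_by_def by (meson abs_ge_zero order_trans)
    then have "(1/2) ^ length w * d \<le> 1 * d" by (intro mult_right_mono power_le_one) auto
    then show ?thesis using coord_word_map_le[OF Suc.prems that, of k] unfolding h_def by linarith
  qed
  have "\<exists>\<psi>. locally_constant_on (game_continuum c p - R) \<psi> \<and> (\<forall>x\<in>spokes - R. \<psi> x = (h x < s)) \<and>
    (\<forall>\<sigma>. active c p \<sigma> \<longrightarrow> (\<forall>y\<in>game_continuum c (label p \<sigma>) - T \<sigma> -` R. \<psi> (T \<sigma> y) = \<phi> \<sigma> y))"
  proof (rule glue_cells)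
    show "locally_constant_on (game_continuum c (label p \<sigma>) - T \<sigma> -` R) (\<phi> \<sigma>)" if "active c p \<sigma>" for \<sigma>
      using \<phi>(1)[OF that] unfolding F_def .
  next
    show "locally_constant_on (spokes - R) (\<lambda>x. h x < s)"
      unfolding locally_constant_on_def
    proof
      fix x assume "x \<in> spokes - R"
      then have "0 < \<bar>h x - s\<bar>" using hs by simp
      moreover have "(h y < s) = (h x < s)" if "dist x y < \<bar>h x - s\<bar>" for y
        using hlip[OF near_by_dist[of x y]] that by auto
      ultimately show "\<exists>\<delta>>0. \<forall>y\<in>spokes - R. dist x y < \<delta> \<longrightarrow> (h y < s) = (h x < s)" by blast
    qed
  next
    show "\<phi> \<sigma> y = (h (T \<sigma> y) < s)" if "active c p \<sigma>" "corner y" "T \<sigma> y \<in> spokes" for \<sigma> y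
      using \<phi>(2) that by blast
  next
    show "\<phi> \<sigma> y = \<phi> \<tau> z" if "active c p \<sigma>" "active c p \<tau>" "\<sigma> \<noteq> \<tau>" "corner y" "corner z" "T \<sigma> y = T \<tau> z"
      "T \<sigma> y \<notin> spokes" for \<sigma> \<tau> y z
      using \<phi>(2)[OF that(1,4)] \<phi>(2)[OF that(2,5)] that(6) by simp
  next
    fix x assume x: "x \<in> spokes - R"
    define \<eta> where "\<eta> = \<bar>h x - s\<bar> / 3"
    have \<eta>: "0 < \<eta>" "\<bar>h x - s\<bar> = 3 * \<eta>" using hs[OF x] by (simp_all add: \<eta>_def)
    have "{\<sigma>. active c p \<sigma> \<and> (\<exists>y\<in>game_continuum c (label p \<sigma>) - T \<sigma> -` R. dist x (T \<sigma> y) < \<eta> \<and> \<phi> \<sigma> y \<noteq> (h x < s))} \<subseteq>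
        {\<sigma>. valid \<sigma> \<and> \<not> (close_to_spoke \<eta> \<sigma> \<and> small_cell \<eta> \<sigma>)}"
    proof
      fix \<sigma> assume "\<sigma> \<in> {\<sigma>. active c p \<sigma> \<and> (\<exists>y\<in>game_continuum c (label p \<sigma>) - T \<sigma> -` R. dist x (T \<sigma> y) < \<eta> \<and> \<phi> \<sigma> y \<noteq> (h x < s))}"
      then obtain y where y: "active c p \<sigma>" "y \<in> F \<sigma>" "dist x (T \<sigma> y) < \<eta>" "\<phi> \<sigma> y \<noteq> (h x < s)" unfolding F_def by blast
      have "\<not> small_cell \<eta> \<sigma>"
      proof
        assume small: "small_cell \<eta> \<sigma>"
        have "(h (T \<sigma> z) < s) = (h x < s)" if z: "z \<in> Delta" for z
        proof -
          have "\<bar>h (T \<sigma> y) - h (T \<sigma> z)\<bar> \<le> \<eta>" using small FD[OF y(2)] z unfolding small_cell_def by (intro hlip) blast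
          moreover have "\<bar>h x - h (T \<sigma> y)\<bar> < \<eta>" using hlip[OF near_by_dist[of x "T \<sigma> y"]] y(3) by simp
          ultimately show ?thesis using \<eta> by (auto simp: abs_if split: if_splits)
        qed
        then show False using \<phi>(4)[OF y(1) _ y(2)] y(4) by blast
      qed
      then show "\<sigma> \<in> {\<sigma>. valid \<sigma> \<and> \<not> (close_to_spoke \<eta> \<sigma> \<and> small_cell \<eta> \<sigma>)}" using active_valid[OF y(1)] by blast
    qed
    then have "finite {\<sigma>. active c p \<sigma> \<and> (\<exists>y\<in>game_continuum c (label p \<sigma>) - T \<sigma> -` R. dist x (T \<sigma> y) < \<eta> \<and> \<phi> \<sigma> y \<noteq> (h x < s))}"
      using finite_not_close_or_small[OF \<eta>(1)] by (rule finite_subset)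
    then show "\<exists>\<delta>>0. finite {\<sigma>. active c p \<sigma> \<and>
        (\<exists>y\<in>game_continuum c (label p \<sigma>) - T \<sigma> -` R. dist x (T \<sigma> y) < \<delta> \<and> \<phi> \<sigma> y \<noteq> (h x < s))}"
      using \<eta>(1) by blast
  qed
  then obtain \<psi> where \<psi>: "locally_constant_on (game_continuum c p - R) \<psi>" "\<forall>x\<in>spokes - R. \<psi> x = (h x < s)"
    "\<forall>\<sigma>. active c p \<sigma> \<longrightarrow> (\<forall>y\<in>game_continuum c (label p \<sigma>) - T \<sigma> -` R. \<psi> (T \<sigma> y) = \<phi> \<sigma> y)"
    by (elim exE conjE)
  have good: "good_removed R" unfolding R_def by (rule good_removed_word[OF S Suc.prems])
  then have nR: "src \<notin> R" "tgt \<notin> R" using corner_vertex unfolding good_removed_def corner_def by blast+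
  then have "\<psi> (T SA src) = \<phi> SA src" "\<psi> (T SB tgt) = \<phi> SB tgt"
    using ends_in_game_continuum by (intro \<psi>(3)[rule_format]; simp add: T_src_tgt)+
  then have ends: "\<psi> src = (h src < s)" "\<psi> tgt = (h tgt < s)"
    using \<phi>(2)[of SA src] \<phi>(2)[of SB tgt] by (simp_all add: corner_def T_src_tgt)
  have "\<psi> y = (h y < s)" if y: "y \<in> game_continuum c p - R" "(1/2) ^ (length w + Suc n) < \<bar>h y - s\<bar>" for y
  proof (cases "y \<in> spokes")
    case True
    then show ?thesis using \<psi>(2) y(1) by blast
  next
    case False
    then obtain \<sigma> z where z: "active c p \<sigma>" "z \<in> game_continuum c (label p \<sigma>)" "y = T \<sigma> z"
      using y(1) game_continuum_unfold[of c p] by blast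
    then have "z \<in> F \<sigma>" using y(1) unfolding F_def by simp
    then show ?thesis using \<phi>(3)[OF z(1)] \<psi>(3) z y(2) unfolding F_def by simp
  qed
  then show ?case unfolding R_def[symmetric] h_def[symmetric] using \<psi>(1) ends
    by (intro exI[of _ \<psi>]) (auto simp: corner_def)
qed

text \<open>One level below and one above each coordinate of \<open>x\<close> bound a small box, and
  the three strips between the corresponding partitions intersect in a small clopen
  neighbourhood.\<close>

theorem winning_imp_small_partitions:
  assumes S: "good_levels S" and win: "colour_win c f"
    and x: "x \<in> game_continuum c [] - removed S" and \<epsilon>: "0 < \<epsilon>"
  shows "\<exists>\<phi>. locally_constant_on (game_continuum c [] - removed S) \<phi> \<and> \<phi> x \<and>
    (\<forall>y\<in>game_continuum c [] - removed S. \<phi> y \<longrightarrow> dist x y < \<epsilon>)"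
proof -
  define F where "F = game_continuum c [] - removed S"
  \<comment> \<open>Each coordinate will be controlled up to \<open>3 * \<eta>\<close>, which gives
    distance at most \<open>9 * \<eta>\<close>.\<close>
  define \<eta> where "\<eta> = \<epsilon> / 12"
  have \<eta>: "0 < \<eta>" "9 * \<eta> < \<epsilon>" using \<epsilon> by (simp_all add: \<eta>_def)
  obtain n where n: "(1/2::real) ^ n < \<eta>" using real_arch_pow_inv[of \<eta> "1/2"] \<eta> by auto
  have lev: "\<exists>\<phi>. locally_constant_on F \<phi> \<and>
      (\<forall>y\<in>F. \<eta> \<le> \<bar>coord k y - s\<bar> \<longrightarrow> \<phi> y = (coord k y < s))" if "s \<in> S" for s k
  proof -
    have "word_map [] -` removed S = removed S" by auto
    then show ?thesis
      using level_partition[OF S that winning_imp_all_cut[OF S win], of "[]" "[]" k n] n unfolding F_def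
      by (auto intro: less_le_trans)
  qed
  have "\<exists>\<phi>. locally_constant_on F \<phi> \<and> \<phi> x \<and> (\<forall>y\<in>F. \<phi> y \<longrightarrow> \<bar>coord k x - coord k y\<bar> \<le> 3 * \<eta>)" for k
  proof -
    obtain s where s: "s \<in> S" "coord k x - 2 * \<eta> < s" "s < coord k x - \<eta>"
      using S \<eta> unfolding good_levels_def
      by (elim conjE allE[of _ "coord k x - 2 * \<eta>"] allE[of _ "coord k x - \<eta>"]) fastforce
    obtain t where t: "t \<in> S" "coord k x + \<eta> < t" "t < coord k x + 2 * \<eta>"
      using S \<eta> unfolding good_levels_def
      by (elim conjE allE[of _ "coord k x + \<eta>"] allE[of _ "coord k x + 2 * \<eta>"]) fastforce
    obtain \<phi> where \<phi>: "locally_constant_on F \<phi>" "\<forall>y\<in>F. \<eta> \<le> \<bar>coord k y - s\<bar> \<longrightarrow> \<phi> y = (coord k y < s)"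
      using lev[OF s(1)] by blast
    obtain \<psi> where \<psi>: "locally_constant_on F \<psi>" "\<forall>y\<in>F. \<eta> \<le> \<bar>coord k y - t\<bar> \<longrightarrow> \<psi> y = (coord k y < t)"
      using lev[OF t(1)] by blast
    have xF: "x \<in> F" using x unfolding F_def .
    have "\<not> \<phi> x" using \<phi>(2)[rule_format, OF xF] s \<eta>(1) by simp
    moreover have "\<psi> x" using \<psi>(2)[rule_format, OF xF] t \<eta>(1) by simp
    moreover have "\<bar>coord k x - coord k y\<bar> \<le> 3 * \<eta>" if y: "y \<in> F" "\<not> \<phi> y" "\<psi> y" for y
    proof -
      have "s - \<eta> \<le> coord k y"
        by (rule ccontr) (use \<phi>(2)[rule_format, OF y(1)] y(2) \<eta>(1) in simp)
      moreover have "coord k y \<le> t + \<eta>"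
        by (rule ccontr) (use \<psi>(2)[rule_format, OF y(1)] y(3) \<eta>(1) in simp)
      ultimately show ?thesis using s t by linarith
    qed
    ultimately show ?thesis
      using locally_constant_on_conj[OF locally_constant_on_Not[OF \<phi>(1)] \<psi>(1)]
      by (intro exI[of _ "\<lambda>y. \<not> \<phi> y \<and> \<psi> y"]) blast
  qed
  then obtain \<phi> where \<phi>: "\<And>k. locally_constant_on F (\<phi> k)" "\<And>k. \<phi> k x"
    "\<And>k y. y \<in> F \<Longrightarrow> \<phi> k y \<Longrightarrow> \<bar>coord k x - coord k y\<bar> \<le> 3 * \<eta>" by metis
  have "locally_constant_on F (\<lambda>y. \<phi> 0 y \<and> \<phi> 1 y \<and> \<phi> 2 y)"
    by (intro locally_constant_on_conj \<phi>(1))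
  moreover have "dist x y < \<epsilon>" if y: "y \<in> F" "\<phi> 0 y \<and> \<phi> 1 y \<and> \<phi> 2 y" for y
  proof -
    have "near_by (3 * \<eta>) x y"
      unfolding near_by_def coord_cases[of "\<lambda>a b. \<bar>a - b\<bar> \<le> 3 * \<eta>"]
      using \<phi>(3)[OF y(1), of 0] \<phi>(3)[OF y(1), of 1] \<phi>(3)[OF y(1), of 2] y(2) by (simp add: coord_def)
    from dist_le_of_near_by[OF this] show ?thesis using \<eta> by simp
  qed
  ultimately show ?thesis using \<phi>(2) unfolding F_def[symmetric]
    by (intro exI[of _ "\<lambda>y. \<phi> 0 y \<and> \<phi> 1 y \<and> \<phi> 2 y"]) blast
qed

section \<open>A partition separating the ends yields a winning strategy\<close>

inductive cell :: "(position \<Rightarrow> bool) \<Rightarrow> sym list \<Rightarrow> position \<Rightarrow> bool" for c where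
  cell_Nil: "cell c [] []"
| cell_snoc: "cell c w p \<Longrightarrow> active c p \<sigma> \<Longrightarrow> cell c (w @ [\<sigma>]) (label p \<sigma>)"

lemma cell_valid: "cell c w p \<Longrightarrow> list_all valid w"
  by (induction rule: cell.induct) (simp_all add: active_valid)

lemma cell_subset: "cell c w p \<Longrightarrow> x \<in> game_continuum c p \<Longrightarrow> word_map w x \<in> game_continuum c []"
proof (induction arbitrary: x rule: cell.induct)
  case (cell_snoc w p \<sigma>)
  have "T \<sigma> x \<in> game_continuum c p" using cell_subset_game_continuum[OF cell_snoc.hyps(2)] cell_snoc.prems by blast
  then show ?case using cell_snoc.IH by (simp add: word_map_append)
qed simp

definition separates :: "(pt \<Rightarrow> bool) \<Rightarrow> sym list \<Rightarrow> bool" where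
  "separates \<phi> w \<longleftrightarrow> \<phi> (word_map w src) \<noteq> \<phi> (word_map w tgt)"

lemma corner_word_mem:
  assumes "good_levels S" "cell c w p" "corner y"
  shows "word_map w y \<in> game_continuum c [] - removed S"
  using cell_subset[OF assms(2)] ends_in_game_continuum assms(3) word_map_vertices[OF cell_valid[OF assms(2)] corner_vertex[OF assms(3)]]
    deep_not_removed[OF assms(1) vertices_deep] unfolding corner_def by blast

text \<open>Each symbol halves distances, so the cells of an unbounded chain shrink to a point,
  which compactness supplies. It is a limit of corners of these cells and hence lies in the closed
  continuum.\<close>

lemma separated_chain_bounded:
  assumes S: "good_levels S" and \<phi>: "locally_constant_on (game_continuum c [] - removed S) \<phi>"
    and cells: "\<And>n. \<exists>p. cell c (W n) p" and sep: "\<And>n. separates \<phi> (W n)"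
    and ext: "\<And>n. \<exists>v. W (Suc n) = W n @ v"
  shows "\<exists>L. \<forall>n. length (W n) < L"
proof (rule ccontr)
  assume "\<not> ?thesis"
  then have long: "\<exists>n. L \<le> length (W n)" for L by (meson not_le)
  define C where "C n = word_map (W n) ` Delta" for n
  have V: "list_all valid (W n)" for n using cells cell_valid by blast
  have sub: "C (Suc n) \<subseteq> C n" for n
  proof -
    obtain v where v: "W (Suc n) = W n @ v" using ext by blast
    then have "list_all valid v" using V[of "Suc n"] by simp
    then show ?thesis unfolding C_def v word_map_append image_comp[symmetric] comp_def
      using word_map_in_Delta by (auto simp del: split_paired_All)
  qed
  have "(\<Inter>n. C n) \<noteq> {}"
  proof (rule compact_nest)
    show "compact (C n)" for n
      unfolding C_def by (rule compact_continuous_image[OF word_map_continuous compact_Delta])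
    show "C n \<noteq> {}" for n unfolding C_def using src_in_Delta by blast
    show "C n \<subseteq> C m" if "m \<le> n" for m n using lift_Suc_antimono_le[of C, OF sub that] .
  qed
  then obtain x where x: "\<And>n. x \<in> C n" by blast
  have near: "dist x (word_map (W n) y) \<le> 3 * (1/2) ^ length (W n)" if "corner y" for n y
  proof -
    obtain z where z: "z \<in> Delta" "x = word_map (W n) z" using x[of n] unfolding C_def by blast
    have "near_by ((1/2) ^ length (W n) * 1) x (word_map (W n) y)"
      unfolding z(2) by (rule word_map_contraction[OF V Delta_near_by[OF z(1) corner_in_Delta[OF that]]])
    then show ?thesis using dist_le_of_near_by by simp
  qed
  have mem: "word_map (W n) y \<in> game_continuum c [] - removed S" if "corner y" for n y
    using cells[of n] corner_word_mem[OF S _ that] by blast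
  have close: "\<exists>n. \<forall>y. corner y \<longrightarrow> dist x (word_map (W n) y) < \<delta>" if pos: "0 < \<delta>" for \<delta>
  proof -
    obtain L where L: "(1/2::real) ^ L < \<delta> / 3" using real_arch_pow_inv[of "\<delta> / 3" "1/2"] pos by auto
    obtain n where n: "L \<le> length (W n)" using long by blast
    have "(1/2::real) ^ length (W n) \<le> (1/2) ^ L" using n by (intro power_decreasing) auto
    then have "3 * (1/2) ^ length (W n) < \<delta>" using L by linarith
    then show ?thesis using near by (meson le_less_trans)
  qed
  have csrc: "corner src" and ctgt: "corner tgt" by (simp_all add: corner_def)
  have "x \<in> game_continuum c []"
  proof (rule ccontr)
    assume "x \<notin> game_continuum c []"
    then obtain \<delta> where \<delta>: "0 < \<delta>" "\<forall>y\<in>game_continuum c []. \<delta> \<le> dist x y"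
      using positive_distance[OF compact_game_continuum] by blast
    obtain n where "dist x (word_map (W n) src) < \<delta>" using close[OF \<delta>(1)] csrc by blast
    then show False using \<delta>(2) mem[OF csrc, of n] by fastforce
  qed
  moreover have "deep x"
    unfolding deep_def
  proof
    fix m obtain n where "m \<le> length (W n)" using long by blast
    then show "\<exists>w. list_all valid w \<and> m \<le> length w \<and> x \<in> word_map w ` Delta"
      using V[of n] x[of n] unfolding C_def by blast
  qed
  ultimately have "x \<in> game_continuum c [] - removed S" using deep_not_removed[OF S] by blast
  then obtain \<delta> where \<delta>: "0 < \<delta>" "\<forall>y\<in>game_continuum c [] - removed S. dist x y < \<delta> \<longrightarrow> \<phi> y = \<phi> x"
    using \<phi> unfolding locally_constant_on_def by blast
  obtain n where n: "\<forall>y. corner y \<longrightarrow> dist x (word_map (W n) y) < \<delta>" using close[OF \<delta>(1)] by blast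
  have "\<phi> (word_map (W n) y) = \<phi> x" if "corner y" for y using \<delta>(2) n mem[OF that] that by blast
  then show False using sep[of n] csrc ctgt unfolding separates_def by blast
qed

text \<open>Consecutive chords share a knot, so the value is carried along the arc.\<close>

lemma edge_value_constant:
  assumes "\<And>m. m \<le> level e \<Longrightarrow> \<not> separates \<phi> (w @ [SE e m])"
  shows "\<phi> (word_map w (spine (near_end e))) = \<phi> (word_map w (spine (far_end e)))"
proof -
  have "\<phi> (word_map w (edge_arc e (knot e m))) = \<phi> (word_map w (edge_arc e 0))" if "m \<le> Suc (level e)" for m
    using that
  proof (induction m)
    case (Suc m)
    then show ?case using assms[of m] by (simp add: separates_def word_map_append T_src_tgt)
  qed (simp add: knot_ends)
  from this[of "Suc (level e)"] show ?thesis by (simp add: knot_ends edge_arc_ends)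
qed

text \<open>The position is kept as \<open>s @ q\<close>, where \<open>w\<close> is the word of the
  copy in which the play now takes place, \<open>q\<close> its label and \<open>s\<close> the moves
  since it was entered. A coloured position enters the copy along the corresponding edge
  \<open>Co\<close>.\<close>

primrec play_state :: "(position \<Rightarrow> bool) \<Rightarrow> sym list \<Rightarrow> position \<Rightarrow> sym list \<times> position \<times> position" where
  "play_state c w0 [] = (w0, [], [])"
| "play_state c w0 (x # p) = (case play_state c w0 p of (w, q, s) \<Rightarrow>
      if c (x # s @ q) then (w @ [SE (Co (x # s)) 0], x # s @ q, []) else (w, q, x # s))"

lemma play_state_position: "play_state c w0 p = (w, q, s) \<Longrightarrow> p = s @ q"
  by (induction p arbitrary: w q s) (auto split: prod.splits if_splits)

text \<open>Player I keeps \<open>u_0(s)\<close> and \<open>b(s)\<close> on different sides within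
  the current copy. A coloured position then leads into a smaller separated copy, and this can
  happen only finitely often.\<close>

theorem separation_imp_winning:
  assumes S: "good_levels S" and \<phi>: "locally_constant_on (game_continuum c [] - removed S) \<phi>"
    and ends: "\<phi> src \<noteq> \<phi> tgt"
  shows "\<exists>f. colour_win c f"
proof -
  \<comment> \<open>Without such a \<open>w0\<close>, separated copies with label \<open>[]\<close>
    could be nested forever.\<close>
  have "\<exists>w0. cell c w0 [] \<and> separates \<phi> w0 \<and> (\<forall>v. cell c (w0 @ v) [] \<longrightarrow> v \<noteq> [] \<longrightarrow> \<not> separates \<phi> (w0 @ v))"
  proof (rule ccontr)
    assume "\<not> ?thesis"
    then have more: "\<exists>v. v \<noteq> [] \<and> cell c (w @ v) [] \<and> separates \<phi> (w @ v)" if "cell c w []" "separates \<phi> w" for w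
      using that by blast
    have "\<exists>W. \<forall>n. (cell c (W n) [] \<and> separates \<phi> (W n)) \<and> (\<exists>v. v \<noteq> [] \<and> W (Suc n) = W n @ v)"
    proof (rule dependent_nat_choice)
      show "\<exists>w. cell c w [] \<and> separates \<phi> w"
        using ends cell_Nil by (intro exI[of _ "[]"]) (simp add: separates_def)
    qed (use more in blast)
    then obtain W where W: "\<And>n. cell c (W n) []" "\<And>n. separates \<phi> (W n)" "\<And>n. \<exists>v. v \<noteq> [] \<and> W (Suc n) = W n @ v"
      by blast
    have "n \<le> length (W n)" for n
    proof (induction n)
      case (Suc n)
      obtain v where "v \<noteq> []" "W (Suc n) = W n @ v" using W(3) by blast
      then show ?case using Suc by (cases v) simp_all
    qed simp
    moreover have "\<exists>L. \<forall>n. length (W n) < L"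
      by (rule separated_chain_bounded[OF S \<phi>]) (use W in blast)+
    ultimately show False by (meson not_le)
  qed
  then obtain w0 where w0: "cell c w0 []" "separates \<phi> w0"
    and max: "\<And>v. cell c (w0 @ v) [] \<Longrightarrow> v \<noteq> [] \<Longrightarrow> \<not> separates \<phi> (w0 @ v)" by blast
  \<comment> \<open>Inside \<open>w0\<close> no copy with label \<open>[]\<close> is separated, so
    sides do not change along the edges \<open>St\<close>, \<open>En\<close> and
    \<open>Vv\<close>.\<close>
  have reset: "\<not> separates \<phi> (w @ [\<sigma>])" if w: "cell c w q" "\<exists>v. w = w0 @ v" and \<sigma>: "active c q \<sigma>" "label q \<sigma> = []" for w q \<sigma>
  proof -
    obtain v where "w = w0 @ v" using w(2) by blast
    moreover have "cell c (w @ [\<sigma>]) []" using cell_snoc[OF w(1) \<sigma>(1)] \<sigma>(2) by simp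
    ultimately show ?thesis using max[of "v @ [\<sigma>]"] by simp
  qed
  define a where "a w g = \<phi> (word_map w (spine (spine_pos g)))" for w g
  define inv where "inv = (\<lambda>(w, q, s). cell c w q \<and> (\<exists>v. w = w0 @ v) \<and> separates \<phi> w \<and> a w (uspoke s 0) \<noteq> a w (bspoke s))"
  \<comment> \<open>The copies \<open>SA\<close> and \<open>SB\<close> are not separated, so
    \<open>u_0([])\<close> has the side of \<open>src\<close> and \<open>b([])\<close> that of
    \<open>tgt\<close>.\<close>
  have inv_Nil: "inv (w, q, [])" if "cell c w q" "\<exists>v. w = w0 @ v" "separates \<phi> w" for w q
    using reset[OF that(1,2), of SA] reset[OF that(1,2), of SB] that
    by (simp add: inv_def a_def separates_def word_map_append T_src_tgt)
  have step: "\<exists>i. \<forall>j. inv (w, q, (i, j) # s) \<and> (c ((i, j) # s @ q) \<longrightarrow> inv (w @ [SE (Co ((i, j) # s)) 0], (i, j) # s @ q, []))"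
    if inv: "inv (w, q, s)" for w q s
  proof -
    have w: "cell c w q" "\<exists>v. w = w0 @ v" "separates \<phi> w" and ab: "a w (uspoke s 0) \<noteq> a w (bspoke s)"
      using inv unfolding inv_def by simp_all
    have V: "list_all valid w" by (rule cell_valid[OF w(1)])
    have st: "a w (uspoke ((i, j) # s) 0) = a w (uspoke s i)" for i j
      using edge_value_constant[of "St i j s" \<phi> w] reset[OF w(1,2)] by (simp add: a_def near_end_def)
    have en: "a w (bspoke ((i, j) # s)) = a w (uspoke s (Suc i))" for i j
      using edge_value_constant[of "En i j s" \<phi> w] reset[OF w(1,2)] by (simp add: a_def near_end_def)
    have vv: "a w (uspoke s k) = \<phi> (word_map w (spine (bk_pos s k)))" for k
      using edge_value_constant[of "Vv s k" \<phi> w] reset[OF w(1,2)] by (simp add: a_def near_end_def)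
    \<comment> \<open>The image of \<open>b(s)\<close> is a vertex and hence not removed. The points
      \<open>b_k(s)\<close> converge to \<open>b(s)\<close>, so some of them lie on its
      side.\<close>
    have "\<exists>k. \<phi> (word_map w (spine (bk_pos s k))) = a w (bspoke s)"
    proof -
      let ?x = "word_map w (spine (spine_pos (bspoke s)))"
      \<comment> \<open>Vertices are formed with all valid symbols, so this edge may be used even
        where it is inactive.\<close>
      have bx: "T (SE (Co s) 0) tgt = spine (spine_pos (bspoke s))"
        using knot_ends(2)[of "Co s"] by (simp add: T_src_tgt edge_arc_ends)
      have vx: "word_map w (T \<sigma> tgt) \<in> vertices" if "valid \<sigma>" for \<sigma>
        using word_map_vertices[of "w @ [\<sigma>]" tgt] V that corner_vertex[of tgt] by (simp add: word_map_append corner_def)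
      have "?x \<in> vertices" using vx[of "SE (Co s) 0"] bx by simp
      moreover have "?x \<in> game_continuum c []"
        using cell_subset[OF w(1)] spine_pos_in_spoke spokes_subset_game_continuum by blast
      ultimately have "?x \<in> game_continuum c [] - removed S" using deep_not_removed[OF S vertices_deep] by blast
      then obtain \<delta> where \<delta>: "0 < \<delta>" "\<forall>y\<in>game_continuum c [] - removed S. dist ?x y < \<delta> \<longrightarrow> \<phi> y = \<phi> ?x"
        using \<phi> unfolding locally_constant_on_def by blast
      obtain k where k: "(1/2::real) ^ k < \<delta> / 3" using real_arch_pow_inv[of "\<delta> / 3" "1/2"] \<delta>(1) by auto
      let ?\<sigma> = "SE (Vv s k) (level (Vv s k))"
      have endp: "T ?\<sigma> tgt = spine (bk_pos s k)" unfolding T_src_tgt knot_ends edge_arc_ends by simp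
      have "T ?\<sigma> tgt \<in> game_continuum c q"
        using cell_subset_game_continuum[of c q ?\<sigma>] ends_in_game_continuum(2) by (simp add: image_subset_iff)
      then have "word_map w (T ?\<sigma> tgt) \<in> game_continuum c []" using cell_subset[OF w(1)] by blast
      moreover have "word_map w (T ?\<sigma> tgt) \<notin> removed S"
        using deep_not_removed[OF S vertices_deep[OF vx]] by simp
      moreover have "dist ?x (word_map w (T ?\<sigma> tgt)) < \<delta>"
      proof -
        have "\<bar>bk_pos s k - spine_pos (bspoke s)\<bar> \<le> (1/2) ^ k"
          by (rule order_trans[OF bk_pos_dist]) simp
        then have "near_by ((1/2) ^ k) (spine (spine_pos (bspoke s))) (spine (bk_pos s k))"
          unfolding spine_def near_by_iff by (simp add: abs_minus_commute)
        from word_map_contraction[OF V this]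
        have "dist ?x (word_map w (T ?\<sigma> tgt)) \<le> 3 * ((1/2) ^ length w * (1/2) ^ k)" unfolding endp by (rule dist_le_of_near_by)
        also have "\<dots> \<le> 3 * (1 * (1/2) ^ k)" by (intro mult_left_mono mult_right_mono power_le_one) auto
        finally show ?thesis using k by simp
      qed
      ultimately have "\<phi> (word_map w (T ?\<sigma> tgt)) = \<phi> ?x" using \<delta>(2) by blast
      then show ?thesis unfolding endp a_def by blast
    qed
    then obtain k where k: "a w (uspoke s k) \<noteq> a w (uspoke s 0)" using vv ab by metis
    \<comment> \<open>A change of side between \<open>u_0(s)\<close> and \<open>u_k(s)\<close>
      occurs between two consecutive vertices. Their index is the move of Player I, and it works
      against every answer \<open>j\<close>.\<close>
    have "\<exists>i. a w (uspoke s i) \<noteq> a w (uspoke s (Suc i))"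
    proof (rule ccontr)
      assume "\<not> ?thesis"
      then have "a w (uspoke s k) = a w (uspoke s 0)" by (induction k) simp_all
      then show False using k by blast
    qed
    then obtain i where i: "a w (uspoke s i) \<noteq> a w (uspoke s (Suc i))" by blast
    have "inv (w, q, (i, j) # s) \<and> (c ((i, j) # s @ q) \<longrightarrow> inv (w @ [SE (Co ((i, j) # s)) 0], (i, j) # s @ q, []))" for j
    proof -
      let ?s = "(i, j) # s"
      have ne: "a w (uspoke ?s 0) \<noteq> a w (bspoke ?s)" using i st en by simp
      have "inv (w @ [SE (Co ?s) 0], ?s @ q, [])" if "c (?s @ q)"
      proof (rule inv_Nil)
        show "cell c (w @ [SE (Co ?s) 0]) (?s @ q)" using cell_snoc[OF w(1), of "SE (Co ?s) 0"] that by simp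
        show "\<exists>v. w @ [SE (Co ?s) 0] = w0 @ v" using w(2) by auto
        show "separates \<phi> (w @ [SE (Co ?s) 0])"
          using ne knot_ends[of "Co ?s"] by (simp add: separates_def word_map_append T_src_tgt a_def edge_arc_ends near_end_def)
      qed
      then show ?thesis using ne w unfolding inv_def by simp
    qed
    then show ?thesis by blast
  qed
  define I where "I st = (case st of (w, q, s) \<Rightarrow> SOME i. \<forall>j. inv (w, q, (i, j) # s) \<and>
      (c ((i, j) # s @ q) \<longrightarrow> inv (w @ [SE (Co ((i, j) # s)) 0], (i, j) # s @ q, [])))" for st
  define f where "f p = I (play_state c w0 p)" for p
  have "colour_win c f"
    unfolding colour_win_def
  proof (intro allI impI)
    fix \<gamma> assume \<gamma>: "\<forall>k. \<gamma> (2 * k) = f (round_list \<gamma> k)"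
    define W where "W n = fst (play_state c w0 (round_list \<gamma> n))" for n
    have inv: "inv (play_state c w0 (round_list \<gamma> n))" for n
    proof (induction n)
      case 0
      then show ?case using inv_Nil w0 by simp
    next
      case (Suc n)
      obtain w q s where st: "play_state c w0 (round_list \<gamma> n) = (w, q, s)" by (metis prod_cases3)
      let ?i = "\<gamma> (2 * n)"
      have "?i = I (w, q, s)" using \<gamma> st unfolding f_def by simp
      then have "\<forall>j. inv (w, q, (?i, j) # s) \<and> (c ((?i, j) # s @ q) \<longrightarrow> inv (w @ [SE (Co ((?i, j) # s)) 0], (?i, j) # s @ q, []))"
        unfolding I_def prod.case using someI_ex[OF step[of w q s]] Suc st by simp
      then show ?case using st by simp
    qed
    have Wstep: "\<exists>v. W (Suc n) = W n @ v \<and> (c (round_list \<gamma> (Suc n)) \<longrightarrow> length v = 1)" for n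
    proof -
      obtain w q s where st: "play_state c w0 (round_list \<gamma> n) = (w, q, s)" by (metis prod_cases3)
      then have "round_list \<gamma> n = s @ q" by (rule play_state_position)
      then show ?thesis unfolding W_def using st by simp
    qed
    have "\<exists>L. \<forall>n. length (W n) < L"
    proof (rule separated_chain_bounded[OF S \<phi>])
      fix n show "\<exists>p. cell c (W n) p" "separates \<phi> (W n)"
        using inv[of n] unfolding W_def inv_def by (auto split: prod.splits)
    qed (use Wstep in blast)
    then obtain L where L: "\<And>n. length (W n) < L" by blast
    show "\<exists>n0. \<forall>n\<ge>n0. \<not> c (round_list \<gamma> (Suc n))"
    proof (rule ccontr)
      assume "\<not> ?thesis"
      then have inf: "\<exists>n\<ge>n0. c (round_list \<gamma> (Suc n))" for n0 by blast
      have mono: "length (W m) \<le> length (W n)" if "m \<le> n" for m n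
      proof (rule lift_Suc_mono_le[of "\<lambda>n. length (W n)", OF _ that])
        show "length (W n) \<le> length (W (Suc n))" for n using Wstep[of n] by auto
      qed
      have "\<exists>n. l \<le> length (W n)" for l
      proof (induction l)
        case (Suc l)
        then obtain m where m: "l \<le> length (W m)" by blast
        obtain n where n: "m \<le> n" "c (round_list \<gamma> (Suc n))" using inf by blast
        have "length (W (Suc n)) = Suc (length (W n))" using Wstep[of n] n(2) by auto
        then show ?case using m mono[OF n(1)] by (metis Suc_le_mono le_trans)
      qed simp
      then show False using L by (meson not_le)
    qed
  qed
  then show ?thesis by blast
qed

section \<open>Embedding into the cube with prescribed rational points\<close>

context
  fixes a :: "nat \<Rightarrow> 'a::metric_space"
begin

text \<open>The cap at 1 bounds the corrections built from these functions and provides a value for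
  \<open>n = 0\<close>.\<close>

primrec distance_to_first :: "nat \<Rightarrow> 'a \<Rightarrow> real" where
  "distance_to_first 0 x = 1"
| "distance_to_first (Suc n) x = min (distance_to_first n x) (dist x (a n))"

lemma distance_to_first_bounds: "0 \<le> distance_to_first n x" "distance_to_first n x \<le> 1"
  by (induction n) auto

lemma distance_to_first_lipschitz: "\<bar>distance_to_first n x - distance_to_first n y\<bar> \<le> dist x y"
proof (induction n)
  case (Suc n)
  have "\<bar>dist x (a n) - dist y (a n)\<bar> \<le> dist x y"
    using dist_triangle[of x "a n" y] dist_triangle[of y "a n" x] by (simp add: dist_commute abs_le_iff)
  then show ?case using Suc by (simp add: min_def abs_le_iff)
qed simp

lemma distance_to_first_eq_0: "i < n \<Longrightarrow> distance_to_first n (a i) = 0"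
proof (induction n)
  case (Suc n)
  then show ?case using distance_to_first_bounds(1)[of n "a i"] by (cases "i = n") (auto simp: min_def)
qed simp

lemma distance_to_first_pos: "(\<And>i. i < n \<Longrightarrow> x \<noteq> a i) \<Longrightarrow> 0 < distance_to_first n x"
  by (induction n) auto

end

lemma small_rational_adjustment:
  fixes u d L :: real
  assumes "0 < d" "0 < L"
  shows "\<exists>c. 0 \<le> c \<and> c \<le> L \<and> (u + c * d \<in> \<rat> \<longleftrightarrow> r)"
proof (cases r)
  case True
  obtain q where q: "q \<in> \<rat>" "u < q" "q < u + L * d" using Rats_dense_in_real[of u "u + L * d"] assms by auto
  then show ?thesis using True assms by (intro exI[of _ "(q - u) / d"]) (simp add: field_simps)
next
  case False
  have "uncountable {u<..<u + L * d}" using assms by (simp add: uncountable_open_interval)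
  then obtain q where q: "q \<notin> \<rat>" "u < q" "q < u + L * d"
    using countable_rat countable_subset[of "{u<..<u + L * d}" \<rat>] by (metis greaterThanLessThan_iff subsetI)
  then show ?thesis using False assms by (intro exI[of _ "(q - u) / d"]) (simp add: field_simps)
qed

text \<open>The corrections added later vanish at the points treated earlier.\<close>

lemma rational_perturbation:
  fixes u :: "'a::metric_space \<Rightarrow> real"
  assumes W: "countable W" and L: "0 < L"
  shows "\<exists>g. (\<forall>x. \<bar>g x\<bar> \<le> L) \<and> (\<forall>x y. \<bar>g x - g y\<bar> \<le> L * dist x y) \<and> (\<forall>x\<in>W. u x + g x \<in> \<rat> \<longleftrightarrow> r x)"
proof (cases "W = {}")
  case True
  then show ?thesis using L by (intro exI[of _ "\<lambda>_. 0"]) simp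
next
  case False
  define a where "a = from_nat_into W"
  have range: "W = range a" unfolding a_def using range_from_nat_into[OF False W] by simp
  let ?d = "distance_to_first a"
  \<comment> \<open>The bounds \<open>L * (1/2) ^ Suc n\<close> add up to \<open>L\<close>, which
    limits both the size and the Lipschitz constant of the total correction.\<close>
  define ok where "ok n h c \<longleftrightarrow> 0 \<le> c \<and> c \<le> L * (1/2) ^ Suc n \<and>
      (0 < ?d n (a n) \<longrightarrow> (u (a n) + h (a n) + c * ?d n (a n) \<in> \<rat> \<longleftrightarrow> r (a n)))" for n and h :: "'a \<Rightarrow> real" and c
  have ok_ex: "\<exists>c. ok n h c" for n h
  proof (cases "0 < ?d n (a n)")
    case True
    have "0 < L * (1/2) ^ Suc n" using L by simp
    from small_rational_adjustment[OF True this, of "u (a n) + h (a n)" "r (a n)"] show ?thesis unfolding ok_def by blast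
  next
    case False
    then show ?thesis using L by (intro exI[of _ 0]) (simp add: ok_def)
  qed
  define H where "H = rec_nat (\<lambda>_. 0) (\<lambda>n h x. h x + (SOME c. ok n h c) * ?d n x)"
  define c where "c n = (SOME c. ok n (H n) c)" for n
  have H0: "H 0 x = 0" and HS: "H (Suc n) x = H n x + c n * ?d n x" for n x
    by (simp_all add: H_def c_def)
  have ok: "ok n (H n) (c n)" for n unfolding c_def by (rule someI_ex[OF ok_ex])
  have c: "0 \<le> c n" "c n \<le> L * (1/2) ^ Suc n" for n using ok[of n] unfolding ok_def by simp_all
  have H: "H n x = (\<Sum>i<n. c i * ?d i x)" for n x by (induction n) (simp_all add: H0 HS)
  have geo: "(\<lambda>n. L * (1/2) ^ Suc n) sums L" using sums_mult[OF power_half_series, of L] by simp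
  have bound: "summable f" "\<bar>suminf f\<bar> \<le> L * b"
    if "0 \<le> b" "\<And>n. \<bar>f n\<bar> \<le> c n * b" for f :: "nat \<Rightarrow> real" and b
  proof -
    have le: "\<bar>f n\<bar> \<le> L * (1/2) ^ Suc n * b" for n
      using that(2)[of n] mult_right_mono[OF c(2)[of n] that(1)] by linarith
    have s: "(\<lambda>n. L * (1/2) ^ Suc n * b) sums (L * b)" by (rule sums_mult2[OF geo])
    have sa: "summable (\<lambda>n. \<bar>f n\<bar>)"
      by (rule summable_comparison_test'[OF sums_summable[OF s], of 0]) (use le in simp)
    then show "summable f" by (rule summable_rabs_cancel)
    have "\<bar>suminf f\<bar> \<le> (\<Sum>n. \<bar>f n\<bar>)" by (rule summable_rabs[OF sa])
    also have "\<dots> \<le> (\<Sum>n. L * (1/2) ^ Suc n * b)" by (rule suminf_le[OF le sa sums_summable[OF s]])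
    also have "\<dots> = L * b" using s by (simp add: sums_iff)
    finally show "\<bar>suminf f\<bar> \<le> L * b" .
  qed
  define g where "g x = (\<Sum>n. c n * ?d n x)" for x
  have abs1: "\<bar>c n * ?d n x\<bar> \<le> c n * 1" for n x
    using c(1)[of n] distance_to_first_bounds[of a n x] by (simp add: abs_mult mult_left_le)
  have sm: "summable (\<lambda>n. c n * ?d n x)" for x by (rule bound(1)[OF _ abs1]) simp
  have "\<bar>g x\<bar> \<le> L" for x unfolding g_def using bound(2)[OF _ abs1[of _ x]] by simp
  moreover have "\<bar>g x - g y\<bar> \<le> L * dist x y" for x y
  proof -
    have "\<bar>c n * ?d n x - c n * ?d n y\<bar> \<le> c n * dist x y" for n
      using mult_left_mono[OF distance_to_first_lipschitz[of a n x y] c(1)[of n]] c(1)[of n]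
      by (simp add: abs_mult right_diff_distrib[symmetric])
    from bound(2)[OF zero_le_dist this] show ?thesis
      unfolding g_def suminf_diff[OF sm sm] .
  qed
  moreover have "u x + g x \<in> \<rat> \<longleftrightarrow> r x" if x: "x \<in> W" for x
  proof -
    \<comment> \<open>The enumeration may repeat points; the value at \<open>x\<close> is settled at
      its first occurrence.\<close>
    define m where "m = (LEAST n. a n = x)"
    have "\<exists>n. a n = x" using x range by blast
    then have m: "a m = x" unfolding m_def by (rule LeastI_ex)
    have "x \<noteq> a i" if "i < m" for i using not_less_Least that unfolding m_def by blast
    then have "0 < ?d m (a m)" using distance_to_first_pos[of m x a] m by simp
    then have "u x + H m x + c m * ?d m x \<in> \<rat> \<longleftrightarrow> r x" using ok[of m] m unfolding ok_def by simp
    moreover have "g x = H (Suc m) x"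
      unfolding g_def H using distance_to_first_eq_0[of m _ a] m
      by (intro suminf_finite) (auto simp: not_less)
    ultimately show ?thesis by (simp add: HS add.assoc)
  qed
  ultimately show ?thesis by blast
qed

theorem rational_embedding:
  fixes D :: "pt set"
  assumes D: "countable D"
  obtains \<Theta> :: "pt \<Rightarrow> real ^ 5" where "continuous_on UNIV \<Theta>" "inj \<Theta>"
    "\<And>x i. x \<in> Delta \<Longrightarrow> \<Theta> x $ i \<in> {0..1}" "\<And>x. (\<forall>i. \<Theta> x $ i \<in> \<rat>) \<longleftrightarrow> x \<in> D"
proof -
  \<comment> \<open>The constant 1/6 preserves injectivity: if the three perturbed coordinates agree
    at \<open>x\<close> and \<open>y\<close>, then \<open>dist x y\<close> is at most 3/6 of
    itself.\<close>
  have "\<exists>g. (\<forall>x. \<bar>g x\<bar> \<le> 1/6) \<and> (\<forall>x y. \<bar>g x - g y\<bar> \<le> 1/6 * dist x y) \<and> (\<forall>x\<in>D. coord k x + g x \<in> \<rat> \<longleftrightarrow> True)" for k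
    by (rule rational_perturbation[OF D]) simp
  then obtain g where g: "\<And>k x. \<bar>g k x\<bar> \<le> 1/6" "\<And>k x y. \<bar>g k x - g k y\<bar> \<le> 1/6 * dist x y"
    "\<And>k x. x \<in> D \<Longrightarrow> coord k x + g k x \<in> \<rat>" by metis
  define F where "F k x = coord k x + g k x" for k x
  have F_inj: "x = y" if "F 0 x = F 0 y" "F 1 x = F 1 y" "F 2 x = F 2 y" for x y
  proof -
    have "\<bar>coord k x - coord k y\<bar> \<le> 1/6 * dist x y" if "F k x = F k y" for k
      using g(2)[of k x y] that unfolding F_def by linarith
    then have "near_by (1/6 * dist x y) x y"
      unfolding near_by_def coord_cases[of "\<lambda>a b. \<bar>a - b\<bar> \<le> 1/6 * dist x y"]
      using that by (metis coord_def numeral_eq_one_iff semiring_norm(85) zero_neq_numeral zero_neq_one)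
    from dist_le_of_near_by[OF this] show ?thesis by simp
  qed
  \<comment> \<open>This set contains \<open>D\<close> and is countable, because the three
    coordinates map it injectively into rational triples.\<close>
  define W where "W = {x. F 0 x \<in> \<rat> \<and> F 1 x \<in> \<rat> \<and> F 2 x \<in> \<rat>}"
  have "countable W"
  proof (rule countable_image_inj_on)
    show "inj_on (\<lambda>x. (F 0 x, F 1 x, F 2 x)) W" using F_inj by (intro inj_onI) blast
    show "countable ((\<lambda>x. (F 0 x, F 1 x, F 2 x)) ` W)"
      by (rule countable_subset[of _ "\<rat> \<times> \<rat> \<times> \<rat>"]) (auto simp: W_def countable_rat)
  qed
  from rational_perturbation[OF this zero_less_one, of "\<lambda>_. 0" "\<lambda>x. x \<in> D"]
  obtain h :: "pt \<Rightarrow> real" where h': "\<forall>x. \<bar>h x\<bar> \<le> 1" "\<forall>x y. \<bar>h x - h y\<bar> \<le> 1 * dist x y"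
    "\<forall>x\<in>W. 0 + h x \<in> \<rat> \<longleftrightarrow> x \<in> D" by (elim exE conjE)
  have h: "\<bar>h x\<bar> \<le> 1" "\<bar>h x - h y\<bar> \<le> dist x y" "x \<in> W \<Longrightarrow> h x \<in> \<rat> \<longleftrightarrow> x \<in> D" for x y
    using h'(1)[rule_format, of x] h'(2)[rule_format, of x y] h'(3)[rule_format, of x] by simp_all
  define G where "G k x = (if k < 3 then F k x else if k = 3 then h x else 1/2)" for k :: nat and x
  have G_lip: "\<bar>G k x - G k y\<bar> \<le> 2 * dist x y" for k x y
  proof -
    have "\<bar>F k x - F k y\<bar> \<le> 2 * dist x y"
      using g(2)[of k x y] coord_le_dist[of k x y] zero_le_dist[of x y] unfolding F_def by linarith
    moreover have "\<bar>h x - h y\<bar> \<le> 2 * dist x y" using h(2)[of x y] zero_le_dist[of x y] by linarith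
    ultimately show ?thesis by (simp add: G_def)
  qed
  obtain j :: "5 \<Rightarrow> nat" where j: "bij_betw j UNIV {0..<5}"
    using ex_bij_betw_finite_nat[of "UNIV :: 5 set"] by auto
  have jex: "\<exists>i. j i = k" if "k < 5" for k
    using j that unfolding bij_betw_def by (metis atLeastLessThan_iff imageE zero_le)
  \<comment> \<open>On \<open>Delta\<close> all coordinates lie in [-1, 2]. The rational affine map
    onto [0, 1] does not affect rationality.\<close>
  define \<Theta> :: "pt \<Rightarrow> real ^ 5" where "\<Theta> x = (\<chi> i. (G (j i) x + 1) / 3)" for x
  show thesis
  proof
    have "continuous_on UNIV (G k)" for k
    proof (rule continuous_onI)
      fix x \<epsilon> assume "0 < (\<epsilon>::real)"
      then show "\<exists>d>0. \<forall>x'\<in>UNIV. dist x' x < d \<longrightarrow> dist (G k x') (G k x) \<le> \<epsilon>"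
        using G_lip[of k _ x] by (intro exI[of _ "\<epsilon> / 2"]) (fastforce simp: dist_real_def intro: order_trans)
    qed
    then show "continuous_on UNIV \<Theta>" unfolding \<Theta>_def by (intro continuous_intros) auto
    show "inj \<Theta>"
    proof (rule injI)
      fix x y assume eq: "\<Theta> x = \<Theta> y"
      have "G k x = G k y" if k: "k < 5" for k
      proof -
        obtain i where "j i = k" using jex[OF k] by blast
        moreover have "\<Theta> x $ i = \<Theta> y $ i" using eq by simp
        ultimately show ?thesis unfolding \<Theta>_def by simp
      qed
      from this[of 0] this[of 1] this[of 2] show "x = y" by (intro F_inj) (simp_all add: G_def)
    qed
    show "\<Theta> x $ i \<in> {0..1}" if "x \<in> Delta" for x i
    proof -
      have "0 \<le> coord k x \<and> coord k x \<le> 1" for k using that unfolding Delta_def coord_def by auto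
      moreover have "-1 \<le> c + a \<and> c + a \<le> 2" if "0 \<le> c \<and> c \<le> 1" "\<bar>a\<bar> \<le> 1/6" for a c :: real
        using that by linarith
      ultimately have "-1 \<le> F k x \<and> F k x \<le> 2" for k using g(1)[of k x] unfolding F_def by blast
      moreover have "-1 \<le> h x \<and> h x \<le> 2" using h(1)[of x] by linarith
      ultimately have "-1 \<le> G k x \<and> G k x \<le> 2" for k unfolding G_def by simp
      from this[of "j i"] show ?thesis unfolding \<Theta>_def by simp
    qed
    show "(\<forall>i. \<Theta> x $ i \<in> \<rat>) \<longleftrightarrow> x \<in> D" for x
    proof -
      have "(G k x + 1) / 3 \<in> \<rat> \<longleftrightarrow> G k x \<in> \<rat>" for k
      proof
        assume "(G k x + 1) / 3 \<in> \<rat>"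
        then have "(G k x + 1) / 3 * 3 - 1 \<in> \<rat>" by (intro Rats_diff Rats_mult) auto
        then show "G k x \<in> \<rat>" by (simp add: add_divide_distrib)
      qed auto
      then have "(\<forall>i. \<Theta> x $ i \<in> \<rat>) \<longleftrightarrow> (\<forall>i. G (j i) x \<in> \<rat>)" unfolding \<Theta>_def by simp
      also have "\<dots> \<longleftrightarrow> x \<in> W \<and> h x \<in> \<rat>"
      proof
        assume *: "\<forall>i. G (j i) x \<in> \<rat>"
        then have "G k x \<in> \<rat>" if "k < 5" for k using jex[OF that] by metis
        from this[of 0] this[of 1] this[of 2] this[of 3] show "x \<in> W \<and> h x \<in> \<rat>" by (simp add: G_def W_def)
      next
        assume *: "x \<in> W \<and> h x \<in> \<rat>"
        then have "F k x \<in> \<rat>" if "k < 3" for k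
          using that unfolding W_def by (auto simp: less_Suc_eq numeral_3_eq_3 numeral_2_eq_2)
        then show "\<forall>i. G (j i) x \<in> \<rat>" using * unfolding G_def by auto
      qed
      also have "\<dots> \<longleftrightarrow> x \<in> D" using h(3) g(3) unfolding W_def F_def by blast
      finally show ?thesis .
    qed
  qed
qed

section \<open>Zero-dimensionality in terms of small partitions\<close>

definition small_partitions :: "'a::metric_space set \<Rightarrow> bool" where
  "small_partitions F \<longleftrightarrow> (\<forall>x\<in>F. \<forall>\<epsilon>>0. \<exists>\<phi>. locally_constant_on F \<phi> \<and> \<phi> x \<and> (\<forall>y\<in>F. \<phi> y \<longrightarrow> dist x y < \<epsilon>))"

lemma zero_dimensional_iff_small_partitions: "zero_dimensional (top_of_set F) \<longleftrightarrow> small_partitions F"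
proof -
  let ?X = "top_of_set F"
  have clopen: "openin ?X U \<and> closedin ?X U \<longleftrightarrow> U \<subseteq> F \<and> locally_constant_on F (\<lambda>y. y \<in> U)" for U
  proof -
    have op: "openin ?X U \<longleftrightarrow> U \<subseteq> F \<and> (\<forall>x\<in>U. \<exists>\<delta>>0. \<forall>y\<in>F. dist x y < \<delta> \<longrightarrow> y \<in> U)" for U
      unfolding openin_euclidean_subtopology_iff by (simp add: dist_commute)
    show ?thesis
    proof
      assume *: "openin ?X U \<and> closedin ?X U"
      then have U: "U \<subseteq> F" "openin ?X U" "openin ?X (F - U)" unfolding closedin_def by simp_all
      have "\<exists>\<delta>>0. \<forall>y\<in>F. dist x y < \<delta> \<longrightarrow> (y \<in> U) = (x \<in> U)" if "x \<in> F" for x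
      proof (cases "x \<in> U")
        case True
        then show ?thesis using U(2)[unfolded op] by simp
      next
        case False
        then have "\<exists>\<delta>>0. \<forall>y\<in>F. dist x y < \<delta> \<longrightarrow> y \<in> F - U" using U(3)[unfolded op] that by blast
        then show ?thesis using False by simp
      qed
      then show "U \<subseteq> F \<and> locally_constant_on F (\<lambda>y. y \<in> U)" using U(1) unfolding locally_constant_on_def by simp
    next
      assume *: "U \<subseteq> F \<and> locally_constant_on F (\<lambda>y. y \<in> U)"
      then have lc: "\<exists>\<delta>>0. \<forall>y\<in>F. dist x y < \<delta> \<longrightarrow> (y \<in> U) = (x \<in> U)" if "x \<in> F" for x
        using that unfolding locally_constant_on_def by simp
      have "openin ?X U" unfolding op
      proof (intro conjI ballI)
        show "\<exists>\<delta>>0. \<forall>y\<in>F. dist x y < \<delta> \<longrightarrow> y \<in> U" if "x \<in> U" for x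
          using lc[of x] that * by (simp add: subset_iff)
      qed (use * in simp)
      moreover have "openin ?X (F - U)" unfolding op
      proof (intro conjI ballI)
        show "\<exists>\<delta>>0. \<forall>y\<in>F. dist x y < \<delta> \<longrightarrow> y \<in> F - U" if "x \<in> F - U" for x
          using lc[of x] that by simp
      qed simp
      ultimately show "openin ?X U \<and> closedin ?X U" unfolding closedin_def using * by simp
    qed
  qed
  have "zero_dimensional ?X \<longleftrightarrow> (\<forall>W x. openin ?X W \<and> x \<in> W \<longrightarrow> (\<exists>U. (closedin ?X U \<and> openin ?X U) \<and> x \<in> U \<and> U \<subseteq> W))"
    unfolding zero_dimensional_iff_dim_le_0 dimension_le_0_neighbourhood_base_of_clopen
    by (rule open_neighbourhood_base_of) simp
  also have "\<dots> \<longleftrightarrow> small_partitions F"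
  proof
    assume L: "\<forall>W x. openin ?X W \<and> x \<in> W \<longrightarrow> (\<exists>U. (closedin ?X U \<and> openin ?X U) \<and> x \<in> U \<and> U \<subseteq> W)"
    show "small_partitions F"
      unfolding small_partitions_def
    proof (intro ballI allI impI)
      fix x and \<epsilon> :: real assume "x \<in> F" "0 < \<epsilon>"
      moreover have "openin ?X (F \<inter> ball x \<epsilon>)" by (simp add: openin_open_Int)
      ultimately obtain U where "closedin ?X U \<and> openin ?X U" "x \<in> U" "U \<subseteq> F \<inter> ball x \<epsilon>"
        using L[rule_format, of "F \<inter> ball x \<epsilon>" x] by auto
      then show "\<exists>\<phi>. locally_constant_on F \<phi> \<and> \<phi> x \<and> (\<forall>y\<in>F. \<phi> y \<longrightarrow> dist x y < \<epsilon>)"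
        using clopen[of U] by (intro exI[of _ "\<lambda>y. y \<in> U"]) auto
    qed
  next
    assume R: "small_partitions F"
    show "\<forall>W x. openin ?X W \<and> x \<in> W \<longrightarrow> (\<exists>U. (closedin ?X U \<and> openin ?X U) \<and> x \<in> U \<and> U \<subseteq> W)"
    proof (intro allI impI)
      fix W x assume W: "openin ?X W \<and> x \<in> W"
      then obtain \<epsilon> where \<epsilon>: "0 < \<epsilon>" "\<forall>y\<in>F. dist y x < \<epsilon> \<longrightarrow> y \<in> W" "x \<in> F"
        unfolding openin_euclidean_subtopology_iff by blast
      then obtain \<phi> where \<phi>: "locally_constant_on F \<phi>" "\<phi> x" "\<forall>y\<in>F. \<phi> y \<longrightarrow> dist x y < \<epsilon>"
        using R unfolding small_partitions_def by blast
      have "locally_constant_on F (\<lambda>y. y \<in> {y \<in> F. \<phi> y})" using \<phi>(1) unfolding locally_constant_on_def by simp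
      then have "closedin ?X {y \<in> F. \<phi> y} \<and> openin ?X {y \<in> F. \<phi> y}" using clopen[of "{y \<in> F. \<phi> y}"] by blast
      then show "\<exists>U. (closedin ?X U \<and> openin ?X U) \<and> x \<in> U \<and> U \<subseteq> W"
        using \<phi> \<epsilon> by (intro exI[of _ "{y \<in> F. \<phi> y}"]) (auto simp: dist_commute)
    qed
  qed
  finally show ?thesis .
qed

lemma small_partitions_mono:
  assumes "small_partitions F" "G \<subseteq> F"
  shows "small_partitions G"
  unfolding small_partitions_def
proof (intro ballI allI impI)
  fix x and \<epsilon> :: real assume "x \<in> G" "0 < \<epsilon>"
  then obtain \<phi> where \<phi>: "locally_constant_on F \<phi>" "\<phi> x" "\<forall>y\<in>F. \<phi> y \<longrightarrow> dist x y < \<epsilon>"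
    using assms unfolding small_partitions_def by blast
  have "locally_constant_on G \<phi>" using \<phi>(1) assms(2) unfolding locally_constant_on_def by (meson subsetD)
  then show "\<exists>\<phi>. locally_constant_on G \<phi> \<and> \<phi> x \<and> (\<forall>y\<in>G. \<phi> y \<longrightarrow> dist x y < \<epsilon>)"
    using \<phi> assms(2) by (intro exI[of _ \<phi>]) blast
qed

text \<open>A clopen subset \<open>H\<close> of \<open>G\<close> is extended to \<open>F\<close> by the points closer to \<open>H\<close> than to its complement.\<close>

lemma small_partitions_add_isolated:
  assumes G: "small_partitions G" and sub: "G \<subseteq> F"
    and iso: "\<And>x. x \<in> F - G \<Longrightarrow> \<exists>\<delta>>0. \<forall>y\<in>F. y \<noteq> x \<longrightarrow> \<delta> \<le> dist x y"
  shows "small_partitions F"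
  unfolding small_partitions_def
proof (intro ballI allI impI)
  fix x and \<epsilon> :: real assume x: "x \<in> F" and \<epsilon>: "0 < \<epsilon>"
  show "\<exists>\<phi>. locally_constant_on F \<phi> \<and> \<phi> x \<and> (\<forall>y\<in>F. \<phi> y \<longrightarrow> dist x y < \<epsilon>)"
  proof (cases "x \<in> G")
    case False
    then obtain \<delta> where \<delta>: "0 < \<delta>" "\<forall>y\<in>F. y \<noteq> x \<longrightarrow> \<delta> \<le> dist x y" using iso x by blast
    have "locally_constant_on F (\<lambda>y. y = x)"
      unfolding locally_constant_on_def
    proof
      fix y assume y: "y \<in> F"
      show "\<exists>\<delta>>0. \<forall>z\<in>F. dist y z < \<delta> \<longrightarrow> (z = x) = (y = x)"
      proof (cases "y = x")
        case True
        then show ?thesis using \<delta> by (intro exI[of _ \<delta>]) fastforce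
      next
        case False
        then show ?thesis by (intro exI[of _ "dist y x"]) auto
      qed
    qed
    then show ?thesis using \<epsilon> by (intro exI[of _ "\<lambda>y. y = x"]) simp
  next
    case True
    then obtain \<phi> where \<phi>: "locally_constant_on G \<phi>" "\<phi> x" "\<forall>y\<in>G. \<phi> y \<longrightarrow> dist x y < \<epsilon> / 2"
      using G \<epsilon> unfolding small_partitions_def by (metis half_gt_zero)
    \<comment> \<open>The condition \<open>dist y h < \<epsilon> / 2\<close> keeps the extended
      clopen set small.\<close>
    define \<psi> where "\<psi> y \<longleftrightarrow> (\<exists>h\<in>G. \<phi> h \<and> dist y h < \<epsilon> / 2 \<and> (\<forall>m\<in>G. \<not> \<phi> m \<longrightarrow> dist y h < dist y m))" for y
    have "\<exists>\<delta>>0. \<forall>y\<in>F. dist z y < \<delta> \<longrightarrow> \<psi> y = \<psi> z" if z: "z \<in> F" for z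
    proof (cases "z \<in> G")
      case False
      then obtain \<delta> where \<delta>: "0 < \<delta>" "\<forall>y\<in>F. y \<noteq> z \<longrightarrow> \<delta> \<le> dist z y" using iso z by blast
      then show ?thesis by (intro exI[of _ \<delta>]) fastforce
    next
      case zG: True
      obtain \<delta> where \<delta>: "0 < \<delta>" "\<forall>y\<in>G. dist z y < \<delta> \<longrightarrow> \<phi> y = \<phi> z"
        using \<phi>(1) zG unfolding locally_constant_on_def by blast
      have "\<psi> y = \<phi> z" if y: "dist z y < min (\<delta> / 2) (\<epsilon> / 2)" for y
      proof -
        have far: "dist y z < dist y m" if "m \<in> G" "\<phi> m \<noteq> \<phi> z" for m
        proof -
          have "\<delta> \<le> dist z m" using \<delta>(2) that by (meson not_le)
          moreover have "dist z m \<le> dist z y + dist y m" by (rule dist_triangle)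
          ultimately show ?thesis using y by (simp add: dist_commute)
        qed
        show ?thesis
        proof (cases "\<phi> z")
          case True
          then show ?thesis using far zG y unfolding \<psi>_def by (auto simp: dist_commute intro!: bexI[of _ z])
        next
          case False
          then show ?thesis using far zG unfolding \<psi>_def by (metis less_asym)
        qed
      qed
      moreover from this[of z] have "\<psi> z = \<phi> z" using \<delta>(1) \<epsilon> by simp
      ultimately show ?thesis using \<delta>(1) \<epsilon> by (intro exI[of _ "min (\<delta> / 2) (\<epsilon> / 2)"]) simp
    qed
    then have "locally_constant_on F \<psi>" unfolding locally_constant_on_def by blast
    moreover have "\<psi> x" unfolding \<psi>_def using True \<phi>(2) \<epsilon> by (intro bexI[of _ x]) auto
    moreover have "dist x y < \<epsilon>" if "\<psi> y" for y
    proof -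
      obtain h where h: "h \<in> G" "\<phi> h" "dist y h < \<epsilon> / 2" using \<open>\<psi> y\<close> unfolding \<psi>_def by blast
      then show ?thesis using \<phi>(3) dist_triangle_half_r[of h x \<epsilon> y] by (simp add: dist_commute)
    qed
    ultimately show ?thesis by blast
  qed
qed

section \<open>Continuous dependence of the closures in a compactification\<close>

text \<open>Near a missing point \<open>q m\<close> of \<open>C z\<close>, the closures in \<open>M\<close> of the sets \<open>e ` (C z - Q)\<close> need not
  depend continuously on \<open>z\<close>. Adding to \<open>C z - Q\<close> finite sets \<open>net l m\<close> forces the closure to contain
  all limits of \<open>e y\<close> for \<open>y\<close> tending to \<open>q m\<close>.\<close>

locale hyperspace_lift = Metric_space M d for M :: "'k set" and d +
  fixes B Q :: "'a::metric_space set" and q :: "nat \<Rightarrow> 'a" and C :: "(nat \<Rightarrow> bool) \<Rightarrow> 'a set" and e :: "'a \<Rightarrow> 'k"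
  assumes compact_M: "compact_space mtopology" and e_continuous: "continuous_map (top_of_set (B - Q)) mtopology e"
    and compact_B: "compact B" and C_subset: "\<And>z. C z \<subseteq> B" and range_q: "range q = B \<inter> Q"
    and dense: "\<And>m \<delta>. 0 < \<delta> \<Longrightarrow> ball (q m) \<delta> \<inter> (B - Q) \<noteq> {}"
    and upper: "\<And>x z. x \<notin> C z \<Longrightarrow> \<exists>\<delta>>0. \<exists>N. \<forall>z'. (\<forall>n<N. z' n = z n) \<longrightarrow> ball x \<delta> \<inter> C z' = {}"
    and lower: "\<And>x z \<epsilon>. x \<in> C z \<Longrightarrow> 0 < \<epsilon> \<Longrightarrow> \<exists>N. \<forall>z'. (\<forall>n<N. z' n = z n) \<longrightarrow> (\<exists>y\<in>C z'. dist x y < \<epsilon>)"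
begin

definition near_hole :: "nat \<Rightarrow> nat \<Rightarrow> 'a set" where
  "near_hole l m = ball (q m) ((1/2) ^ l) \<inter> (B - Q)"

text \<open>Finiteness is possible because \<open>M\<close> is totally bounded. Density is measured
  in \<open>M\<close> through \<open>e\<close>, since \<open>e\<close> need not be uniformly
  continuous near the hole.\<close>

definition net :: "nat \<Rightarrow> nat \<Rightarrow> 'a set" where
  "net l m = (SOME N. finite N \<and> N \<subseteq> near_hole l m \<and> (\<forall>y\<in>near_hole l m. \<exists>x\<in>N. d (e x) (e y) < (1/2) ^ l))"

text \<open>Asking for some parameter in the cylinder, and not for \<open>q m \<in> C z\<close>
  itself, makes the condition depend on the first \<open>l\<close> entries of \<open>z\<close>
  only.\<close>

definition hit :: "(nat \<Rightarrow> bool) \<Rightarrow> nat \<Rightarrow> nat \<Rightarrow> bool" where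
  "hit z l m \<longleftrightarrow> (\<exists>z'. (\<forall>n<l. z' n = z n) \<and> q m \<in> C z')"

text \<open>The bound \<open>m \<le> l\<close> leaves finitely many nets for each \<open>l\<close>,
  and their radii tend to 0, so the added points can accumulate only at points of
  \<open>C z\<close>.\<close>

definition lift :: "(nat \<Rightarrow> bool) \<Rightarrow> 'a set" where
  "lift z = (C z - Q) \<union> \<Union>{net l m | l m. m \<le> l \<and> hit z l m}"

lemma e_in_M: "x \<in> B - Q \<Longrightarrow> e x \<in> M"
  using e_continuous continuous_map_image_subset_topspace by fastforce

lemma e_near:
  assumes "x \<in> B - Q" "0 < \<epsilon>"
  shows "\<exists>\<delta>>0. \<forall>y\<in>B - Q. dist x y < \<delta> \<longrightarrow> d (e x) (e y) < \<epsilon>"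
proof -
  have "openin (top_of_set (B - Q)) {y \<in> topspace (top_of_set (B - Q)). e y \<in> mball (e x) \<epsilon>}"
    by (rule openin_continuous_map_preimage[OF e_continuous openin_mball])
  moreover have "x \<in> {y \<in> topspace (top_of_set (B - Q)). e y \<in> mball (e x) \<epsilon>}" using assms e_in_M by simp
  ultimately obtain \<delta> where "0 < \<delta>" "\<forall>y\<in>B - Q. dist y x < \<delta> \<longrightarrow> y \<in> {y \<in> topspace (top_of_set (B - Q)). e y \<in> mball (e x) \<epsilon>}"
    unfolding openin_euclidean_subtopology_iff by blast
  then show ?thesis by (intro exI[of _ \<delta>]) (simp add: dist_commute)
qed

lemma net: "finite (net l m)" "net l m \<subseteq> near_hole l m" "y \<in> near_hole l m \<Longrightarrow> \<exists>x\<in>net l m. d (e x) (e y) < (1/2) ^ l"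
proof -
  have "mtotally_bounded (e ` near_hole l m)"
  proof (rule mtotally_bounded_subset)
    show "mtotally_bounded M"
      using compactin_imp_mtotally_bounded compact_M unfolding compact_space_def by simp
    show "e ` near_hole l m \<subseteq> M" using e_in_M unfolding near_hole_def by blast
  qed
  then obtain A where A: "finite A" "A \<subseteq> e ` near_hole l m" "e ` near_hole l m \<subseteq> (\<Union>x\<in>A. mball x ((1/2) ^ l))"
    unfolding mtotally_bounded_def by (meson half_gt_zero zero_less_one zero_less_power)
  obtain N where N: "N \<subseteq> near_hole l m" "finite N" "A = e ` N" using finite_subset_image[OF A(1,2)] by blast
  have "\<forall>y\<in>near_hole l m. \<exists>x\<in>N. d (e x) (e y) < (1/2) ^ l" using A(3) N(3) by (fastforce simp: image_subset_iff)
  then have "\<exists>N. finite N \<and> N \<subseteq> near_hole l m \<and> (\<forall>y\<in>near_hole l m. \<exists>x\<in>N. d (e x) (e y) < (1/2) ^ l)"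
    using N by blast
  from someI_ex[OF this] show "finite (net l m)" "net l m \<subseteq> near_hole l m"
    "y \<in> near_hole l m \<Longrightarrow> \<exists>x\<in>net l m. d (e x) (e y) < (1/2) ^ l" unfolding net_def[symmetric] by blast+
qed

lemma lift_subset: "lift z \<subseteq> B - Q"
proof -
  have "net l m \<subseteq> B - Q" for l m using net(2) unfolding near_hole_def by blast
  then show ?thesis using C_subset unfolding lift_def by blast
qed

lemma hit_cong: "(\<And>n. n < l \<Longrightarrow> z' n = z n) \<Longrightarrow> hit z' l m = hit z l m"
  unfolding hit_def by auto

text \<open>By upper semicontinuity a hole hit at a late stage is far from \<open>x\<close>, and its
  net is close to the hole. So only early nets come near \<open>x\<close>, and these are controlled
  by finitely many entries of \<open>z\<close>.\<close>

lemma outside: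
  assumes "x \<notin> C z"
  shows "\<exists>\<delta>>0. \<exists>N. \<forall>z'. (\<forall>n<N. z' n = z n) \<longrightarrow>
    ball x \<delta> \<inter> lift z' \<subseteq> \<Union>{net l m | l m. m \<le> l \<and> l < N \<and> hit z l m}"
proof -
  obtain \<delta> N0 where \<delta>: "0 < \<delta>" and N0: "\<And>z'. (\<forall>n<N0. z' n = z n) \<Longrightarrow> ball x \<delta> \<inter> C z' = {}"
    using upper[OF assms] by blast
  obtain N1 where N1: "(1/2::real) ^ N1 < \<delta> / 2" using real_arch_pow_inv[of "\<delta> / 2" "1/2"] \<delta> by auto
  define N where "N = max N0 N1"
  have "ball x (\<delta> / 2) \<inter> lift z' \<subseteq> \<Union>{net l m | l m. m \<le> l \<and> l < N \<and> hit z l m}" if z': "\<forall>n<N. z' n = z n" for z'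
  proof
    fix y assume y: "y \<in> ball x (\<delta> / 2) \<inter> lift z'"
    have "ball x \<delta> \<inter> C z' = {}" using N0 z' by (simp add: N_def)
    moreover have xy: "dist x y < \<delta> / 2" using y by simp
    then have "y \<in> ball x \<delta>" using \<delta> by simp
    ultimately have "y \<notin> C z'" by blast
    then obtain l m where lm: "y \<in> net l m" "m \<le> l" "hit z' l m" using y unfolding lift_def by blast
    have "l < N"
    proof (rule ccontr)
      assume l: "\<not> l < N"
      obtain z'' where z'': "\<forall>n<l. z'' n = z' n" "q m \<in> C z''" using lm(3) unfolding hit_def by blast
      have "ball x \<delta> \<inter> C z'' = {}" using N0 z' z''(1) l by (simp add: N_def)
      then have "\<delta> \<le> dist x (q m)" using z''(2) by (meson disjoint_iff mem_ball not_le)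
      moreover have "dist (q m) y < (1/2) ^ l" using subsetD[OF net(2) lm(1)] unfolding near_hole_def by simp
      moreover have "(1/2::real) ^ l \<le> (1/2) ^ N1" using l by (intro power_decreasing) (auto simp: N_def)
      moreover have "dist x (q m) \<le> dist x y + dist (q m) y" by (rule dist_triangle2)
      ultimately show False using N1 xy by linarith
    qed
    moreover from this have "hit z l m" using lm(3) hit_cong[of l z' z m] z' by auto
    ultimately show "y \<in> \<Union>{net l m | l m. m \<le> l \<and> l < N \<and> hit z l m}" using lm by blast
  qed
  then show ?thesis using \<delta> half_gt_zero by blast
qed

lemma isolated:
  assumes "x \<notin> C z"
  shows "\<exists>\<delta>>0. \<forall>y\<in>lift z. y \<noteq> x \<longrightarrow> \<delta> \<le> dist x y"
proof -
  obtain \<delta> N where \<delta>: "0 < \<delta>" and N: "\<forall>z'. (\<forall>n<N. z' n = z n) \<longrightarrow>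
      ball x \<delta> \<inter> lift z' \<subseteq> \<Union>{net l m | l m. m \<le> l \<and> l < N \<and> hit z l m}"
    using outside[OF assms] by (elim exE conjE)
  have "y \<in> (\<Union>l\<in>{..<N}. \<Union>m\<in>{..l}. net l m)" if yU: "y \<in> \<Union>{net l m | l m. m \<le> l \<and> l < N \<and> hit z l m}" for y
  proof -
    obtain A where A: "A \<in> {net l m | l m. m \<le> l \<and> l < N \<and> hit z l m}" "y \<in> A" using yU by (rule UnionE)
    from A(1) obtain l m where "A = net l m \<and> m \<le> l \<and> l < N \<and> hit z l m" unfolding mem_Collect_eq by (elim exE)
    then show ?thesis using A(2) by (intro UN_I[of l] UN_I[of m]) simp_all
  qed
  then have "ball x \<delta> \<inter> lift z \<subseteq> (\<Union>l\<in>{..<N}. \<Union>m\<in>{..l}. net l m)"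
    using N[rule_format, of z] by (meson subset_iff)
  moreover have "finite (\<Union>l\<in>{..<N}. \<Union>m\<in>{..l}. net l m)" using net(1) by simp
  ultimately have "finite (ball x \<delta> \<inter> lift z)" by (rule finite_subset)
  from finite_set_avoid[OF this, of x]
  obtain \<eta> where \<eta>: "0 < \<eta>" "\<forall>y\<in>ball x \<delta> \<inter> lift z. y \<noteq> x \<longrightarrow> \<eta> \<le> dist x y" by blast
  have "min \<delta> \<eta> \<le> dist x y" if "y \<in> lift z" "y \<noteq> x" for y
    using \<eta>(2) that by (cases "dist x y < \<delta>") (auto simp: min_le_iff_disj)
  then show ?thesis using \<delta> \<eta>(1) by (intro exI[of _ "min \<delta> \<eta>"]) simp
qed

lemma closedin_lift: "closedin (top_of_set (B - Q)) (lift z)"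
  unfolding closedin_def openin_euclidean_subtopology_iff
proof (intro conjI ballI)
  show "lift z \<subseteq> topspace (top_of_set (B - Q))" using lift_subset by simp
  fix x assume x: "x \<in> topspace (top_of_set (B - Q)) - lift z"
  then have "x \<notin> C z" unfolding lift_def by auto
  then obtain \<delta> where "0 < \<delta>" "\<forall>y\<in>lift z. y \<noteq> x \<longrightarrow> \<delta> \<le> dist x y" using isolated by blast
  then show "\<exists>\<delta>>0. \<forall>y\<in>B - Q. dist y x < \<delta> \<longrightarrow> y \<in> topspace (top_of_set (B - Q)) - lift z"
    using x by (intro exI[of _ \<delta>]) (fastforce simp: dist_commute)
qed simp

lemma zero_dimensional_lift: "small_partitions (lift z) \<longleftrightarrow> small_partitions (C z - Q)"
proof
  show "small_partitions (C z - Q)" if "small_partitions (lift z)"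
    by (rule small_partitions_mono[OF that]) (simp add: lift_def)
  show "small_partitions (lift z)" if "small_partitions (C z - Q)"
  proof (rule small_partitions_add_isolated[OF that])
    show "C z - Q \<subseteq> lift z" by (simp add: lift_def)
    fix x assume "x \<in> lift z - (C z - Q)"
    then have "x \<notin> C z" using lift_subset by blast
    then show "\<exists>\<delta>>0. \<forall>y\<in>lift z. y \<noteq> x \<longrightarrow> \<delta> \<le> dist x y" by (rule isolated)
  qed
qed


text \<open>Locally on \<open>B\<close>, points of \<open>lift z'\<close> have to be close in
  \<open>M\<close> to points of \<open>lift z\<close>. Off \<open>C z\<close> they are net points of
  \<open>lift z\<close> itself, at points of \<open>C z - Q\<close> continuity of \<open>e\<close>
  suffices, and at a hole a net belonging to \<open>z\<close> serves. Compactness of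
  \<open>B\<close> makes this uniform.\<close>

lemma lift_upper:
  assumes U: "openin mtopology U" and sub: "mtopology closure_of (e ` lift z) \<subseteq> U"
  shows "\<exists>N. \<forall>z'. (\<forall>n<N. z' n = z n) \<longrightarrow> mtopology closure_of (e ` lift z') \<subseteq> U"
proof -
  let ?S = "mtopology closure_of (e ` lift z)"
  have lift_M: "e ` lift z \<subseteq> M" for z using subsetD[OF lift_subset] by (intro image_subsetI e_in_M)
  have S: "e ` lift z \<subseteq> ?S" by (rule closure_of_subset) (simp add: lift_M)
  have "compactin mtopology ?S" by (rule closedin_compact_space[OF compact_M closedin_closure_of])
  then obtain \<eta> where \<eta>: "0 < \<eta>" "\<And>k. k \<in> ?S \<Longrightarrow> mball k \<eta> \<subseteq> U"
    using lebesgue_number[of ?S "{U}"] sub U by auto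
  define good where "good y \<longleftrightarrow> (\<exists>x\<in>lift z. d (e x) (e y) < \<eta> / 2)" for y
  have good_lift: "good y" if "y \<in> lift z" for y
    unfolding good_def using that \<eta>(1) lift_M[of z] by (intro bexI[of _ y]) auto
  have "\<exists>\<delta>>0. \<exists>N. \<forall>z'. (\<forall>n<N. z' n = z n) \<longrightarrow> (\<forall>y\<in>ball x \<delta> \<inter> lift z'. good y)" if x: "x \<in> B" for x
  proof (cases "x \<in> C z")
    case False
    from outside[OF False] obtain \<delta> N where \<delta>: "0 < \<delta>" and N: "\<forall>z'. (\<forall>n<N. z' n = z n) \<longrightarrow>
      ball x \<delta> \<inter> lift z' \<subseteq> \<Union>{net l m | l m. m \<le> l \<and> l < N \<and> hit z l m}" by (elim exE conjE)
    have "{net l m | l m. m \<le> l \<and> l < N \<and> hit z l m} \<subseteq> {net l m | l m. m \<le> l \<and> hit z l m}"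
      by (intro Collect_mono ex_mono impI) simp
    then have sub: "\<Union>{net l m | l m. m \<le> l \<and> l < N \<and> hit z l m} \<subseteq> lift z"
      unfolding lift_def by (intro le_supI2 Union_mono)
    have "good y" if "\<forall>n<N. z' n = z n" "y \<in> ball x \<delta> \<inter> lift z'" for z' y
      using subsetD[OF sub subsetD[OF N[rule_format, of z'] that(2)]] that(1) by (intro good_lift) simp
    then show ?thesis using \<delta> by (intro exI[of _ \<delta>] conjI exI[of _ N]) simp_all
  next
    case xC: True
    show ?thesis
    proof (cases "x \<in> Q")
      case False
      then have xX: "x \<in> B - Q" and xl: "x \<in> lift z" using x xC unfolding lift_def by blast+
      obtain \<delta> where \<delta>: "0 < \<delta>" "\<forall>y\<in>B - Q. dist x y < \<delta> \<longrightarrow> d (e x) (e y) < \<eta> / 2"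
        using e_near[OF xX half_gt_zero[OF \<eta>(1)]] by (elim exE conjE)
      have gd: "good y" if "y \<in> ball x \<delta> \<inter> lift z'" for y z'
        using \<delta>(2) that subsetD[OF lift_subset, of y z'] unfolding good_def by (intro bexI[OF _ xl]) simp
      show ?thesis by (intro exI[of _ \<delta>] conjI exI[of _ 0] allI impI ballI \<delta>(1)) (rule gd)
    next
      case True
      then obtain m where m: "x = q m" using x range_q by blast
      obtain l0 where l0: "(1/2::real) ^ l0 < \<eta> / 2" using real_arch_pow_inv[of "\<eta> / 2" "1/2"] \<eta>(1) by auto
      define l where "l = max l0 m"
      have "(1/2::real) ^ l \<le> (1/2) ^ l0" by (intro power_decreasing) (auto simp: l_def)
      then have l: "(1/2::real) ^ l < \<eta> / 2" using l0 by linarith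
      have ml: "m \<le> l" by (simp add: l_def)
      \<comment> \<open>The hole lies in \<open>C z\<close> itself, so it is hit at every stage, and
        \<open>l\<close> can be as large as the accuracy requires.\<close>
      have "hit z l m" using xC m unfolding hit_def by (intro exI[of _ z]) simp
      then have netl: "net l m \<subseteq> lift z" using ml unfolding lift_def by blast
      have gd: "good y" if "y \<in> ball x ((1/2) ^ l) \<inter> lift z'" for y z'
      proof -
        have "y \<in> near_hole l m" using that subsetD[OF lift_subset, of y z'] m unfolding near_hole_def by simp
        then obtain a where "a \<in> net l m" "d (e a) (e y) < (1/2) ^ l" using net(3) by blast
        then show ?thesis using subsetD[OF netl] l unfolding good_def by (intro bexI[of _ a]) simp_all
      qed
      have "0 < (1/2::real) ^ l" by simp
      then show ?thesis by (intro exI[of _ "(1/2) ^ l"] conjI exI[of _ 0] allI impI ballI) (assumption, rule gd)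
    qed
  qed
  then have "\<forall>x\<in>B. \<exists>\<delta>. 0 < \<delta> \<and> (\<exists>N. \<forall>z'. (\<forall>n<N. z' n = z n) \<longrightarrow> (\<forall>y\<in>ball x \<delta> \<inter> lift z'. good y))" by (rule ballI)
  from bchoice[OF this] obtain \<delta> where \<delta>N: "\<forall>x\<in>B. 0 < \<delta> x \<and>
      (\<exists>N. \<forall>z'. (\<forall>n<N. z' n = z n) \<longrightarrow> (\<forall>y\<in>ball x (\<delta> x) \<inter> lift z'. good y))" by (elim exE)
  then have \<delta>: "\<And>x. x \<in> B \<Longrightarrow> 0 < \<delta> x" by simp
  from \<delta>N have "\<forall>x\<in>B. \<exists>N. \<forall>z'. (\<forall>n<N. z' n = z n) \<longrightarrow> (\<forall>y\<in>ball x (\<delta> x) \<inter> lift z'. good y)" by simp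
  from bchoice[OF this] obtain N where
    N': "\<forall>x\<in>B. \<forall>z'. (\<forall>n<N x. z' n = z n) \<longrightarrow> (\<forall>y\<in>ball x (\<delta> x) \<inter> lift z'. good y)" by (elim exE)
  have N: "good y" if "x \<in> B" "\<forall>n<N x. z' n = z n" "y \<in> ball x (\<delta> x)" "y \<in> lift z'" for x y z'
    using N'[rule_format, OF that(1), of z' y] that(2-4) by simp
  have "B \<subseteq> (\<Union>x\<in>B. ball x (\<delta> x))" using \<delta> by auto
  then obtain A where A: "A \<subseteq> B" "finite A" "B \<subseteq> (\<Union>x\<in>A. ball x (\<delta> x))"
    using compactE_image[OF compact_B, of B "\<lambda>x. ball x (\<delta> x)"] by auto
  define L where "L = Max (insert 0 (N ` A))"
  have L: "N x \<le> L" if "x \<in> A" for x unfolding L_def using that A(2) by (intro Max_ge) auto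
  have "mtopology closure_of (e ` lift z') \<subseteq> U" if z': "\<forall>n<L. z' n = z n" for z'
  proof
    fix k assume k: "k \<in> mtopology closure_of (e ` lift z')"
    then have "\<forall>r>0. \<exists>y\<in>e ` lift z'. y \<in> mball k r"
      unfolding metric_closure_of mem_Collect_eq by (rule conjunct2)
    then have "\<exists>y\<in>e ` lift z'. y \<in> mball k (\<eta> / 2)" using half_gt_zero[OF \<eta>(1)] by (elim allE impE)
    then obtain y where y: "y \<in> lift z'" "e y \<in> mball k (\<eta> / 2)" unfolding bex_simps by (elim bexE)
    have "y \<in> B" using subsetD[OF lift_subset y(1)] by simp
    then obtain x where x: "x \<in> A" "y \<in> ball x (\<delta> x)" using A(3) by blast
    have "good y" proof (rule N[OF _ _ x(2) y(1)])
      show "x \<in> B" using x(1) A(1) by blast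
      show "\<forall>n<N x. z' n = z n" using L[OF x(1)] z' by simp
    qed
    then obtain a where a: "a \<in> lift z" "d (e a) (e y) < \<eta> / 2" unfolding good_def by blast
    have mem: "e a \<in> M" "e y \<in> M" "k \<in> M"
      using e_in_M[OF subsetD[OF lift_subset a(1)]] y(2) by simp_all
    have "d (e a) k \<le> d (e a) (e y) + d (e y) k" by (rule triangle[OF mem])
    moreover have "d (e y) k < \<eta> / 2" using y(2) by (simp add: commute)
    ultimately have "k \<in> mball (e a) \<eta>" using a(2) mem by simp
    moreover have "e a \<in> ?S" using S a(1) by blast
    ultimately show "k \<in> U" using \<eta>(2) by blast
  qed
  then show ?thesis by blast
qed

text \<open>An open set meets the closure iff it meets the set. The point of \<open>C z'\<close>
  provided by \<open>lower\<close> may be a hole, and then a net point next to the hole replaces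
  it.\<close>

lemma lift_lower:
  assumes U: "openin mtopology U" and ne: "mtopology closure_of (e ` lift z) \<inter> U \<noteq> {}"
  shows "\<exists>N. \<forall>z'. (\<forall>n<N. z' n = z n) \<longrightarrow> mtopology closure_of (e ` lift z') \<inter> U \<noteq> {}"
proof -
  have meets: "mtopology closure_of (e ` lift z) \<inter> U \<noteq> {} \<longleftrightarrow> (\<exists>y\<in>lift z. e y \<in> U)" for z
  proof -
    have "mtopology closure_of (e ` lift z) \<inter> U \<noteq> {} \<longleftrightarrow> U \<inter> e ` lift z \<noteq> {}"
      unfolding Int_commute[of _ U] openin_Int_closure_of_eq_empty[OF U, of "e ` lift z"] ..
    also have "\<dots> \<longleftrightarrow> (\<exists>y\<in>lift z. e y \<in> U)" by blast
    finally show ?thesis .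
  qed
  obtain x where x: "x \<in> lift z" "e x \<in> U" using ne[unfolded meets] by (elim bexE)
  have "\<exists>N. \<forall>z'. (\<forall>n<N. z' n = z n) \<longrightarrow> (\<exists>y\<in>lift z'. e y \<in> U)"
  proof (cases "x \<in> C z")
    case False
    then obtain l m where lm: "x \<in> net l m" "m \<le> l" "hit z l m" using x(1) unfolding lift_def by blast
    have "\<exists>y\<in>lift z'. e y \<in> U" if z': "\<forall>n<l. z' n = z n" for z'
    proof (rule bexI[of _ x])
      show "e x \<in> U" by (rule x(2))
      have "hit z' l m" using lm(3) hit_cong[of l z' z m] z' by simp
      then show "x \<in> lift z'" using lm(1,2) unfolding lift_def by blast
    qed
    then show ?thesis by (intro exI[of _ l]) simp
  next
    case True
    have xX: "x \<in> B - Q" using x(1) lift_subset by blast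
    obtain r where r: "0 < r" "mball (e x) r \<subseteq> U" using U x(2) unfolding openin_mtopology by blast
    obtain \<delta> where \<delta>: "0 < \<delta>" "\<forall>y\<in>B - Q. dist x y < \<delta> \<longrightarrow> d (e x) (e y) < r" using e_near[OF xX r(1)] by blast
    have inU: "e y \<in> U" if "y \<in> B - Q" "dist x y < \<delta>" for y
    proof -
      have "e y \<in> mball (e x) r" using \<delta>(2) that e_in_M[OF xX] e_in_M[OF that(1)] by simp
      then show ?thesis using r(2) by blast
    qed
    obtain N where N: "\<And>z'. (\<forall>n<N. z' n = z n) \<Longrightarrow> \<exists>y\<in>C z'. dist x y < \<delta> / 2"
      using lower[OF True half_gt_zero[OF \<delta>(1)]] by blast
    have "\<exists>y\<in>lift z'. e y \<in> U" if z': "\<forall>n<N. z' n = z n" for z'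
    proof -
      obtain y where y: "y \<in> C z'" "dist x y < \<delta> / 2" using N[OF z'] by blast
      show ?thesis
      proof (cases "y \<in> Q")
        case False
        show ?thesis
        proof (rule bexI)
          show yl: "y \<in> lift z'" using False y(1) unfolding lift_def by blast
          show "e y \<in> U" using subsetD[OF lift_subset yl] y(2) \<delta>(1) by (intro inU) simp_all
        qed
      next
        case True
        then obtain m where m: "y = q m" using y(1) C_subset range_q by blast
        obtain l0 where l0: "(1/2::real) ^ l0 < \<delta> / 2" using real_arch_pow_inv[of "\<delta> / 2" "1/2"] \<delta>(1) by auto
        define l where "l = max l0 m"
        have "(1/2::real) ^ l \<le> (1/2) ^ l0" by (intro power_decreasing) (auto simp: l_def)
        then have l: "(1/2::real) ^ l < \<delta> / 2" using l0 by linarith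
        have ml: "m \<le> l" by (simp add: l_def)
        have "near_hole l m \<noteq> {}" unfolding near_hole_def by (rule dense) simp
        then obtain a where a: "a \<in> net l m" using net(3) by blast
        have "hit z' l m" using y(1) m unfolding hit_def by (intro exI[of _ z']) simp
        then have "a \<in> lift z'" using a ml unfolding lift_def by blast
        moreover have "dist x a < \<delta>"
        proof -
          have "dist y a < (1/2) ^ l" using subsetD[OF net(2) a] m unfolding near_hole_def by simp
          then show ?thesis using dist_triangle[of x a y] y(2) l by linarith
        qed
        ultimately have "e a \<in> U" using subsetD[OF lift_subset] by (intro inU)
        then show ?thesis using \<open>a \<in> lift z'\<close> by (rule bexI)
      qed
    qed
    then show ?thesis by (intro exI[of _ N]) simp
  qed
  then show ?thesis unfolding meets .
qed

theorem continuous_lift: "continuous_map cantor_space (admissible_topology (top_of_set (B - Q)) mtopology e) lift"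
  unfolding admissible_topology_def
proof (rule continuous_map_pullback')
  let ?f = "(\<lambda>F. mtopology closure_of (e ` F)) \<circ> lift"
  let ?S = "{{C. C \<subseteq> U} | U. openin mtopology U} \<union> {{C. C \<inter> U \<noteq> {}} | U. openin mtopology U}"
  show "topspace cantor_space \<subseteq> lift -` closed_sets (top_of_set (B - Q))"
    unfolding closed_sets_def by (intro subsetI vimageI2 CollectI closedin_lift)
  have "compactin mtopology (?f z)" for z
    unfolding comp_def by (rule closedin_compact_space[OF compact_M closedin_closure_of])
  moreover have "continuous_map cantor_space (topology_generated_by ?S) ?f"
  proof (rule continuous_on_generated_topo)
    have M: "{C. C \<subseteq> M} \<in> ?S"
      by (intro UnI1 CollectI exI[of _ M] conjI refl) (metis openin_topspace topspace_mtopology)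
    show "?f ` topspace cantor_space \<subseteq> \<Union>?S"
    proof (rule image_subsetI, rule UnionI[OF M])
      fix z show "?f z \<in> {C. C \<subseteq> M}" using closure_of_subset_topspace[of mtopology "e ` lift z"] by simp
    qed
    fix V assume "V \<in> ?S"
    then obtain U where U: "openin mtopology U" "V = {C. C \<subseteq> U} \<or> V = {C. C \<inter> U \<noteq> {}}"
      by (elim UnE CollectE exE conjE) simp_all
    show "openin cantor_space (?f -` V \<inter> topspace cantor_space)"
    proof (rule openin_discrete_product_if_cylinder)
      have mem: "z \<in> ?f -` V \<inter> topspace cantor_space \<longleftrightarrow> mtopology closure_of (e ` lift z) \<in> V" for z by simp
      fix z assume "z \<in> ?f -` V \<inter> topspace cantor_space"
      then have z: "mtopology closure_of (e ` lift z) \<in> V" unfolding mem .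
      show "\<exists>N. \<forall>z'. (\<forall>n<N. z' n = z n) \<longrightarrow> z' \<in> ?f -` V \<inter> topspace cantor_space"
        unfolding mem using U(2)
      proof
        assume V: "V = {C. C \<subseteq> U}"
        show "\<exists>N. \<forall>z'. (\<forall>n<N. z' n = z n) \<longrightarrow> mtopology closure_of (e ` lift z') \<in> V"
          using lift_upper[OF U(1), of z] z unfolding V mem_Collect_eq by (elim meta_impE)
      next
        assume V: "V = {C. C \<inter> U \<noteq> {}}"
        show "\<exists>N. \<forall>z'. (\<forall>n<N. z' n = z n) \<longrightarrow> mtopology closure_of (e ` lift z') \<in> V"
          using lift_lower[OF U(1), of z] z unfolding V mem_Collect_eq by (elim meta_impE)
      qed
    qed
  qed
  ultimately show "continuous_map cantor_space (vietoris mtopology) ?f"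
    unfolding vietoris_def continuous_map_in_subtopology by (intro conjI) (assumption, simp)
qed

end

section \<open>Assembling the reduction\<close>

lemma small_partitions_homeomorphism:
  assumes G: "small_partitions G" and hom: "homeomorphism G H f g"
  shows "small_partitions H"
  unfolding small_partitions_def
proof (intro ballI allI impI)
  fix x and \<epsilon> :: real assume x: "x \<in> H" and \<epsilon>: "0 < \<epsilon>"
  have g: "g y \<in> G" "f (g y) = y" if "y \<in> H" for y using hom that unfolding homeomorphism_def by auto
  have "continuous_on G f" "continuous_on H g" using hom unfolding homeomorphism_def by auto
  note cont = this[unfolded continuous_on_iff]
  obtain \<delta> where \<delta>: "0 < \<delta>" "\<forall>y\<in>G. dist y (g x) < \<delta> \<longrightarrow> dist (f y) (f (g x)) < \<epsilon>"
    using cont(1)[rule_format, OF g(1)[OF x] \<epsilon>] by (elim exE conjE)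
  obtain \<phi> where \<phi>: "locally_constant_on G \<phi>" "\<phi> (g x)" "\<forall>y\<in>G. \<phi> y \<longrightarrow> dist (g x) y < \<delta>"
    using G[unfolded small_partitions_def, rule_format, OF g(1)[OF x] \<delta>(1)] by (elim exE conjE)
  have "\<exists>\<delta>>0. \<forall>z\<in>H. dist y z < \<delta> \<longrightarrow> \<phi> (g z) = \<phi> (g y)" if y: "y \<in> H" for y
  proof -
    obtain \<eta> where \<eta>: "0 < \<eta>" "\<forall>z\<in>G. dist (g y) z < \<eta> \<longrightarrow> \<phi> z = \<phi> (g y)"
      using \<phi>(1)[unfolded locally_constant_on_def, rule_format, OF g(1)[OF y]] by (elim exE conjE)
    obtain \<theta> where \<theta>: "0 < \<theta>" "\<forall>z\<in>H. dist z y < \<theta> \<longrightarrow> dist (g z) (g y) < \<eta>"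
      using cont(2)[rule_format, OF y \<eta>(1)] by (elim exE conjE)
    have "\<phi> (g z) = \<phi> (g y)" if "z \<in> H" "dist y z < \<theta>" for z
    proof -
      have "dist (g y) (g z) < \<eta>" using \<theta>(2)[rule_format, OF that(1)] that(2) by (simp add: dist_commute)
      then show ?thesis using \<eta>(2) g(1)[OF that(1)] by simp
    qed
    then show ?thesis using \<theta>(1) by (intro exI[of _ \<theta>]) simp
  qed
  then have "locally_constant_on H (\<lambda>y. \<phi> (g y))" unfolding locally_constant_on_def by simp
  moreover have "dist x y < \<epsilon>" if "y \<in> H" "\<phi> (g y)" for y
    using \<phi>(3) \<delta>(2) g[OF that(1)] g(2)[OF x] that(2) by (metis dist_commute)
  ultimately show "\<exists>\<phi>. locally_constant_on H \<phi> \<and> \<phi> x \<and> (\<forall>y\<in>H. \<phi> y \<longrightarrow> dist x y < \<epsilon>)"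
    using \<phi>(2) by (intro exI[of _ "\<lambda>y. \<phi> (g y)"]) simp
qed

lemma countable_rational_vectors: "countable {x :: real ^ 'n. \<forall>i. x $ i \<in> \<rat>}"
proof (rule countable_subset)
  show "{x :: real ^ 'n. \<forall>i. x $ i \<in> \<rat>} \<subseteq> vec_lambda ` (\<Pi>\<^sub>E i\<in>UNIV. \<rat>)"
  proof
    fix x :: "real ^ 'n" assume "x \<in> {x. \<forall>i. x $ i \<in> \<rat>}"
    then show "x \<in> vec_lambda ` (\<Pi>\<^sub>E i\<in>UNIV. \<rat>)" by (intro image_eqI[of _ _ "vec_nth x"]) auto
  qed
  show "countable (vec_lambda ` (\<Pi>\<^sub>E i\<in>UNIV. \<rat>) :: (real ^ 'n) set)"
    by (intro countable_image countable_PiE countable_rat) simp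
qed

lemma irrational_vector_near:
  fixes x :: "real ^ 'n"
  assumes x: "\<forall>i. x $ i \<in> {0..1}" and \<delta>: "0 < \<delta>"
  shows "\<exists>y. dist x y < \<delta> \<and> (\<forall>i. y $ i \<in> {0..1}) \<and> \<not> (\<forall>i. y $ i \<in> \<rat>)"
proof -
  \<comment> \<open>An arbitrary coordinate; making a single one irrational is enough.\<close>
  define i :: 'n where "i = undefined"
  have "0 \<le> x $ i" "x $ i \<le> 1" using x by simp_all
  then have "max 0 (x $ i - \<delta>) < min 1 (x $ i + \<delta>)" using \<delta> by (simp add: max_def min_def)
  then have "uncountable {max 0 (x $ i - \<delta>)<..<min 1 (x $ i + \<delta>)}" by (simp only: uncountable_open_interval)
  then obtain s where s: "s \<notin> \<rat>" "max 0 (x $ i - \<delta>) < s" "s < min 1 (x $ i + \<delta>)"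
    using countable_rat countable_subset[of "{max 0 (x $ i - \<delta>)<..<min 1 (x $ i + \<delta>)}" \<rat>]
    by (metis greaterThanLessThan_iff subsetI)
  define y where "y = (\<chi> k. if k = i then s else x $ k)"
  have "dist x y \<le> (\<Sum>k\<in>UNIV. \<bar>(x - y) $ k\<bar>)" unfolding dist_norm by (rule norm_le_l1_cart)
  also have "\<dots> = (\<Sum>k\<in>UNIV. if k = i then \<bar>x $ i - s\<bar> else 0)" by (rule sum.cong) (simp_all add: y_def)
  also have "\<dots> = \<bar>x $ i - s\<bar>" by simp
  also have "\<dots> < \<delta>" using s(2,3) by (simp add: abs_less_iff)
  finally have "dist x y < \<delta>" .
  moreover have "\<forall>k. y $ k \<in> {0..1}" using x s(2,3) by (simp add: y_def)
  moreover have "y $ i \<notin> \<rat>" using s(1) by (simp add: y_def)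
  ultimately show ?thesis by blast
qed

theorem theorem1p4:
  fixes K :: "'k topology" and e :: "real ^ 5 \<Rightarrow> 'k"
  assumes "compact_space K" and "metrizable_space K"
    and "embedding_map cube_minus_rationals K e"
  shows "hard_for (game_class fsigma_in)
           (admissible_topology cube_minus_rationals K e)
           (zero_dim_closed_sets cube_minus_rationals)"
  unfolding hard_for_def
proof (intro allI impI)
  fix A assume "game_class fsigma_in cantor_space A"
  then show "\<exists>\<phi>. continuous_map cantor_space (admissible_topology cube_minus_rationals K e) \<phi> \<and>
      A = \<phi> -` zero_dim_closed_sets cube_minus_rationals" (is ?goal)
  proof (rule game_class_fsigma_colouring)
    fix c assume local: "\<And>z z' p. (\<And>n. n < length p \<Longrightarrow> z n = z' n) \<Longrightarrow> c z p = c z' p"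
      and win: "\<And>z. z \<in> A \<longleftrightarrow> (\<exists>f. colour_win (c z) f)"
    obtain S where S: "good_levels S" "countable (removed S)" using good_levels_exist by (elim exE conjE)
    show ?goal
    proof (rule rational_embedding[OF S(2)])
      fix \<Theta> :: "pt \<Rightarrow> real ^ 5" assume \<Theta>: "continuous_on UNIV \<Theta>" "inj \<Theta>"
        "\<And>x i. x \<in> Delta \<Longrightarrow> \<Theta> x $ i \<in> {0..1}" "\<And>x. (\<forall>i. \<Theta> x $ i \<in> \<rat>) \<longleftrightarrow> x \<in> removed S"
      obtain M d where "Metric_space M d" and K: "K = Metric_space.mtopology M d"
        using assms(2) unfolding metrizable_space_def by (elim exE conjE)
      then interpret Metric_space M d by simp
      define B :: "(real ^ 5) set" where "B = {x. \<forall>i. x $ i \<in> {0..1}}"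
      define Q :: "(real ^ 5) set" where "Q = {x. \<forall>i. x $ i \<in> \<rat>}"
      have X: "cube_minus_rationals = top_of_set (B - Q)" unfolding cube_minus_rationals_def B_def Q_def ..
      define E where "E z = game_continuum (c z) []" for z
      have ED: "E z \<subseteq> Delta" for z unfolding E_def by (rule game_continuum_subset)
      define q where "q = from_nat_into (B \<inter> Q)"
      have q: "range q = B \<inter> Q"
        unfolding q_def
      proof (rule range_from_nat_into)
        have "0 \<in> B \<inter> Q" by (simp add: B_def Q_def)
        then show "B \<inter> Q \<noteq> {}" by blast
        show "countable (B \<inter> Q)" using countable_subset[OF Int_lower2] countable_rational_vectors unfolding Q_def by blast
      qed
      \<comment> \<open>The colour of \<open>p\<close> depends on the first \<open>length p\<close>
        entries of the parameter, so finitely many colours are fixed by a common initial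
        part.\<close>
      have agree: "\<exists>N. \<forall>z'. (\<forall>n<N. z' n = z n) \<longrightarrow> (\<forall>p\<in>P. c z' p = c z p)" if "finite P" for P z
      proof -
        have eq: "c z' p = c z p" if "\<forall>n<Max (insert 0 (length ` P)). z' n = z n" "p \<in> P" for z' p
        proof -
          have "length p \<le> Max (insert 0 (length ` P))" using \<open>finite P\<close> that(2) by (intro Max_ge) auto
          then show ?thesis using that(1) by (intro local) simp
        qed
        show ?thesis by (intro exI[of _ "Max (insert 0 (length ` P))"] allI impI ballI) (rule eq)
      qed
      interpret hyperspace_lift M d B Q q "\<lambda>z. \<Theta> ` E z" e
      proof unfold_locales
        show "compact_space mtopology" using assms(1) K by simp
        show "continuous_map (top_of_set (B - Q)) mtopology e"
          using homeomorphic_imp_continuous_map[OF assms(3)[unfolded embedding_map_def X K]]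
          unfolding continuous_map_in_subtopology by (rule conjunct1)
        have "B = cbox 0 1" unfolding B_def by (auto simp: mem_box_cart)
        then show "compact B" by simp
        show "\<Theta> ` E z \<subseteq> B" for z using \<Theta>(3) ED unfolding B_def by blast
        show "range q = B \<inter> Q" by (rule q)
        show "ball (q m) \<delta> \<inter> (B - Q) \<noteq> {}" if pos: "0 < \<delta>" for m \<delta>
        proof -
          have "q m \<in> B" using q by blast
          then have "\<forall>i. q m $ i \<in> {0..1}" unfolding B_def mem_Collect_eq .
          from irrational_vector_near[OF this pos]
          obtain y where "dist (q m) y < \<delta>" "\<forall>i. y $ i \<in> {0..1}" "\<not> (\<forall>i. y $ i \<in> \<rat>)" by (elim exE conjE)
          then have "y \<in> ball (q m) \<delta> \<inter> (B - Q)" unfolding B_def Q_def by simp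
          then show ?thesis by blast
        qed
      next
        fix x z assume x: "x \<notin> \<Theta> ` E z"
        have far: "\<exists>\<delta>>0. ball x \<delta> \<inter> \<Theta> ` Y = {}" if Y: "compact Y" "x \<notin> \<Theta> ` Y" for Y
        proof -
          have "closed (\<Theta> ` Y)"
            using compact_continuous_image[OF continuous_on_subset[OF \<Theta>(1)] Y(1)] compact_imp_closed by simp
          then have "open (- (\<Theta> ` Y))" "x \<in> - (\<Theta> ` Y)" using Y(2) by (simp_all add: open_Compl)
          then obtain \<delta> where "0 < \<delta>" "ball x \<delta> \<subseteq> - (\<Theta> ` Y)" by (rule openE)
          then show ?thesis by (intro exI[of _ \<delta>]) blast
        qed
        show "\<exists>\<delta>>0. \<exists>N. \<forall>z'. (\<forall>n<N. z' n = z n) \<longrightarrow> ball x \<delta> \<inter> \<Theta> ` E z' = {}"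
        proof (cases "x \<in> \<Theta> ` Delta")
          case False
          from far[OF compact_Delta this] obtain \<delta> where \<delta>: "0 < \<delta>" "ball x \<delta> \<inter> \<Theta> ` Delta = {}" by (elim exE conjE)
          then have "ball x \<delta> \<inter> \<Theta> ` E z' = {}" for z' using ED[of z'] by blast
          then show ?thesis using \<delta>(1) by (intro exI[of _ \<delta>] conjI exI[of _ 0] allI impI)
        next
          case True
          then obtain y where y: "y \<in> Delta" "x = \<Theta> y" by blast
          then have "y \<notin> game_continuum (c z) []" using x unfolding E_def by blast
          from game_continuum_upper_semicontinuous[OF this]
          obtain \<eta> P where \<eta>: "0 < \<eta>" and P: "finite P"
            "\<forall>c'. (\<forall>p\<in>P. c' p = c z p) \<longrightarrow> ball y \<eta> \<inter> game_continuum c' [] = {}" by (elim exE conjE)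
          have comp: "compact (Delta - ball y \<eta>)" using compact_Delta by (intro compact_diff) simp_all
          have "x \<notin> \<Theta> ` (Delta - ball y \<eta>)"
          proof
            assume "x \<in> \<Theta> ` (Delta - ball y \<eta>)"
            then obtain w where "x = \<Theta> w" "w \<in> Delta - ball y \<eta>" by (rule imageE)
            then show False using injD[OF \<Theta>(2), of y w] y(2) \<eta> by simp
          qed
          from far[OF comp this] obtain \<delta> where \<delta>: "0 < \<delta>" "ball x \<delta> \<inter> \<Theta> ` (Delta - ball y \<eta>) = {}" by (elim exE conjE)
          obtain N where N: "\<forall>z'. (\<forall>n<N. z' n = z n) \<longrightarrow> (\<forall>p\<in>P. c z' p = c z p)" using agree[OF P(1), of z] by (elim exE)
          have "ball x \<delta> \<inter> \<Theta> ` E z' = {}" if z': "\<forall>n<N. z' n = z n" for z'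
          proof -
            have "ball y \<eta> \<inter> E z' = {}" using P(2) N z' unfolding E_def by blast
            then have "E z' \<subseteq> Delta - ball y \<eta>" using ED by blast
            then show ?thesis using \<delta>(2) by blast
          qed
          then show ?thesis using \<delta>(1) by (intro exI[of _ \<delta>] conjI exI[of _ N] allI impI)
        qed
      next
        fix x z and \<epsilon> :: real assume x: "x \<in> \<Theta> ` E z" and \<epsilon>: "0 < \<epsilon>"
        obtain y where y: "y \<in> game_continuum (c z) []" "x = \<Theta> y" using x unfolding E_def by blast
        obtain \<delta> where \<delta>: "0 < \<delta>" "\<forall>y'\<in>UNIV. dist y' y < \<delta> \<longrightarrow> dist (\<Theta> y') (\<Theta> y) < \<epsilon>"
          using \<Theta>(1)[unfolded continuous_on_iff, rule_format, OF UNIV_I[of y] \<epsilon>] by (elim exE conjE)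
        obtain n where n: "(1/2::real) ^ n < \<delta> / 3" using real_arch_pow_inv[of "\<delta> / 3" "1/2"] \<delta>(1) by auto
        obtain P where P: "finite P"
          "\<forall>c'. (\<forall>p\<in>P. c' p = c z p) \<longrightarrow> (\<exists>y'\<in>game_continuum c' []. near_by ((1/2) ^ n) y y')"
          using game_continuum_lower_semicontinuous[OF y(1), of n] by (elim exE conjE)
        obtain N where N: "\<forall>z'. (\<forall>n<N. z' n = z n) \<longrightarrow> (\<forall>p\<in>P. c z' p = c z p)" using agree[OF P(1), of z] by (elim exE)
        have "\<exists>w\<in>\<Theta> ` E z'. dist x w < \<epsilon>" if z': "\<forall>n<N. z' n = z n" for z'
        proof -
          obtain y' where y': "y' \<in> E z'" "near_by ((1/2) ^ n) y y'" using P(2) N z' unfolding E_def by blast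
          have "dist y' y < \<delta>" using dist_le_of_near_by[OF y'(2)] n by (simp add: dist_commute)
          then have "dist x (\<Theta> y') < \<epsilon>" using \<delta>(2)[rule_format, OF UNIV_I, of y'] y(2) by (simp add: dist_commute)
          then show ?thesis using y'(1) by blast
        qed
        then show "\<exists>N. \<forall>z'. (\<forall>n<N. z' n = z n) \<longrightarrow> (\<exists>w\<in>\<Theta> ` E z'. dist x w < \<epsilon>)"
          by (intro exI[of _ N] allI impI)
      qed
      have "z \<in> A \<longleftrightarrow> lift z \<in> zero_dim_closed_sets cube_minus_rationals" for z
      proof -
        let ?G = "E z - removed S"
        have "z \<in> A \<longleftrightarrow> small_partitions ?G"
        proof
          assume "z \<in> A"
          then obtain f where f: "colour_win (c z) f" using win by blast
          show "small_partitions ?G"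
            unfolding small_partitions_def E_def
            by (intro ballI allI impI winning_imp_small_partitions[OF S(1) f])
        next
          assume sp: "small_partitions ?G"
          have mem: "src \<in> ?G" "tgt \<in> ?G"
            using ends_in_game_continuum deep_not_removed[OF S(1) vertices_deep[OF corner_vertex]]
            unfolding E_def corner_def by blast+
          obtain \<phi> where \<phi>: "locally_constant_on ?G \<phi>" "\<phi> src" "\<forall>y\<in>?G. \<phi> y \<longrightarrow> dist src y < 1"
            using sp[unfolded small_partitions_def, rule_format, OF mem(1) zero_less_one] by (elim exE conjE)
          \<comment> \<open>The strict bound 1 in the choice of \<open>\<phi>\<close> thus puts
            \<open>tgt\<close> outside the clopen set of \<open>src\<close>.\<close>
          have "dist src tgt = 1" by (simp add: src_def tgt_def dist_prod_def)
          then have "\<phi> src \<noteq> \<phi> tgt" using \<phi>(2,3) mem(2) by (metis less_irrefl)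
          then show "z \<in> A" using separation_imp_winning[OF S(1)] \<phi>(1) win unfolding E_def by blast
        qed
        also have "\<dots> \<longleftrightarrow> small_partitions (\<Theta> ` E z - Q)"
        proof -
          have "compact (E z)" unfolding E_def by (rule compact_game_continuum)
          then obtain g where g: "homeomorphism (E z) (\<Theta> ` E z) \<Theta> g"
            using homeomorphism_compact[of "E z" \<Theta>, OF _ continuous_on_subset[OF \<Theta>(1)] refl inj_on_subset[OF \<Theta>(2)]] by blast
          have img: "\<Theta> ` ?G = \<Theta> ` E z - Q" using \<Theta>(4) unfolding Q_def by blast
          have hom: "homeomorphism ?G (\<Theta> ` E z - Q) \<Theta> g"
            by (rule homeomorphism_of_subsets[OF g Diff_subset subset_refl img])
          then show ?thesis
            using small_partitions_homeomorphism[of ?G "\<Theta> ` E z - Q" \<Theta> g]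
              small_partitions_homeomorphism[of "\<Theta> ` E z - Q" ?G g \<Theta>] homeomorphism_symD[OF hom] by blast
        qed
        also have "\<dots> \<longleftrightarrow> small_partitions (lift z)" by (rule zero_dimensional_lift[symmetric])
        also have "\<dots> \<longleftrightarrow> lift z \<in> zero_dim_closed_sets cube_minus_rationals"
        proof -
          have "subtopology cube_minus_rationals (lift z) = top_of_set (lift z)"
            unfolding X subtopology_subtopology using lift_subset[of z] by (simp add: inf.absorb2)
          then show ?thesis
            using closedin_lift[of z] unfolding zero_dim_closed_sets_def closed_sets_def X[symmetric]
            by (simp add: zero_dimensional_iff_small_partitions)
        qed
        finally show ?thesis .
      qed
      then have "A = lift -` zero_dim_closed_sets cube_minus_rationals" by (intro set_eqI) simp
      with continuous_lift show ?goal unfolding X[symmetric] K[symmetric] by (intro exI[of _ lift] conjI)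
    qed
  qed
qed

end
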